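(* Let $n\ge3$. The group of conformal transformations in $\mathbb{R}^n$ acts on the set of limiting Carleman weights (LCWs) by $\psi\mapsto F^*\psi=\psi\circ F$. This action, combined with the action $\psi\mapsto a\psi+b$ where $a\in\mathbb{R}\setminus\{0\}$ and $b\in\mathbb{R}$, has exactly three orbits, given by the following representatives ($e_1$ and $e_2$ are the first two vectors of the canonical basis): $$\psi_1(x)=e_1\cdot x,\qquad \psi_2(x)=\log|x|,\qquad \psi_3(x)=\arctan\frac{e_1\cdot x}{e_2\cdot x}.$$ In other words, for any LCW $\varphi$ defined in an open set $\Omega\subset\mathbb{R}^n$, there is exactly one $i\in\{1,2,3\}$, a conformal transformation $F$ defined on the one point compactification of $\mathbb{R}^n$, and two real numbers $a,b$ with $a\neq0$, such that $\varphi$ is the restriction of $a(\psi_i\circ F)+b$ to $\Omega$. If one only considers affine conformal mappings (without the inversion), there are exactly six orbits, corresponding to the following six families, where $\gamma,\sigma\in\mathbb{R}^n$ satisfy $|\gamma|=|\sigma|=1$ and $\gamma\cdot\sigma=0$, and $s>0$: $$\gamma\cdot x;\qquad \log|x|;\qquad \arctan\frac{\gamma\cdot x}{\sigma\cdot x};\qquad -2\frac{\gamma\cdot x}{|x|^2};\qquad \frac1{\sqrt s}\arctan\frac{-2\gamma\cdot x/\sqrt s}{|x|^2/s-1};\qquad \frac1{\sqrt s}\,\mathrm{arctanh}\,\frac{-2\gamma\cdot x/\sqrt s}{|x|^2/s+1}.$$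
   Context: Limiting Carleman weight (LCW): a real-valued $\varphi\in C^\infty(M)$ on an open Riemannian manifold $(M,g)$ of dimension $n\geq 3$ with $d\varphi\neq0$ everywhere and such that $\mathrm{Hess}_g\varphi(\nabla\varphi,\nabla\varphi)+\mathrm{Hess}_g\varphi(V,V)=0$ at every point $p$ and for every $V\in T_pM$ with $|V|=|\nabla\varphi|$ and $\langle V,\nabla\varphi\rangle=0$. Equivalently, $d\varphi\ne0$ everywhere and $|\nabla\varphi|^{-2}\nabla\varphi$ is a conformal Killing vector field. Here $M=\Omega$ is an open subset of $\mathbb{R}^n$ with the Euclidean metric. The conformal transformations of the one point compactification $\mathbb{R}^n\cup\{\infty\}$ are the compositions of translations, dilations, orthogonal maps and the inversion $x\mapsto x/|x|^2$; the affine conformal mappings are the compositions of translations, dilations and orthogonal maps only.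
   Formalization: In the two classification claims Ω is taken nonempty and connected (on a disconnected Ω different weights on different components refute the claim), and arctan is read as a continuous branch of the multivalued arctangent, since the principal branch fails e.g. on slit domains. *)

theory Defs
  imports "HOL-Analysis.Analysis" "HOL-Algebra.Bij"
begin

section \<open>Limiting Carleman weights on open subsets of Euclidean space\<close>

text \<open>
  Functions on an open set \<open>\<Omega>\<close> are total functions whose values outside \<open>\<Omega>\<close> are irrelevant:
  all derivatives below are taken at points of the open set \<open>\<Omega>\<close>.
\<close>

primrec Ck_on :: "nat \<Rightarrow> 'a::euclidean_space set \<Rightarrow> ('a \<Rightarrow> real) \<Rightarrow> bool" where
  "Ck_on 0 \<Omega> f \<longleftrightarrow> continuous_on \<Omega> f"
| "Ck_on (Suc k) \<Omega> f \<longleftrightarrow>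
     (\<forall>x\<in>\<Omega>. f differentiable (at x)) \<and> (\<forall>v. Ck_on k \<Omega> (\<lambda>x. frechet_derivative f (at x) v))"

definition smooth_on :: "'a::euclidean_space set \<Rightarrow> ('a \<Rightarrow> real) \<Rightarrow> bool" where
  "smooth_on \<Omega> f \<longleftrightarrow> (\<forall>k. Ck_on k \<Omega> f)"

definition grad :: "('a::euclidean_space \<Rightarrow> real) \<Rightarrow> 'a \<Rightarrow> 'a" where
  "grad f x = (THE D. GDERIV f x :> D)"

definition hess :: "('a::euclidean_space \<Rightarrow> real) \<Rightarrow> 'a \<Rightarrow> 'a \<Rightarrow> 'a \<Rightarrow> real" where
  "hess f x v w = frechet_derivative (\<lambda>y. frechet_derivative f (at y) w) (at x) v"

definition LCW :: "'a::euclidean_space set \<Rightarrow> ('a \<Rightarrow> real) \<Rightarrow> bool" where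
  "LCW \<Omega> \<phi> \<longleftrightarrow> open \<Omega> \<and> smooth_on \<Omega> \<phi> \<and>
     (\<forall>x\<in>\<Omega>. frechet_derivative \<phi> (at x) \<noteq> (\<lambda>h. 0) \<and>
        (\<forall>V. norm V = norm (grad \<phi> x) \<and> V \<bullet> grad \<phi> x = 0 \<longrightarrow>
           hess \<phi> x (grad \<phi> x) (grad \<phi> x) + hess \<phi> x V V = 0))"


section \<open>Conformal transformations of the one point compactification\<close>

text \<open>
  The one point compactification of \<open>'a\<close> is \<open>'a option\<close>, with \<open>None\<close> as the point at infinity
  (as in \<open>Alexandroff_compactification\<close>).
\<close>

definition affine_generators :: "('a::euclidean_space option \<Rightarrow> 'a option) set" where
  "affine_generators =
     {map_option (\<lambda>x. x + c) | c. True} \<union>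
     {map_option (\<lambda>x. r *\<^sub>R x) | r. r > 0} \<union>
     {map_option f | f. orthogonal_transformation f}"

definition inversion :: "'a::euclidean_space option \<Rightarrow> 'a option" where
  "inversion p = (case p of None \<Rightarrow> Some 0
     | Some x \<Rightarrow> if x = 0 then None else Some (x /\<^sub>R (norm x)\<^sup>2))"

inductive_set compositions :: "('b \<Rightarrow> 'b) set \<Rightarrow> ('b \<Rightarrow> 'b) set" for S where
  base: "F \<in> S \<Longrightarrow> F \<in> compositions S"
| comp: "F \<in> compositions S \<Longrightarrow> G \<in> compositions S \<Longrightarrow> F \<circ> G \<in> compositions S"

definition affine_conformal_maps :: "('a::euclidean_space option \<Rightarrow> 'a option) set" where
  "affine_conformal_maps = compositions affine_generators"

definition conformal_maps :: "('a::euclidean_space option \<Rightarrow> 'a option) set" where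
  "conformal_maps = compositions (insert inversion affine_generators)"


section \<open>Multivalued weights and their branches\<close>

text \<open>
  On a domain that meets \<open>{q = 0}\<close> (or winds around \<open>{p = q = 0}\<close>) the expression
  \<open>arctan (p / q)\<close> has to be read as a continuous branch of the multivalued arctangent,
  otherwise the classification fails, e.g. for an angular coordinate on a slit domain.  A weight
  is therefore given by its set of values at each point: empty where the weight is undefined,
  a singleton for the single-valued weights, and a coset of \<open>\<pi>\<int>\<close> for the arctangents.
\<close>

definition arctan_values :: "real \<Rightarrow> real \<Rightarrow> real set" where
  "arctan_values p q = (if p = 0 \<and> q = 0 then {}
     else {(if q = 0 then pi / 2 else arctan (p / q)) + of_int k * pi | k. True})"

definition rescale :: "real \<Rightarrow> real \<Rightarrow> ('a \<Rightarrow> real set) \<Rightarrow> 'a \<Rightarrow> real set" where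
  "rescale a b \<psi> x = (\<lambda>t. a * t + b) ` \<psi> x"

definition pullback :: "('a option \<Rightarrow> 'a option) \<Rightarrow> ('a \<Rightarrow> real set) \<Rightarrow> 'a \<Rightarrow> real set" where
  "pullback F \<psi> x = (case F (Some x) of None \<Rightarrow> {} | Some y \<Rightarrow> \<psi> y)"

text \<open>For single-valued \<open>\<psi>\<close>, being a branch just means being the restriction of \<open>\<psi>\<close> to \<open>\<Omega>\<close>,
  with \<open>\<psi>\<close> defined and continuous there.\<close>

definition branch_on :: "'a::topological_space set \<Rightarrow> ('a \<Rightarrow> real set) \<Rightarrow> ('a \<Rightarrow> real) \<Rightarrow> bool" where
  "branch_on \<Omega> \<psi> \<phi> \<longleftrightarrow> continuous_on \<Omega> \<phi> \<and> (\<forall>x\<in>\<Omega>. \<phi> x \<in> \<psi> x)"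

definition psi :: "'a::euclidean_space \<Rightarrow> 'a \<Rightarrow> nat \<Rightarrow> 'a \<Rightarrow> real set" where
  "psi e1 e2 i x =
     (if i = 1 then {e1 \<bullet> x}
      else if i = 2 then (if x = 0 then {} else {ln (norm x)})
      else if i = 3 then arctan_values (e1 \<bullet> x) (e2 \<bullet> x)
      else {})"

definition affine_family ::
  "'a::euclidean_space \<Rightarrow> 'a \<Rightarrow> real \<Rightarrow> nat \<Rightarrow> 'a \<Rightarrow> real set" where
  "affine_family \<gamma> \<sigma> s j x =
     (if j = 1 then {\<gamma> \<bullet> x}
      else if j = 2 then (if x = 0 then {} else {ln (norm x)})
      else if j = 3 then arctan_values (\<gamma> \<bullet> x) (\<sigma> \<bullet> x)
      else if j = 4 then (if x = 0 then {} else {- 2 * ((\<gamma> \<bullet> x) / (norm x)\<^sup>2)})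
      else if j = 5 then
        (\<lambda>t. 1 / sqrt s * t) `
          arctan_values (- 2 * (\<gamma> \<bullet> x) / sqrt s) ((norm x)\<^sup>2 / s - 1)
      else if j = 6 then
        (let z = (- 2 * (\<gamma> \<bullet> x) / sqrt s) / ((norm x)\<^sup>2 / s + 1)
         in if \<bar>z\<bar> < 1 then {1 / sqrt s * artanh z} else {})
      else {})"

definition admissible :: "'a::euclidean_space \<Rightarrow> 'a \<Rightarrow> real \<Rightarrow> bool" where
  "admissible \<gamma> \<sigma> s \<longleftrightarrow> norm \<gamma> = 1 \<and> norm \<sigma> = 1 \<and> \<gamma> \<bullet> \<sigma> = 0 \<and> s > 0"

end

theory Submission
  imports Defs
begin

text \<open>
  Every limiting Carleman weight \<open>\<phi>\<close> is studied through the vector field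
  \<open>X = \<nabla>\<phi> / |\<nabla>\<phi>|\<^sup>2\<close>, which determines \<open>\<phi>\<close> up to an additive constant because
  \<open>\<nabla>\<phi> = X / |X|\<^sup>2\<close>.  The Hessian condition on \<open>\<phi>\<close> says exactly that \<open>X\<close> is conformal: the
  symmetric part of its derivative is a multiple of the identity (\<open>LCW_imp_field\<close>,
  \<open>LCW_if_field\<close>).  In this form the conformal invariance of the notion is a short computation for
  each generator of the group, and a normal form for the conformal maps (a similarity, or a
  similarity after the inversion after a translation) leaves only similarities and the inversion to
  treat, away from the pole.

  In dimension at least three conformal fields are rigid.  Symmetry of the third derivatives
  forces the scale factor of \<open>X\<close> to be affine, so on a connected domain \<open>X\<close> is a quadratic
  polynomial (\<open>conformal_field_quadratic_near\<close>).  Moreover \<open>X\<close> is proportional to a gradient, hence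
  \<open>X\<close> wedged with the skew part of its derivative vanishes.  Evaluated to first order at a single
  point, this integrability condition already puts all the coefficients of \<open>X\<close> into one plane, and
  completing the square in that plane leaves, up to translation, only the following fields
  (\<open>irrotational_conformal_kind\<close>):
  a nonzero constant; a multiple of \<open>x\<close>; a plane rotation; and
  \<open>\<kappa> b + 2 (b \<bullet> x) x - |x|\<^sup>2 b\<close> with \<open>b \<noteq> 0\<close> and \<open>\<kappa>\<close> zero, positive or negative.
  Such a field is determined by its values on a nonempty open set, and the six kinds are
  distinguished by second differences, by their linear parts and by \<open>\<kappa>\<close> (\<open>field_kind_unique\<close>).

  These six kinds are the fields of the six affine families (\<open>family_weight\<close>,
  \<open>field_kind_family\<close>), and similarities preserve the kind; this gives the six affine orbits.  The
  inversion acts on quadratic fields by exchanging the constant with the quadratic coefficient.  It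
  therefore turns a field of one of the last three kinds with a zero at the origin into a field of
  degree at most one, namely a constant, a radial field or a rotation according to whether \<open>\<kappa>\<close> is
  zero, negative or positive, and conversely (\<open>inverted_pencil\<close>, \<open>inverted_field_kind\<close>).  So the
  six kinds collapse to three classes under the full conformal group.
\<close>

section \<open>Functions of class \<open>C\<^sup>k\<close>\<close>

abbreviation dir_deriv :: "'a \<Rightarrow> ('a::euclidean_space \<Rightarrow> real) \<Rightarrow> 'a \<Rightarrow> real" where
  "dir_deriv v f \<equiv> (\<lambda>x. frechet_derivative f (at x) v)"

lemma frechet_derivativeI: "(f has_derivative f') (at x) \<Longrightarrow> frechet_derivative f (at x) = f'"
  using frechet_derivative_at by metis

lemma has_derivative_cong_open:
  assumes "open \<Omega>" "x \<in> \<Omega>" "\<And>y. y \<in> \<Omega> \<Longrightarrow> f y = g y" "(f has_derivative D) (at x)"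
  shows "(g has_derivative D) (at x)"
  using has_derivative_transform_within_open[OF assms(4,1,2,3)] .

lemma frechet_derivative_cong_open:
  assumes "open \<Omega>" "x \<in> \<Omega>" "\<And>y. y \<in> \<Omega> \<Longrightarrow> f y = g y"
  shows "frechet_derivative f (at x) = frechet_derivative g (at x)"
proof -
  have "(f has_derivative D) (at x) \<longleftrightarrow> (g has_derivative D) (at x)" for D
    using has_derivative_cong_open[OF assms] has_derivative_cong_open[OF assms(1,2), of g f D] assms(3)
    by auto
  then show ?thesis by (simp add: frechet_derivative_def)
qed

lemma Ck_on_cong:
  assumes "open \<Omega>" "\<And>y. y \<in> \<Omega> \<Longrightarrow> f y = g y"
  shows "Ck_on k \<Omega> f \<longleftrightarrow> Ck_on k \<Omega> g"
  using assms(2)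
proof (induction k arbitrary: f g)
  case 0
  then show ?case by (simp cong: continuous_on_cong)
next
  case (Suc k)
  have 1: "f differentiable (at x) \<longleftrightarrow> g differentiable (at x)" if "x \<in> \<Omega>" for x
    unfolding differentiable_def
    using has_derivative_cong_open[OF assms(1) that] Suc.prems by metis
  have 2: "frechet_derivative f (at x) = frechet_derivative g (at x)" if "x \<in> \<Omega>" for x
    by (rule frechet_derivative_cong_open[OF assms(1) that Suc.prems])
  show ?case
    using 1 Suc.IH[of "dir_deriv _ f" "dir_deriv _ g"] 2 by auto
qed

lemma Ck_on_Suc_D: "Ck_on (Suc k) \<Omega> f \<Longrightarrow> Ck_on k \<Omega> f"
proof (induction k arbitrary: f)
  case 0
  then show ?case
    by (auto intro!: continuous_at_imp_continuous_on differentiable_imp_continuous_within)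
next
  case (Suc k)
  then show ?case by simp
qed

lemma Ck_on_Suc_I:
  assumes "open \<Omega>" "\<And>x. x \<in> \<Omega> \<Longrightarrow> (f has_derivative D x) (at x)" "\<And>v. Ck_on k \<Omega> (\<lambda>x. D x v)"
  shows "Ck_on (Suc k) \<Omega> f"
proof -
  have "Ck_on k \<Omega> (dir_deriv v f)" for v
    using assms(3)[of v] Ck_on_cong[OF assms(1), of "dir_deriv v f" "\<lambda>x. D x v"]
      frechet_derivativeI[OF assms(2)] by auto
  then show ?thesis
    using assms(2) by (auto simp: differentiable_def)
qed

lemma Ck_on_Suc_has_derivative:
  "Ck_on (Suc k) \<Omega> f \<Longrightarrow> x \<in> \<Omega> \<Longrightarrow> (f has_derivative frechet_derivative f (at x)) (at x)"
  by (simp add: frechet_derivative_works)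

lemma Ck_on_const: "open \<Omega> \<Longrightarrow> Ck_on k \<Omega> (\<lambda>x. c)"
proof (induction k arbitrary: c)
  case (Suc k)
  show ?case
    by (rule Ck_on_Suc_I[where D = "\<lambda>x v. 0"]) (use Suc in auto)
qed simp

lemma Ck_on_add:
  assumes "open \<Omega>"
  shows "Ck_on k \<Omega> f \<Longrightarrow> Ck_on k \<Omega> g \<Longrightarrow> Ck_on k \<Omega> (\<lambda>x. f x + g x)"
proof (induction k arbitrary: f g)
  case 0
  then show ?case by (simp add: continuous_on_add)
next
  case (Suc k)
  show ?case
    by (rule Ck_on_Suc_I[OF assms has_derivative_add[OF Ck_on_Suc_has_derivative[OF Suc.prems(1)]
              Ck_on_Suc_has_derivative[OF Suc.prems(2)]]])
      (use Suc in auto)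
qed

lemma Ck_on_mult:
  assumes "open \<Omega>"
  shows "Ck_on k \<Omega> f \<Longrightarrow> Ck_on k \<Omega> g \<Longrightarrow> Ck_on k \<Omega> (\<lambda>x. f x * g x)"
proof (induction k arbitrary: f g)
  case 0
  then show ?case by (simp add: continuous_on_mult)
next
  case (Suc k)
  show ?case
    by (rule Ck_on_Suc_I[OF assms has_derivative_mult[OF Ck_on_Suc_has_derivative[OF Suc.prems(1)]
              Ck_on_Suc_has_derivative[OF Suc.prems(2)]]])
      (use Suc.prems Ck_on_Suc_D[OF Suc.prems(1)] Ck_on_Suc_D[OF Suc.prems(2)] in
        \<open>auto intro!: Ck_on_add[OF assms] Suc.IH\<close>)
qed

lemma Ck_on_minus: "open \<Omega> \<Longrightarrow> Ck_on k \<Omega> f \<Longrightarrow> Ck_on k \<Omega> (\<lambda>x. - f x)"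
  using Ck_on_mult[OF _ Ck_on_const[of \<Omega> k "-1"], of f] by simp

lemma Ck_on_inverse:
  assumes "open \<Omega>" "\<And>x. x \<in> \<Omega> \<Longrightarrow> f x \<noteq> 0"
  shows "Ck_on k \<Omega> f \<Longrightarrow> Ck_on k \<Omega> (\<lambda>x. inverse (f x))"
proof (induction k)
  case 0
  then show ?case using assms by (simp add: continuous_on_inverse)
next
  case (Suc k)
  have D: "((\<lambda>x. inverse (f x)) has_derivative
      (\<lambda>v. inverse (f x) * inverse (f x) * (frechet_derivative f (at x) v * (- 1)))) (at x)" if "x \<in> \<Omega>" for x
    using Deriv.has_derivative_inverse[OF assms(2)[OF that] Ck_on_Suc_has_derivative[OF Suc.prems that]]
    by (simp add: algebra_simps)
  show ?case
    by (rule Ck_on_Suc_I[OF assms(1) D])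
      (use Suc Ck_on_Suc_D[OF Suc.prems] in
        \<open>auto intro!: Ck_on_mult[OF assms(1)] Ck_on_minus[OF assms(1)]\<close>)
qed

lemma Ck_on_sum:
  assumes "open \<Omega>"
  shows "(\<And>i. i \<in> I \<Longrightarrow> Ck_on k \<Omega> (f i)) \<Longrightarrow> Ck_on k \<Omega> (\<lambda>x. \<Sum>i\<in>I. f i x)"
  by (induction I rule: infinite_finite_induct) (auto intro!: Ck_on_add[OF assms] Ck_on_const[OF assms])

lemma smooth_onI:
  assumes "open \<Omega>" "\<And>x. x \<in> \<Omega> \<Longrightarrow> (f has_derivative D x) (at x)" "\<And>v. smooth_on \<Omega> (\<lambda>x. D x v)"
  shows "smooth_on \<Omega> f"
  unfolding smooth_on_def
proof
  fix k
  have "Ck_on (Suc k) \<Omega> f"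
    by (rule Ck_on_Suc_I[OF assms(1,2)]) (use assms(3) in \<open>auto simp: smooth_on_def\<close>)
  then show "Ck_on k \<Omega> f" by (rule Ck_on_Suc_D)
qed

lemma smooth_on_has_derivative:
  "smooth_on \<Omega> f \<Longrightarrow> x \<in> \<Omega> \<Longrightarrow> (f has_derivative frechet_derivative f (at x)) (at x)"
  using Ck_on_Suc_has_derivative[of 0 \<Omega> f x] by (auto simp: smooth_on_def simp del: Ck_on.simps)

lemma smooth_on_dir_deriv: "smooth_on \<Omega> f \<Longrightarrow> smooth_on \<Omega> (dir_deriv v f)"
  by (metis Ck_on.simps(2) smooth_on_def)

lemma smooth_on_cong:
  "open \<Omega> \<Longrightarrow> (\<And>y. y \<in> \<Omega> \<Longrightarrow> f y = g y) \<Longrightarrow> smooth_on \<Omega> f \<longleftrightarrow> smooth_on \<Omega> g"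
  unfolding smooth_on_def using Ck_on_cong by blast

lemma smooth_on_continuous: "smooth_on \<Omega> f \<Longrightarrow> continuous_on \<Omega> f"
  using Ck_on.simps(1) smooth_on_def by blast

lemma smooth_on_const: "open \<Omega> \<Longrightarrow> smooth_on \<Omega> (\<lambda>x. c)"
  and smooth_on_add: "open \<Omega> \<Longrightarrow> smooth_on \<Omega> f \<Longrightarrow> smooth_on \<Omega> g \<Longrightarrow> smooth_on \<Omega> (\<lambda>x. f x + g x)"
  and smooth_on_minus: "open \<Omega> \<Longrightarrow> smooth_on \<Omega> f \<Longrightarrow> smooth_on \<Omega> (\<lambda>x. - f x)"
  and smooth_on_mult: "open \<Omega> \<Longrightarrow> smooth_on \<Omega> f \<Longrightarrow> smooth_on \<Omega> g \<Longrightarrow> smooth_on \<Omega> (\<lambda>x. f x * g x)"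
  and smooth_on_inverse: "open \<Omega> \<Longrightarrow> (\<And>x. x \<in> \<Omega> \<Longrightarrow> f x \<noteq> 0) \<Longrightarrow> smooth_on \<Omega> f \<Longrightarrow>
    smooth_on \<Omega> (\<lambda>x. inverse (f x))"
  and smooth_on_sum: "open \<Omega> \<Longrightarrow> (\<And>i. i \<in> I \<Longrightarrow> smooth_on \<Omega> (h i)) \<Longrightarrow>
    smooth_on \<Omega> (\<lambda>x. \<Sum>i\<in>I. h i x)"
  unfolding smooth_on_def
  by (blast intro: Ck_on_const Ck_on_add Ck_on_minus Ck_on_mult Ck_on_inverse Ck_on_sum)+

lemma smooth_on_diff:
  "open \<Omega> \<Longrightarrow> smooth_on \<Omega> f \<Longrightarrow> smooth_on \<Omega> g \<Longrightarrow> smooth_on \<Omega> (\<lambda>x. f x - g x)"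
  using smooth_on_add[OF _ _ smooth_on_minus, of \<Omega> f g] by simp

lemma smooth_on_inner_left:
  assumes "open \<Omega>" shows "smooth_on \<Omega> (\<lambda>x. x \<bullet> w)"
  by (rule smooth_onI[where D = "\<lambda>x v. v \<bullet> w"])
    (auto intro!: assms smooth_on_const derivative_eq_intros)

lemma smooth_on_inner:
  fixes X Y :: "'a::euclidean_space \<Rightarrow> 'a"
  assumes "open \<Omega>" "\<And>w. smooth_on \<Omega> (\<lambda>x. X x \<bullet> w)" "\<And>w. smooth_on \<Omega> (\<lambda>x. Y x \<bullet> w)"
  shows "smooth_on \<Omega> (\<lambda>x. X x \<bullet> Y x)"
  by (subst euclidean_inner) (intro smooth_on_sum smooth_on_mult assms)

text \<open>The chain rule expresses the derivative of a composition by products of lower order data, so the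
  class of the outer function can be lowered by induction while the inner map stays smooth.\<close>

lemma Ck_on_compose:
  fixes F :: "'a::euclidean_space \<Rightarrow> 'a"
  assumes "open \<Omega>'" "\<And>w. smooth_on \<Omega>' (\<lambda>x. F x \<bullet> w)" "\<And>x. x \<in> \<Omega>' \<Longrightarrow> F x \<in> \<Omega>"
  shows "Ck_on k \<Omega> g \<Longrightarrow> Ck_on k \<Omega>' (\<lambda>x. g (F x))"
proof (induction k arbitrary: g)
  case 0
  have "continuous_on \<Omega>' F"
    using assms(2) by (subst continuous_on_componentwise) (auto intro: smooth_on_continuous)
  then show ?case using 0 assms(3)
    by (auto intro!: continuous_on_compose2[of \<Omega> g \<Omega>' F])
next
  case (Suc k)
  let ?DF = "\<lambda>x v. \<Sum>i\<in>Basis. frechet_derivative (\<lambda>x. F x \<bullet> i) (at x) v *\<^sub>R i"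
  have DF: "(F has_derivative ?DF x) (at x)" if "x \<in> \<Omega>'" for x
  proof -
    have "((\<lambda>x. \<Sum>i\<in>Basis. (F x \<bullet> i) *\<^sub>R i) has_derivative ?DF x) (at x)"
      by (intro has_derivative_sum has_derivative_scaleR_left smooth_on_has_derivative[OF assms(2) that])
    then show ?thesis by (simp add: euclidean_representation)
  qed
  have D: "((\<lambda>x. g (F x)) has_derivative
     (\<lambda>v. \<Sum>i\<in>Basis. frechet_derivative (\<lambda>x. F x \<bullet> i) (at x) v * frechet_derivative g (at (F x)) i)) (at x)"
    if "x \<in> \<Omega>'" for x
  proof -
    note Dg = Ck_on_Suc_has_derivative[OF Suc.prems assms(3)[OF that]]
    interpret bounded_linear "frechet_derivative g (at (F x))"
      using Dg by (rule has_derivative_bounded_linear)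
    show ?thesis
      using has_derivative_compose[OF DF[OF that] Dg] by (simp add: sum scaleR)
  qed
  show ?case
  proof (rule Ck_on_Suc_I[OF assms(1) D])
    show "Ck_on k \<Omega>' (\<lambda>x. \<Sum>i\<in>Basis. frechet_derivative (\<lambda>x. F x \<bullet> i) (at x) v *
      frechet_derivative g (at (F x)) i)" for v
      using Suc.prems smooth_on_dir_deriv[OF assms(2)]
      by (intro Ck_on_sum Ck_on_mult assms(1) Suc.IH) (auto simp: smooth_on_def)
  qed auto
qed

lemma smooth_on_compose:
  fixes F :: "'a::euclidean_space \<Rightarrow> 'a"
  assumes "open \<Omega>'" "\<And>w. smooth_on \<Omega>' (\<lambda>x. F x \<bullet> w)" "\<And>x. x \<in> \<Omega>' \<Longrightarrow> F x \<in> \<Omega>" "smooth_on \<Omega> g"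
  shows "smooth_on \<Omega>' (\<lambda>x. g (F x))"
  using Ck_on_compose[OF assms(1-3)] assms(4) by (auto simp: smooth_on_def)

lemma dir_deriv_representation:
  assumes "smooth_on \<Omega> g" "x \<in> \<Omega>"
  obtains G where "\<And>w. dir_deriv w g x = G \<bullet> w"
proof
  interpret bounded_linear "frechet_derivative g (at x)"
    using smooth_on_has_derivative[OF assms] by (rule has_derivative_bounded_linear)
  fix w
  have "dir_deriv w g x = frechet_derivative g (at x) (\<Sum>i\<in>Basis. (w \<bullet> i) *\<^sub>R i)"
    by (simp add: euclidean_representation)
  also have "\<dots> = (\<Sum>i\<in>Basis. (w \<bullet> i) * dir_deriv i g x)" by (simp add: sum scaleR)
  also have "\<dots> = (\<Sum>i\<in>Basis. dir_deriv i g x *\<^sub>R i) \<bullet> w"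
    by (simp add: inner_sum_left inner_commute[of w] mult.commute)
  finally show "dir_deriv w g x = (\<Sum>i\<in>Basis. dir_deriv i g x *\<^sub>R i) \<bullet> w" .
qed

lemma DERIV_along_line:
  fixes f :: "'a::euclidean_space \<Rightarrow> real"
  assumes "(f has_derivative frechet_derivative f (at (y + s *\<^sub>R v))) (at (y + s *\<^sub>R v))"
  shows "((\<lambda>s. f (y + s *\<^sub>R v)) has_real_derivative dir_deriv v f (y + s *\<^sub>R v)) (at s)"
proof -
  interpret bounded_linear "frechet_derivative f (at (y + s *\<^sub>R v))"
    using assms by (rule has_derivative_bounded_linear)
  have "((\<lambda>s. y + s *\<^sub>R v) has_derivative (\<lambda>h. h *\<^sub>R v)) (at s)"
    by (auto intro!: derivative_eq_intros)
  from has_derivative_compose[OF this assms] show ?thesis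
    by (simp add: has_field_derivative_def scaleR mult_commute_abs)
qed

text \<open>The second difference of \<open>f\<close> over a parallelogram is, by two applications of the mean value
  theorem, a value of the iterated directional derivative inside the parallelogram.\<close>

lemma second_difference_mvt:
  fixes f :: "'a::euclidean_space \<Rightarrow> real"
  assumes "smooth_on \<Omega> f" "h > 0" and in_\<Omega>: "\<And>s t. 0 \<le> s \<Longrightarrow> s \<le> h \<Longrightarrow> 0 \<le> t \<Longrightarrow> t \<le> h \<Longrightarrow> x + s *\<^sub>R v + t *\<^sub>R w \<in> \<Omega>"
  shows "\<exists>s t. 0 < s \<and> s < h \<and> 0 < t \<and> t < h \<and>
    f (x + h *\<^sub>R v + h *\<^sub>R w) - f (x + h *\<^sub>R v) - f (x + h *\<^sub>R w) + f x = h * h * dir_deriv w (dir_deriv v f) (x + s *\<^sub>R v + t *\<^sub>R w)"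
proof -
  let ?g = "\<lambda>s. f (x + h *\<^sub>R w + s *\<^sub>R v) - f (x + s *\<^sub>R v)"
  have "(?g has_real_derivative dir_deriv v f (x + h *\<^sub>R w + s *\<^sub>R v) - dir_deriv v f (x + s *\<^sub>R v)) (at s)"
    if "0 \<le> s" "s \<le> h" for s
    using in_\<Omega>[OF that, of h] in_\<Omega>[OF that, of 0] assms(2)
    by (intro DERIV_diff DERIV_along_line smooth_on_has_derivative[OF assms(1)])
      (auto simp: algebra_simps)
  from MVT2[OF assms(2) this] obtain s where s: "0 < s" "s < h"
    "?g h - ?g 0 = h * (dir_deriv v f (x + h *\<^sub>R w + s *\<^sub>R v) - dir_deriv v f (x + s *\<^sub>R v))" by auto
  have "((\<lambda>t. dir_deriv v f (x + s *\<^sub>R v + t *\<^sub>R w)) has_real_derivative dir_deriv w (dir_deriv v f) (x + s *\<^sub>R v + t *\<^sub>R w)) (at t)"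
    if "0 \<le> t" "t \<le> h" for t
    using in_\<Omega>[of s t] that s(1,2)
    by (intro DERIV_along_line smooth_on_has_derivative[OF smooth_on_dir_deriv[OF assms(1)]]) auto
  from MVT2[OF assms(2) this] obtain t where t: "0 < t" "t < h"
    "dir_deriv v f (x + s *\<^sub>R v + h *\<^sub>R w) - dir_deriv v f (x + s *\<^sub>R v) = h * dir_deriv w (dir_deriv v f) (x + s *\<^sub>R v + t *\<^sub>R w)" by auto
  have "f (x + h *\<^sub>R v + h *\<^sub>R w) - f (x + h *\<^sub>R v) - f (x + h *\<^sub>R w) + f x = ?g h - ?g 0"
    by (simp add: algebra_simps)
  also have "\<dots> = h * (dir_deriv v f (x + s *\<^sub>R v + h *\<^sub>R w) - dir_deriv v f (x + s *\<^sub>R v))"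
    unfolding s(3) by (simp add: algebra_simps)
  finally show ?thesis using s t by (intro exI[of _ s] exI[of _ t]) auto
qed

text \<open>Both orders of differentiation compute the same second difference, and the iterated derivatives
  are continuous, so the two limits over shrinking parallelograms agree.\<close>

lemma dir_deriv_commute:
  fixes f :: "'a::euclidean_space \<Rightarrow> real"
  assumes "open \<Omega>" "smooth_on \<Omega> f" "x \<in> \<Omega>"
  shows "dir_deriv w (dir_deriv v f) x = dir_deriv v (dir_deriv w f) x"
proof (rule ccontr)
  assume ne: "\<not> ?thesis"
  define e where "e = \<bar>dir_deriv w (dir_deriv v f) x - dir_deriv v (dir_deriv w f) x\<bar> / 2"
  have "e > 0" using ne by (simp add: e_def)
  have cont: "isCont (dir_deriv a (dir_deriv b f)) x" for a b
    using smooth_on_continuous[OF smooth_on_dir_deriv[OF smooth_on_dir_deriv[OF assms(2)]]] assms(1,3)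
    by (metis continuous_on_eq_continuous_at)
  obtain d1 where d1: "d1 > 0" "\<And>y. dist y x < d1 \<Longrightarrow> \<bar>dir_deriv w (dir_deriv v f) y - dir_deriv w (dir_deriv v f) x\<bar> < e"
    using cont[of v w, unfolded continuous_at_eps_delta, rule_format, OF \<open>e > 0\<close>] by (auto simp: dist_real_def)
  obtain d2 where d2: "d2 > 0" "\<And>y. dist y x < d2 \<Longrightarrow> \<bar>dir_deriv v (dir_deriv w f) y - dir_deriv v (dir_deriv w f) x\<bar> < e"
    using cont[of w v, unfolded continuous_at_eps_delta, rule_format, OF \<open>e > 0\<close>] by (auto simp: dist_real_def)
  obtain d3 where d3: "d3 > 0" "ball x d3 \<subseteq> \<Omega>" using assms(1,3) openE by blast
  define d where "d = min d1 (min d2 d3)"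
  \<comment> \<open>the parallelogram with sides \<open>h v\<close> and \<open>h w\<close> stays in the ball of radius \<open>d\<close>\<close>
  define h where "h = d / (2 * (norm v + norm w + 1))"
  have d: "d > 0" using d1 d2 d3 by (simp add: d_def)
  have h: "h > 0" unfolding h_def using d
    by (metis add_nonneg_pos divide_pos_pos mult_pos_pos norm_ge_zero zero_less_numeral zero_less_one add_nonneg_nonneg)
  have near: "dist (x + s *\<^sub>R v + t *\<^sub>R w) x < d" if "0 \<le> s" "s \<le> h" "0 \<le> t" "t \<le> h" for s t
  proof -
    have "norm (s *\<^sub>R v + t *\<^sub>R w) \<le> s * norm v + t * norm w"
      using norm_triangle_ineq[of "s *\<^sub>R v" "t *\<^sub>R w"] that by simp
    also have "\<dots> \<le> h * norm v + h * norm w" using that by (intro add_mono mult_right_mono) auto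
    also have "\<dots> \<le> h * (norm v + norm w + 1)" using h by (simp add: algebra_simps)
    also have "\<dots> = d / 2" unfolding h_def
      using add_nonneg_pos[OF add_nonneg_nonneg[OF norm_ge_zero[of v] norm_ge_zero[of w]] zero_less_one] by (simp add: field_simps)
    finally show ?thesis using d by (simp add: dist_norm algebra_simps)
  qed
  have in_\<Omega>: "x + s *\<^sub>R v + t *\<^sub>R w \<in> \<Omega>" if "0 \<le> s" "s \<le> h" "0 \<le> t" "t \<le> h" for s t
    using near[OF that] d3 by (auto simp: d_def dist_commute subset_iff)
  obtain s t where st: "0 < s" "s < h" "0 < t" "t < h"
    "f (x + h *\<^sub>R v + h *\<^sub>R w) - f (x + h *\<^sub>R v) - f (x + h *\<^sub>R w) + f x = h * h * dir_deriv w (dir_deriv v f) (x + s *\<^sub>R v + t *\<^sub>R w)"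
    using second_difference_mvt[OF assms(2) h in_\<Omega>] by blast
  have in_\<Omega>': "x + s *\<^sub>R w + t *\<^sub>R v \<in> \<Omega>" if "0 \<le> s" "s \<le> h" "0 \<le> t" "t \<le> h" for s t
    using in_\<Omega>[OF that(3,4,1,2)] by (simp add: algebra_simps)
  obtain s' t' where st': "0 < s'" "s' < h" "0 < t'" "t' < h"
    "f (x + h *\<^sub>R w + h *\<^sub>R v) - f (x + h *\<^sub>R w) - f (x + h *\<^sub>R v) + f x = h * h * dir_deriv v (dir_deriv w f) (x + s' *\<^sub>R w + t' *\<^sub>R v)"
    using second_difference_mvt[OF assms(2) h in_\<Omega>'] by blast
  have "h * h * dir_deriv w (dir_deriv v f) (x + s *\<^sub>R v + t *\<^sub>R w) = h * h * dir_deriv v (dir_deriv w f) (x + s' *\<^sub>R w + t' *\<^sub>R v)"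
    using st(5) st'(5) by (simp add: algebra_simps)
  then have eq: "dir_deriv w (dir_deriv v f) (x + s *\<^sub>R v + t *\<^sub>R w) = dir_deriv v (dir_deriv w f) (x + s' *\<^sub>R w + t' *\<^sub>R v)"
    using h by simp
  have "\<bar>dir_deriv w (dir_deriv v f) (x + s *\<^sub>R v + t *\<^sub>R w) - dir_deriv w (dir_deriv v f) x\<bar> < e"
    using near[of s t] st by (intro d1) (auto simp: d_def)
  moreover have "\<bar>dir_deriv v (dir_deriv w f) (x + s' *\<^sub>R w + t' *\<^sub>R v) - dir_deriv v (dir_deriv w f) x\<bar> < e"
    using near[of t' s'] st' by (intro d2) (auto simp: d_def algebra_simps)
  moreover have False if "\<bar>a - b\<bar> < e'" "\<bar>a - c\<bar> < e'" "e' = \<bar>b - c\<bar> / 2" for a b c e' :: real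
    using that by (auto simp: abs_if split: if_splits)
  ultimately show False using eq e_def by metis
qed

section \<open>Limiting Carleman weights and conformal fields\<close>

text \<open>The field \<open>X = \<nabla>\<phi> / |\<nabla>\<phi>|\<^sup>2\<close> of a function without critical points.  The definition is
  solved for the gradient, \<open>\<nabla>\<phi> = X / |X|\<^sup>2\<close>; the map \<open>y \<mapsto> y / |y|\<^sup>2\<close> is an involution, so this is
  the same relation.\<close>

definition has_field :: "'a::euclidean_space set \<Rightarrow> ('a \<Rightarrow> real) \<Rightarrow> ('a \<Rightarrow> 'a) \<Rightarrow> bool" where
  "has_field \<Omega> \<phi> X \<longleftrightarrow>
     (\<forall>x\<in>\<Omega>. X x \<noteq> 0 \<and> (\<phi> has_derivative (\<lambda>v. X x \<bullet> v / (X x \<bullet> X x))) (at x))"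

text \<open>Conformal Killing fields.\<close>

definition conformal_field :: "'a::euclidean_space set \<Rightarrow> ('a \<Rightarrow> 'a) \<Rightarrow> bool" where
  "conformal_field \<Omega> X \<longleftrightarrow>
     (\<forall>x\<in>\<Omega>. \<exists>L f. (X has_derivative L) (at x) \<and> (\<forall>v. v \<bullet> L v = f * (v \<bullet> v)))"

definition smooth_field :: "'a::euclidean_space set \<Rightarrow> ('a \<Rightarrow> 'a) \<Rightarrow> bool" where
  "smooth_field \<Omega> X \<longleftrightarrow> (\<forall>w. smooth_on \<Omega> (\<lambda>x. X x \<bullet> w))"

text \<open>The Frobenius condition for the hyperplanes orthogonal to \<open>X\<close>.  It holds for all fields that are
  proportional to a gradient, whatever the factor.\<close>

definition irrotational_field :: "'a::euclidean_space set \<Rightarrow> ('a \<Rightarrow> 'a) \<Rightarrow> bool" where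
  "irrotational_field \<Omega> X \<longleftrightarrow>
     (\<forall>x\<in>\<Omega>. \<forall>L V W. (X has_derivative L) (at x) \<longrightarrow> V \<bullet> X x = 0 \<longrightarrow> W \<bullet> X x = 0 \<longrightarrow> V \<bullet> L W = W \<bullet> L V)"

lemma grad_eqI:
  assumes "(f has_derivative (\<lambda>v. D \<bullet> v)) (at x)"
  shows "grad f x = D"
  unfolding grad_def
proof (rule the_equality)
  show "GDERIV f x :> D" using assms by (simp add: gderiv_def inner_commute)
next
  fix E assume "GDERIV f x :> E"
  then have "(\<lambda>v. v \<bullet> E) = (\<lambda>v. D \<bullet> v)"
    unfolding gderiv_def using assms has_derivative_unique by blast
  then show "E = D" by (metis inner_commute vector_eq_rdot)
qed

text \<open>The passage between gradient and field, and the geometric inversion, are both of this shape.\<close>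

lemma has_derivative_inversion:
  fixes N :: "'b::real_normed_vector \<Rightarrow> 'a::euclidean_space"
  assumes "(N has_derivative H) (at x)" "N x \<noteq> 0"
  shows "((\<lambda>x. N x /\<^sub>R (N x \<bullet> N x)) has_derivative
    (\<lambda>v. H v /\<^sub>R (N x \<bullet> N x) - (2 * (N x \<bullet> H v) / (N x \<bullet> N x)\<^sup>2) *\<^sub>R N x)) (at x)"
proof -
  have nn: "N x \<bullet> N x \<noteq> 0" using assms(2) by simp
  have "((\<lambda>x. N x \<bullet> N x) has_derivative (\<lambda>v. N x \<bullet> H v + H v \<bullet> N x)) (at x)"
    by (rule has_derivative_inner[OF assms(1,1)])
  from has_derivative_scaleR[OF Deriv.has_derivative_inverse[OF nn this] assms(1)]
  show ?thesis
    by (rule has_derivative_eq_rhs)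
      (auto simp: inner_commute power2_eq_square divide_inverse algebra_simps)
qed

text \<open>On the complement of the gradient \<open>N\<close> the Hessian \<open>H\<close> is \<open>- (N \<bullet> H N) / |N|\<^sup>2\<close> times the identity,
  by homogeneity of the defining condition.  The normalisation \<open>X = N / |N|\<^sup>2\<close> is exactly the one
  whose derivative has the same scale factor in the direction of \<open>N\<close>: it flips the sign of
  \<open>N \<bullet> H N\<close> and cancels the mixed terms against the symmetry of \<open>H\<close>.\<close>

lemma LCW_imp_field:
  fixes \<phi> :: "'a::euclidean_space \<Rightarrow> real"
  assumes "LCW \<Omega> \<phi>"
  obtains X where "has_field \<Omega> \<phi> X" "conformal_field \<Omega> X" "smooth_field \<Omega> X" "irrotational_field \<Omega> X"
proof -
  have op: "open \<Omega>" and sm: "smooth_on \<Omega> \<phi>" using assms by (auto simp: LCW_def)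
  have "\<exists>G. \<forall>w. dir_deriv w \<phi> x = G \<bullet> w" if "x \<in> \<Omega>" for x
    using dir_deriv_representation[OF sm that] by metis
  then obtain N where N: "N x \<bullet> w = dir_deriv w \<phi> x" if "x \<in> \<Omega>" for x w by metis
  define H where "H x v = (\<Sum>i\<in>Basis. dir_deriv v (dir_deriv i \<phi>) x *\<^sub>R i)" for x v
  define X where "X x = N x /\<^sub>R (N x \<bullet> N x)" for x
  define L where "L x v = H x v /\<^sub>R (N x \<bullet> N x) - (2 * (N x \<bullet> H x v) / (N x \<bullet> N x)\<^sup>2) *\<^sub>R N x" for x v
  have D\<phi>: "(\<phi> has_derivative (\<lambda>v. N x \<bullet> v)) (at x)" if "x \<in> \<Omega>" for x
    using smooth_on_has_derivative[OF sm that] by (simp add: N[OF that])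
  have grad: "grad \<phi> x = N x" if "x \<in> \<Omega>" for x
    by (rule grad_eqI[OF D\<phi>[OF that]])
  have N0: "N x \<noteq> 0" if "x \<in> \<Omega>" for x
  proof
    assume "N x = 0"
    then have "frechet_derivative \<phi> (at x) = (\<lambda>h. 0)" using N[OF that] by auto
    then show False using assms that by (auto simp: LCW_def)
  qed
  have DN: "(N has_derivative H x) (at x)" if "x \<in> \<Omega>" for x
  proof (rule has_derivative_cong_open[OF op that])
    show "((\<lambda>x. \<Sum>i\<in>Basis. dir_deriv i \<phi> x *\<^sub>R i) has_derivative H x) (at x)"
      unfolding H_def
      by (intro has_derivative_sum has_derivative_scaleR_left smooth_on_has_derivative[OF smooth_on_dir_deriv[OF sm] that])
    show "(\<Sum>i\<in>Basis. dir_deriv i \<phi> y *\<^sub>R i) = N y" if "y \<in> \<Omega>" for y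
      using euclidean_representation[of "N y"] by (simp add: N[OF that])
  qed
  have H: "H x v \<bullet> w = dir_deriv v (dir_deriv w \<phi>) x" if "x \<in> \<Omega>" for x v w
  proof -
    have "((\<lambda>y. N y \<bullet> w) has_derivative (\<lambda>v. H x v \<bullet> w)) (at x)"
      by (intro has_derivative_inner_left DN that)
    then have "(dir_deriv w \<phi> has_derivative (\<lambda>v. H x v \<bullet> w)) (at x)"
      by (rule has_derivative_cong_open[OF op that, rotated]) (simp add: N)
    then show ?thesis by (simp add: frechet_derivativeI)
  qed
  have sym: "H x v \<bullet> w = H x w \<bullet> v" if "x \<in> \<Omega>" for x v w
    using dir_deriv_commute[OF op sm that] H[OF that] by simp
  have weight: "N x \<bullet> H x (N x) + V \<bullet> H x V = 0" if "x \<in> \<Omega>" "V \<bullet> V = N x \<bullet> N x" "V \<bullet> N x = 0" for x V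
  proof -
    have "hess \<phi> x (N x) (N x) + hess \<phi> x V V = 0"
      using assms that grad[OF that(1)] by (auto simp: LCW_def norm_eq)
    then show ?thesis using H[OF that(1)] by (simp add: hess_def inner_commute)
  qed
  have weight': "V \<bullet> H x V = - (N x \<bullet> H x (N x)) / (N x \<bullet> N x) * (V \<bullet> V)"
    if "x \<in> \<Omega>" "V \<bullet> N x = 0" for x V
  proof (cases "V = 0")
    case False
    interpret bounded_linear "H x" using DN[OF that(1)] by (rule has_derivative_bounded_linear)
    \<comment> \<open>rescale \<open>V\<close> to the length of the gradient\<close>
    let ?c = "norm (N x) / norm V"
    have c: "?c * ?c = (N x \<bullet> N x) / (V \<bullet> V)" by (simp add: dot_square_norm power2_eq_square)
    have "N x \<bullet> H x (N x) + (?c *\<^sub>R V) \<bullet> H x (?c *\<^sub>R V) = 0"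
      by (rule weight[OF that(1)]) (use that False c in \<open>auto simp: dot_square_norm power2_eq_square\<close>)
    then have "N x \<bullet> H x (N x) + (?c * ?c) * (V \<bullet> H x V) = 0" by (simp add: scaleR mult.assoc)
    then have "N x \<bullet> H x (N x) + ((N x \<bullet> N x) / (V \<bullet> V)) * (V \<bullet> H x V) = 0" unfolding c .
    moreover have "V \<bullet> V \<noteq> 0" "N x \<bullet> N x \<noteq> 0" using False N0[OF that(1)] by auto
    ultimately show ?thesis by (simp add: field_simps)
  qed (use has_derivative_bounded_linear[OF DN[OF that(1)]] linear_simps(3) in auto)
  have DX: "(X has_derivative L x) (at x)" if "x \<in> \<Omega>" for x
    unfolding X_def[abs_def] L_def[abs_def] by (rule has_derivative_inversion[OF DN[OF that] N0[OF that]])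
  show thesis
  proof (rule that)
    show "has_field \<Omega> \<phi> X"
      unfolding has_field_def
    proof (intro ballI conjI)
      fix x assume x: "x \<in> \<Omega>"
      then show "X x \<noteq> 0" using N0 by (simp add: X_def)
      have "X x \<bullet> v / (X x \<bullet> X x) = N x \<bullet> v" for v
        using N0[OF x] by (simp add: X_def field_simps)
      then show "(\<phi> has_derivative (\<lambda>v. X x \<bullet> v / (X x \<bullet> X x))) (at x)"
        using D\<phi>[OF x] by simp
    qed
    show "smooth_field \<Omega> X"
      unfolding smooth_field_def
    proof
      fix w
      have N1: "smooth_on \<Omega> (\<lambda>x. N x \<bullet> w)" for w
        using smooth_on_dir_deriv[OF sm, of w] smooth_on_cong[OF op N[of _ w]] by simp
      have "smooth_on \<Omega> (\<lambda>x. inverse (N x \<bullet> N x) * (N x \<bullet> w))"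
        by (intro smooth_on_mult smooth_on_inverse smooth_on_inner[OF op N1 N1] op N1) (use N0 in auto)
      then show "smooth_on \<Omega> (\<lambda>x. X x \<bullet> w)" by (simp add: X_def)
    qed
    show "conformal_field \<Omega> X"
      unfolding conformal_field_def
    proof (intro ballI exI conjI allI)
      fix x v assume x: "x \<in> \<Omega>"
      show "(X has_derivative L x) (at x)" by (rule DX[OF x])
      interpret bounded_linear "H x" using DN[OF x] by (rule has_derivative_bounded_linear)
      define n a V where "n = N x \<bullet> N x" and "a = (N x \<bullet> v) / n" and "V = v - a *\<^sub>R N x"
      have n: "n \<noteq> 0" using N0[OF x] by (simp add: n_def)
      have v: "v = a *\<^sub>R N x + V" by (simp add: V_def)
      have "N x \<bullet> V = N x \<bullet> v - a * n" by (simp add: V_def inner_diff_right n_def)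
      then have VN: "V \<bullet> N x = 0" using n by (simp add: a_def inner_commute)
      have s: "V \<bullet> H x (N x) = N x \<bullet> H x V" using sym[OF x, of "N x" V] by (simp add: inner_commute)
      have Hv: "H x v = a *\<^sub>R H x (N x) + H x V" by (simp add: v add scaleR)
      have vv: "v \<bullet> v = a\<^sup>2 * n + V \<bullet> V"
        using VN by (simp add: v inner_add_left inner_add_right power2_eq_square inner_commute flip: n_def)
      have "v \<bullet> L x v = (v \<bullet> H x v) / n - 2 * (N x \<bullet> H x v) * (N x \<bullet> v) / n\<^sup>2"
        by (simp add: L_def inner_diff_right inner_commute flip: n_def) (simp add: field_simps)
      also have "N x \<bullet> v = a * n" using n by (simp add: a_def)
      also have "v \<bullet> H x v = a\<^sup>2 * (N x \<bullet> H x (N x)) + 2 * a * (N x \<bullet> H x V) + V \<bullet> H x V"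
        unfolding Hv by (simp add: v inner_add_left inner_add_right s power2_eq_square algebra_simps)
      also have "V \<bullet> H x V = - (N x \<bullet> H x (N x)) / n * (V \<bullet> V)"
        using weight'[OF x VN] by (simp add: n_def)
      also have "N x \<bullet> H x v = a * (N x \<bullet> H x (N x)) + N x \<bullet> H x V"
        unfolding Hv by (simp add: inner_add_right)
      also have "(a\<^sup>2 * (N x \<bullet> H x (N x)) + 2 * a * (N x \<bullet> H x V) + - (N x \<bullet> H x (N x)) / n * (V \<bullet> V)) / n -
        2 * (a * (N x \<bullet> H x (N x)) + N x \<bullet> H x V) * (a * n) / n\<^sup>2 = - (N x \<bullet> H x (N x)) / n\<^sup>2 * (v \<bullet> v)"
        unfolding vv using n by (simp add: field_simps power2_eq_square)
      finally show "v \<bullet> L x v = - (N x \<bullet> H x (N x)) / n\<^sup>2 * (v \<bullet> v)" by (simp add: n_def)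
    qed
    show "irrotational_field \<Omega> X"
      unfolding irrotational_field_def
    proof (intro ballI allI impI)
      fix x L' V W assume x: "x \<in> \<Omega>" and L': "(X has_derivative L') (at x)" and VW: "V \<bullet> X x = 0" "W \<bullet> X x = 0"
      have "L' = L x" using has_derivative_unique[OF L' DX[OF x]] .
      moreover have "V \<bullet> N x = 0" "W \<bullet> N x = 0" using VW N0[OF x] by (auto simp: X_def)
      ultimately show "V \<bullet> L' W = W \<bullet> L' V"
        using sym[OF x, of V W] by (simp add: L_def inner_diff_right inner_commute)
    qed
  qed
qed

text \<open>Only the values of the Hessian on \<open>X\<close> and on vectors orthogonal to \<open>X\<close> occur in the condition, and
  for these the conformal scale factor enters with opposite signs.\<close>

lemma LCW_if_field:
  fixes \<phi> :: "'a::euclidean_space \<Rightarrow> real"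
  assumes op: "open \<Omega>" and "has_field \<Omega> \<phi> X" "conformal_field \<Omega> X" "smooth_field \<Omega> X"
  shows "LCW \<Omega> \<phi>"
proof -
  have X0: "X x \<noteq> 0" and D\<phi>: "(\<phi> has_derivative (\<lambda>v. X x \<bullet> v / (X x \<bullet> X x))) (at x)" if "x \<in> \<Omega>" for x
    using assms(2) that by (auto simp: has_field_def)
  have sm: "smooth_on \<Omega> \<phi>"
  proof (rule smooth_onI[OF op D\<phi>])
    fix v
    have X: "smooth_on \<Omega> (\<lambda>x. X x \<bullet> w)" for w using assms(4) by (simp add: smooth_field_def)
    have "smooth_on \<Omega> (\<lambda>x. (X x \<bullet> v) * inverse (X x \<bullet> X x))"
      by (intro smooth_on_mult smooth_on_inverse smooth_on_inner[OF op X X] op X) (use X0 in auto)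
    then show "smooth_on \<Omega> (\<lambda>x. X x \<bullet> v / (X x \<bullet> X x))" by (simp add: divide_inverse)
  qed
  have grad: "grad \<phi> x = X x /\<^sub>R (X x \<bullet> X x)" if "x \<in> \<Omega>" for x
    using D\<phi>[OF that] by (intro grad_eqI) (simp add: divide_inverse mult.commute)
  have "frechet_derivative \<phi> (at x) \<noteq> (\<lambda>h. 0)" if "x \<in> \<Omega>" for x
    using frechet_derivativeI[OF D\<phi>[OF that]] X0[OF that]
    by (metis divide_self_if inner_eq_zero_iff zero_neq_one)
  moreover have "hess \<phi> x (grad \<phi> x) (grad \<phi> x) + hess \<phi> x V V = 0"
    if x: "x \<in> \<Omega>" and V: "norm V = norm (grad \<phi> x)" "V \<bullet> grad \<phi> x = 0" for x V
  proof -
    obtain L f where L: "(X has_derivative L) (at x)" and f: "\<And>v. v \<bullet> L v = f * (v \<bullet> v)"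
      using assms(3) x unfolding conformal_field_def by blast
    define n where "n = X x \<bullet> X x"
    have n: "n \<noteq> 0" using X0[OF x] by (simp add: n_def)
    have hess: "hess \<phi> x v w = (L v \<bullet> w) / n - (X x \<bullet> w) * (2 * (X x \<bullet> L v)) / n\<^sup>2" for v w
    proof -
      have "((\<lambda>y. X y \<bullet> w / (X y \<bullet> X y)) has_derivative
          (\<lambda>v. (L v \<bullet> w) / n - (X x \<bullet> w) * (2 * (X x \<bullet> L v)) / n\<^sup>2)) (at x)"
        using n unfolding n_def
        by (auto intro!: derivative_eq_intros L simp: power2_eq_square inner_commute field_simps)
      then have "(dir_deriv w \<phi> has_derivative
          (\<lambda>v. (L v \<bullet> w) / n - (X x \<bullet> w) * (2 * (X x \<bullet> L v)) / n\<^sup>2)) (at x)"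
        by (rule has_derivative_cong_open[OF op x, rotated]) (simp add: frechet_derivativeI[OF D\<phi>])
      then show ?thesis unfolding hess_def by (simp add: frechet_derivativeI)
    qed
    interpret bounded_linear L using L by (rule has_derivative_bounded_linear)
    have g: "grad \<phi> x = X x /\<^sub>R n" using grad[OF x] by (simp add: n_def)
    have "X x \<bullet> L (X x) = f * n" using f[of "X x"] by (simp add: n_def)
    then have hNN: "hess \<phi> x (grad \<phi> x) (grad \<phi> x) = - f / n\<^sup>2"
      unfolding hess g using n
      by (simp add: scaleR inner_commute flip: n_def) (simp add: field_simps power2_eq_square)
    have "V \<bullet> X x = 0" using V(2) n by (simp add: g)
    moreover have "V \<bullet> V = 1 / n"
    proof -
      have "V \<bullet> V = grad \<phi> x \<bullet> grad \<phi> x" using V(1) by (simp add: norm_eq)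
      also have "\<dots> = 1 / n" unfolding g using n by (simp add: field_simps flip: n_def)
      finally show ?thesis .
    qed
    ultimately have "hess \<phi> x V V = f / n\<^sup>2"
      unfolding hess[of V V] using f[of V] by (simp add: inner_commute power2_eq_square)
    then show ?thesis using hNN by simp
  qed
  ultimately show ?thesis using op sm by (simp add: LCW_def)
qed

lemma has_field_rescale:
  assumes "has_field \<Omega> \<phi> X" "a \<noteq> 0"
  shows "has_field \<Omega> (\<lambda>x. a * \<phi> x + b) (\<lambda>x. X x /\<^sub>R a)"
  unfolding has_field_def
proof (intro ballI conjI)
  fix x assume x: "x \<in> \<Omega>"
  then show "X x /\<^sub>R a \<noteq> 0" using assms by (auto simp: has_field_def)
  have "((\<lambda>x. a * \<phi> x + b) has_derivative (\<lambda>v. a * (X x \<bullet> v / (X x \<bullet> X x)))) (at x)"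
    using assms x by (auto simp: has_field_def intro!: derivative_eq_intros)
  then show "((\<lambda>x. a * \<phi> x + b) has_derivative (\<lambda>v. (X x /\<^sub>R a) \<bullet> v / ((X x /\<^sub>R a) \<bullet> (X x /\<^sub>R a)))) (at x)"
    using assms(2) by (simp add: field_simps)
qed

lemma LCW_rescale:
  fixes \<phi> :: "'a::euclidean_space \<Rightarrow> real"
  assumes "LCW \<Omega> \<phi>" "a \<noteq> 0"
  shows "LCW \<Omega> (\<lambda>x. a * \<phi> x + b)"
proof -
  obtain X where X: "has_field \<Omega> \<phi> X" "conformal_field \<Omega> X" "smooth_field \<Omega> X"
    using LCW_imp_field[OF assms(1)] by blast
  have op: "open \<Omega>" using assms(1) by (simp add: LCW_def)
  show ?thesis
  proof (rule LCW_if_field[OF op has_field_rescale[OF X(1) assms(2)]])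
    show "smooth_field \<Omega> (\<lambda>x. X x /\<^sub>R a)"
      using X(3) smooth_on_mult[OF op smooth_on_const[OF op]] by (simp add: smooth_field_def)
    show "conformal_field \<Omega> (\<lambda>x. X x /\<^sub>R a)"
      unfolding conformal_field_def
    proof
      fix x assume "x \<in> \<Omega>"
      then obtain L f where "(X has_derivative L) (at x)" "\<And>v. v \<bullet> L v = f * (v \<bullet> v)"
        using X(2) unfolding conformal_field_def by blast
      then have "((\<lambda>x. X x /\<^sub>R a) has_derivative (\<lambda>v. L v /\<^sub>R a)) (at x)"
        "\<And>v. v \<bullet> (L v /\<^sub>R a) = f / a * (v \<bullet> v)"
        by (auto intro!: derivative_eq_intros simp: divide_inverse)
      then show "\<exists>L f. ((\<lambda>x. X x /\<^sub>R a) has_derivative L) (at x) \<and> (\<forall>v. v \<bullet> L v = f * (v \<bullet> v))"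
        by blast
    qed
  qed
qed

text \<open>
  For a conformal map \<open>F\<close> the field pulls back as a vector field, \<open>DF (Y x) = X (F x)\<close>, although its
  definition involves the norm of the gradient: the derivative of \<open>F\<close> only rescales inner products,
  and the factor cancels.
\<close>

lemma has_field_pull:
  assumes "has_field \<Omega> \<phi> X"
    and "\<And>x. x \<in> \<Omega>' \<Longrightarrow> F x \<in> \<Omega>"
    and "\<And>x. x \<in> \<Omega>' \<Longrightarrow> (F has_derivative DF x) (at x)"
    and "\<And>x. x \<in> \<Omega>' \<Longrightarrow> DF x (Y x) = X (F x)"
    and "\<And>x v w. x \<in> \<Omega>' \<Longrightarrow> DF x v \<bullet> DF x w = m x * (v \<bullet> w)"
  shows "has_field \<Omega>' (\<lambda>x. \<phi> (F x)) Y"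
  unfolding has_field_def
proof (intro ballI conjI)
  fix x assume x: "x \<in> \<Omega>'"
  interpret bounded_linear "DF x" using assms(3)[OF x] by (rule has_derivative_bounded_linear)
  have X: "X (F x) \<noteq> 0" "(\<phi> has_derivative (\<lambda>v. X (F x) \<bullet> v / (X (F x) \<bullet> X (F x)))) (at (F x))"
    using assms(1,2) x by (auto simp: has_field_def)
  show "Y x \<noteq> 0" using X(1) assms(4)[OF x] zero by metis
  have XX: "X (F x) \<bullet> X (F x) = m x * (Y x \<bullet> Y x)"
    using assms(5)[OF x, of "Y x" "Y x"] by (simp only: assms(4)[OF x])
  then have "m x \<noteq> 0" using X(1) by auto
  moreover have "X (F x) \<bullet> DF x v = m x * (Y x \<bullet> v)" for v
    using assms(5)[OF x, of "Y x" v] by (simp only: assms(4)[OF x])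
  ultimately have "X (F x) \<bullet> DF x v / (X (F x) \<bullet> X (F x)) = Y x \<bullet> v / (Y x \<bullet> Y x)" for v
    by (simp add: XX)
  then show "((\<lambda>x. \<phi> (F x)) has_derivative (\<lambda>v. Y x \<bullet> v / (Y x \<bullet> Y x))) (at x)"
    using has_derivative_compose[OF assms(3)[OF x] X(2)] by simp
qed

subsection \<open>Similarities\<close>

definition similarity :: "('a::euclidean_space \<Rightarrow> 'a) \<Rightarrow> bool" where
  "similarity f \<longleftrightarrow> (\<exists>r A d. r > 0 \<and> orthogonal_transformation A \<and> f = (\<lambda>x. r *\<^sub>R A x + d))"

lemma similarityI: "r > 0 \<Longrightarrow> orthogonal_transformation A \<Longrightarrow> similarity (\<lambda>x. r *\<^sub>R A x + d)"
  by (auto simp: similarity_def)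

text \<open>The inverse comes with the adjoint identity, in which form it is applied to fields.\<close>

lemma orthogonal_transformation_adjoint:
  fixes A :: "'a::euclidean_space \<Rightarrow> 'a"
  assumes "orthogonal_transformation A"
  obtains B where "orthogonal_transformation B" "\<And>x. A (B x) = x" "\<And>x. B (A x) = x"
    "\<And>x y. B x \<bullet> y = x \<bullet> A y"
proof
  have b: "bij A" by (rule orthogonal_transformation_bij[OF assms])
  show "orthogonal_transformation (inv_into UNIV A)" by (rule orthogonal_transformation_inv[OF assms])
  show AB: "A (inv_into UNIV A x) = x" for x using b by (simp add: bij_is_surj surj_f_inv_f)
  show "inv_into UNIV A (A x) = x" for x using b by (simp add: bij_is_inj)
  show "inv_into UNIV A x \<bullet> y = x \<bullet> A y" for x y
    using assms AB[of x] unfolding orthogonal_transformation_def by metis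
qed

lemma similarity_data:
  fixes f :: "'a::euclidean_space \<Rightarrow> 'a"
  assumes "similarity f"
  shows "\<exists>r A B d. r > 0 \<and> orthogonal_transformation A \<and> orthogonal_transformation B \<and>
    (\<forall>x. f x = r *\<^sub>R A x + d) \<and> (\<forall>x. A (B x) = x) \<and> (\<forall>x. B (A x) = x) \<and>
    (\<forall>x y. B x \<bullet> y = x \<bullet> A y)"
proof -
  obtain r A d where *: "r > 0" "orthogonal_transformation A" "f = (\<lambda>x. r *\<^sub>R A x + d)"
    using assms unfolding similarity_def by blast
  obtain B where "orthogonal_transformation B" "\<And>x. A (B x) = x" "\<And>x. B (A x) = x"
    "\<And>x y. B x \<bullet> y = x \<bullet> A y"
    using orthogonal_transformation_adjoint[OF *(2)] by blast
  then show ?thesis using * by (intro exI[of _ r] exI[of _ A] exI[of _ B] exI[of _ d]) simp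
qed

lemma similarity_has_derivative:
  fixes A :: "'a::euclidean_space \<Rightarrow> 'a"
  assumes "orthogonal_transformation A"
  shows "((\<lambda>x. r *\<^sub>R A x + d) has_derivative (\<lambda>v. r *\<^sub>R A v)) (at x)"
  using assms
  by (auto intro!: derivative_eq_intros bounded_linear_imp_has_derivative
      simp: linear_linear orthogonal_transformation_linear)

lemma similarity_continuous:
  fixes f :: "'a::euclidean_space \<Rightarrow> 'a"
  assumes "similarity f" shows "continuous_on S f"
proof -
  obtain r A d where "orthogonal_transformation A" and f: "f = (\<lambda>x. r *\<^sub>R A x + d)"
    using assms unfolding similarity_def by blast
  then have "isCont f x" for x
    using similarity_has_derivative has_derivative_continuous by metis
  then show ?thesis by (simp add: continuous_at_imp_continuous_on)
qed

lemma open_similarity_vimage: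
  fixes f :: "'a::euclidean_space \<Rightarrow> 'a"
  assumes "similarity f" "open \<Omega>" shows "open {x. f x \<in> \<Omega>}"
  using open_vimage[OF assms(2) similarity_continuous[OF assms(1)]] by (simp add: vimage_def)

lemma has_field_similarity:
  fixes A :: "'a::euclidean_space \<Rightarrow> 'a"
  assumes "has_field \<Omega> \<phi> X" "r > 0" "orthogonal_transformation A" "\<And>x. A (B x) = x"
    and "\<And>x. x \<in> \<Omega>' \<Longrightarrow> r *\<^sub>R A x + d \<in> \<Omega>"
  shows "has_field \<Omega>' (\<lambda>x. \<phi> (r *\<^sub>R A x + d)) (\<lambda>x. B (X (r *\<^sub>R A x + d)) /\<^sub>R r)"
proof (rule has_field_pull[OF assms(1) assms(5) similarity_has_derivative[OF assms(3)]])
  fix x v w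
  show "r *\<^sub>R A (B (X (r *\<^sub>R A x + d)) /\<^sub>R r) = X (r *\<^sub>R A x + d)"
    using assms(2,4) orthogonal_transformation_linear[OF assms(3)] by (simp add: linear_scale)
  show "(r *\<^sub>R A v) \<bullet> (r *\<^sub>R A w) = r\<^sup>2 * (v \<bullet> w)"
    using assms(3) by (simp add: orthogonal_transformation_def power2_eq_square)
qed

lemma LCW_similarity:
  fixes \<phi> :: "'a::euclidean_space \<Rightarrow> real"
  assumes "LCW \<Omega> \<phi>" "similarity f"
  shows "LCW {x. f x \<in> \<Omega>} (\<lambda>x. \<phi> (f x))"
proof -
  obtain X where X: "has_field \<Omega> \<phi> X" "conformal_field \<Omega> X" "smooth_field \<Omega> X"
    using LCW_imp_field[OF assms(1)] by blast
  obtain r A B d where r: "r > 0" and A: "orthogonal_transformation A" and B: "orthogonal_transformation B"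
    and f: "\<And>x. f x = r *\<^sub>R A x + d" and AB: "\<And>x. A (B x) = x"
    and "\<And>x. B (A x) = x" and BA: "\<And>x y. B x \<bullet> y = x \<bullet> A y"
    using similarity_data[OF assms(2)] by blast
  have op: "open {x. f x \<in> \<Omega>}"
    using open_similarity_vimage assms by (auto simp: LCW_def)
  have F: "has_field {x. f x \<in> \<Omega>} (\<lambda>x. \<phi> (f x)) (\<lambda>x. B (X (f x)) /\<^sub>R r)"
    unfolding f by (rule has_field_similarity[OF X(1) r A AB]) simp
  show ?thesis
  proof (rule LCW_if_field[OF op F])
    have "smooth_on {x. f x \<in> \<Omega>} (\<lambda>x. f x \<bullet> w)" for w
    proof -
      have "f x \<bullet> w = r * (x \<bullet> B w) + d \<bullet> w" for x
        by (simp add: f inner_add_left) (metis BA inner_commute)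
      then show ?thesis
        by (simp add: op smooth_on_add smooth_on_const smooth_on_mult smooth_on_inner_left)
    qed
    then have "smooth_on {x. f x \<in> \<Omega>} (\<lambda>x. X (f x) \<bullet> w)" for w
      using X(3) by (intro smooth_on_compose[OF op, of f \<Omega> "\<lambda>y. X y \<bullet> w"]) (auto simp: smooth_field_def)
    then show "smooth_field {x. f x \<in> \<Omega>} (\<lambda>x. B (X (f x)) /\<^sub>R r)"
      by (simp add: smooth_field_def BA smooth_on_mult[OF op smooth_on_const[OF op]])
    show "conformal_field {x. f x \<in> \<Omega>} (\<lambda>x. B (X (f x)) /\<^sub>R r)"
      unfolding conformal_field_def
    proof
      fix x assume "x \<in> {x. f x \<in> \<Omega>}"
      then obtain L k where L: "(X has_derivative L) (at (f x))" "\<And>v. v \<bullet> L v = k * (v \<bullet> v)"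
        using X(2) unfolding conformal_field_def by blast
      interpret bounded_linear L using L by (auto intro: has_derivative_bounded_linear)
      have "bounded_linear B" using B by (simp add: linear_linear orthogonal_transformation_linear)
      then interpret B: bounded_linear B .
      have "(f has_derivative (\<lambda>v. r *\<^sub>R A v)) (at x)"
        unfolding f[abs_def] by (rule similarity_has_derivative[OF A])
      from B.has_derivative[OF has_derivative_compose[OF this L(1)]]
      have "((\<lambda>x. B (X (f x)) /\<^sub>R r) has_derivative (\<lambda>v. B (L (r *\<^sub>R A v)) /\<^sub>R r)) (at x)"
        by (rule has_derivative_scaleR_right)
      moreover have "v \<bullet> (B (L (r *\<^sub>R A v)) /\<^sub>R r) = k * (v \<bullet> v)" for v
      proof -
        have "v \<bullet> (B (L (r *\<^sub>R A v)) /\<^sub>R r) = A v \<bullet> L (A v)"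
          using r BA[of "L (A v)" v] by (simp add: scaleR B.scaleR inner_commute)
        then show ?thesis using A by (simp add: L(2) orthogonal_transformation_def)
      qed
      ultimately show "\<exists>L k. ((\<lambda>x. B (X (f x)) /\<^sub>R r) has_derivative L) (at x) \<and> (\<forall>v. v \<bullet> L v = k * (v \<bullet> v))"
        by blast
    qed
  qed
qed

subsection \<open>The inversion\<close>

text \<open>The inversion in the unit sphere.  The value at \<open>0\<close> is \<open>0\<close>, so that \<open>vinv\<close> is an involution
  without side conditions; the point at infinity is dealt with by \<open>inversion\<close>.\<close>

definition vinv :: "'a::euclidean_space \<Rightarrow> 'a" where
  "vinv x = x /\<^sub>R (x \<bullet> x)"

text \<open>The pullback of a vector field by the inversion, whose derivative at \<open>x\<close> is the reflection in the
  hyperplane orthogonal to \<open>x\<close> divided by \<open>|x|\<^sup>2\<close>.\<close>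

definition inverted_field :: "('a::euclidean_space \<Rightarrow> 'a) \<Rightarrow> 'a \<Rightarrow> 'a" where
  "inverted_field X x = (x \<bullet> x) *\<^sub>R X (vinv x) - (2 * (x \<bullet> X (vinv x))) *\<^sub>R x"

lemma vinv_eq_0_iff [simp]: "vinv x = 0 \<longleftrightarrow> x = 0"
  by (simp add: vinv_def)

lemma vinv_vinv [simp]: "vinv (vinv x) = x"
  by (cases "x = 0") (simp_all add: vinv_def field_simps)

lemma vinv_has_derivative:
  "x \<noteq> 0 \<Longrightarrow> (vinv has_derivative (\<lambda>v. v /\<^sub>R (x \<bullet> x) - (2 * (x \<bullet> v) / (x \<bullet> x)\<^sup>2) *\<^sub>R x)) (at x)"
  unfolding vinv_def[abs_def] using has_derivative_inversion[OF has_derivative_ident] by blast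

lemma has_field_inversion:
  assumes "has_field \<Omega> \<phi> X" "\<And>x. x \<in> \<Omega>' \<Longrightarrow> x \<noteq> 0 \<and> vinv x \<in> \<Omega>"
  shows "has_field \<Omega>' (\<lambda>x. \<phi> (vinv x)) (inverted_field X)"
proof (rule has_field_pull[OF assms(1), where m = "\<lambda>x. 1 / (x \<bullet> x)\<^sup>2"])
  fix x v w assume x: "x \<in> \<Omega>'"
  then show "vinv x \<in> \<Omega>" using assms(2) by blast
  show "(vinv has_derivative (\<lambda>v. v /\<^sub>R (x \<bullet> x) - (2 * (x \<bullet> v) / (x \<bullet> x)\<^sup>2) *\<^sub>R x)) (at x)"
    using assms(2)[OF x] by (simp add: vinv_has_derivative)
  define n where "n = x \<bullet> x"
  have n: "n \<noteq> 0" using assms(2)[OF x] by (simp add: n_def)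
  have xY: "x \<bullet> inverted_field X x = - n * (x \<bullet> X (vinv x))"
    by (simp add: inverted_field_def inner_diff_right flip: n_def)
  have "inverted_field X x /\<^sub>R n - (2 * (x \<bullet> inverted_field X x) / n\<^sup>2) *\<^sub>R x = X (vinv x)"
    using n unfolding xY
    by (simp add: inverted_field_def scaleR_diff_right field_simps power2_eq_square flip: n_def)
  then show "inverted_field X x /\<^sub>R (x \<bullet> x) - (2 * (x \<bullet> inverted_field X x) / (x \<bullet> x)\<^sup>2) *\<^sub>R x = X (vinv x)"
    by (simp add: n_def)
  have "(v /\<^sub>R n - (2 * (x \<bullet> v) / n\<^sup>2) *\<^sub>R x) \<bullet> (w /\<^sub>R n - (2 * (x \<bullet> w) / n\<^sup>2) *\<^sub>R x) = 1 / n\<^sup>2 * (v \<bullet> w)"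
    using n by (simp add: inner_diff_left inner_diff_right inner_commute flip: n_def)
      (simp add: field_simps power2_eq_square power4_eq_xxxx)
  then show "(v /\<^sub>R (x \<bullet> x) - (2 * (x \<bullet> v) / (x \<bullet> x)\<^sup>2) *\<^sub>R x) \<bullet> (w /\<^sub>R (x \<bullet> x) - (2 * (x \<bullet> w) / (x \<bullet> x)\<^sup>2) *\<^sub>R x)
    = 1 / (x \<bullet> x)\<^sup>2 * (v \<bullet> w)"
    by (simp add: n_def)
qed

lemma open_vinv_vimage: "open \<Omega> \<Longrightarrow> open {x::'a::euclidean_space. x \<noteq> 0 \<and> vinv x \<in> \<Omega>}"
proof -
  assume op: "open \<Omega>"
  have "continuous_on (- {0::'a}) vinv"
    unfolding vinv_def[abs_def] by (intro continuous_intros) auto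
  then have "open (vinv -` \<Omega> \<inter> - {0::'a})"
    using op continuous_on_open_vimage[of "- {0::'a}" vinv] by auto
  moreover have "vinv -` \<Omega> \<inter> - {0::'a} = {x. x \<noteq> 0 \<and> vinv x \<in> \<Omega>}" by auto
  ultimately show ?thesis by simp
qed

text \<open>With \<open>R\<close> the reflection in the hyperplane orthogonal to \<open>x\<close> and \<open>y = X (vinv x)\<close>, the quadratic
  form of the derivative of the inverted field at \<open>v\<close> is the one of \<open>X\<close> at \<open>R v\<close> plus
  \<open>- 2 (x \<bullet> y) |v|\<^sup>2\<close>: the terms \<open>\<plusminus> 2 (x \<bullet> v) (v \<bullet> y)\<close> from the two factors cancel.\<close>

lemma LCW_inversion:
  fixes \<phi> :: "'a::euclidean_space \<Rightarrow> real"
  assumes "LCW \<Omega> \<phi>"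
  shows "LCW {x. x \<noteq> 0 \<and> vinv x \<in> \<Omega>} (\<lambda>x. \<phi> (vinv x))" (is "LCW ?U _")
proof -
  obtain X where X: "has_field \<Omega> \<phi> X" "conformal_field \<Omega> X" "smooth_field \<Omega> X"
    using LCW_imp_field[OF assms(1)] by blast
  have op: "open ?U"
    using open_vinv_vimage assms by (auto simp: LCW_def)
  show ?thesis
  proof (rule LCW_if_field[OF op has_field_inversion[OF X(1)]])
    have id: "smooth_on ?U (\<lambda>x. x \<bullet> w)" for w by (rule smooth_on_inner_left[OF op])
    have xx: "smooth_on ?U (\<lambda>x. x \<bullet> x)" by (rule smooth_on_inner[OF op id id])
    have "smooth_on ?U (\<lambda>x. inverse (x \<bullet> x) * (x \<bullet> w))" for w
      by (intro smooth_on_mult smooth_on_inverse op id xx) auto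
    then have "smooth_on ?U (\<lambda>x. vinv x \<bullet> w)" for w by (simp add: vinv_def)
    then have Xv: "smooth_on ?U (\<lambda>x. X (vinv x) \<bullet> w)" for w
      using X(3) by (intro smooth_on_compose[OF op, of vinv \<Omega> "\<lambda>y. X y \<bullet> w"]) (auto simp: smooth_field_def)
    have "smooth_on ?U (\<lambda>x. (x \<bullet> x) * (X (vinv x) \<bullet> w) - (2 * (x \<bullet> X (vinv x))) * (x \<bullet> w))" for w
      by (intro smooth_on_diff smooth_on_mult smooth_on_inner[OF op id Xv] op id xx Xv smooth_on_const)
    then show "smooth_field ?U (inverted_field X)"
      by (simp add: smooth_field_def inverted_field_def inner_diff_left)
    show "conformal_field ?U (inverted_field X)"
      unfolding conformal_field_def
    proof
      fix x assume x: "x \<in> ?U"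
      then obtain L k where L: "(X has_derivative L) (at (vinv x))" "\<And>v. v \<bullet> L v = k * (v \<bullet> v)"
        using X(2) unfolding conformal_field_def by blast
      interpret bounded_linear L using L by (auto intro: has_derivative_bounded_linear)
      define n y where "n = x \<bullet> x" and "y = X (vinv x)"
      have n: "n \<noteq> 0" using x by (simp add: n_def)
      define R where "R v = v - (2 * (x \<bullet> v) / n) *\<^sub>R x" for v
      define M where "M v = L (R v /\<^sub>R n)" for v
      have "(vinv has_derivative (\<lambda>v. v /\<^sub>R n - (2 * (x \<bullet> v) / n\<^sup>2) *\<^sub>R x)) (at x)"
        using x vinv_has_derivative[of x] by (simp add: n_def)
      moreover have "v /\<^sub>R n - (2 * (x \<bullet> v) / n\<^sup>2) *\<^sub>R x = R v /\<^sub>R n" for v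
        using n by (simp add: R_def scaleR_diff_right field_simps power2_eq_square)
      ultimately have "(vinv has_derivative (\<lambda>v. R v /\<^sub>R n)) (at x)" by simp
      then have "((\<lambda>x. X (vinv x)) has_derivative M) (at x)"
        using has_derivative_compose[of vinv "\<lambda>v. R v /\<^sub>R n" x UNIV X L] L(1) by (simp add: M_def[abs_def])
      then have "(inverted_field X has_derivative
          (\<lambda>v. (2 * (x \<bullet> v)) *\<^sub>R y + n *\<^sub>R M v - (2 * (v \<bullet> y + x \<bullet> M v)) *\<^sub>R x - (2 * (x \<bullet> y)) *\<^sub>R v)) (at x)"
        unfolding inverted_field_def[abs_def] n_def y_def
        by (auto intro!: derivative_eq_intros simp: inner_commute algebra_simps)
      moreover have "v \<bullet> ((2 * (x \<bullet> v)) *\<^sub>R y + n *\<^sub>R M v - (2 * (v \<bullet> y + x \<bullet> M v)) *\<^sub>R x - (2 * (x \<bullet> y)) *\<^sub>R v)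
          = (k - 2 * (x \<bullet> y)) * (v \<bullet> v)" for v
      proof -
        have "n * (v \<bullet> M v) - 2 * (x \<bullet> M v) * (x \<bullet> v) = R v \<bullet> L (R v)"
          using n unfolding M_def scaleR by (simp add: R_def[of v] inner_diff_left field_simps)
        also have "\<dots> = k * (v \<bullet> v)"
          unfolding L(2) using n
          by (simp add: R_def inner_diff_left inner_diff_right inner_commute flip: n_def; simp add: field_simps)
        finally show ?thesis
          by (simp add: inner_diff_right inner_add_right inner_commute algebra_simps)
      qed
      ultimately show "\<exists>L k. (inverted_field X has_derivative L) (at x) \<and> (\<forall>v. v \<bullet> L v = k * (v \<bullet> v))"
        by blast
    qed
  qed auto
qed

section \<open>The conformal group\<close>

lemma subgroup_compositions:
  fixes S :: "('b \<Rightarrow> 'b) set"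
  assumes "S \<noteq> {}" "\<And>F. F \<in> S \<Longrightarrow> \<exists>G\<in>S. G \<circ> F = id \<and> F \<circ> G = id"
  shows "subgroup (compositions S) (BijGroup UNIV)"
proof -
  have inv: "\<exists>G\<in>compositions S. G \<circ> F = id \<and> F \<circ> G = id" if "F \<in> compositions S" for F
    using that
  proof induction
    case (base F)
    then show ?case using assms(2) compositions.base by metis
  next
    case (comp F G)
    then obtain F' G' where FG: "F' \<in> compositions S" "G' \<in> compositions S"
      "F' \<circ> F = id" "F \<circ> F' = id" "G' \<circ> G = id" "G \<circ> G' = id" by blast
    have "(G' \<circ> F') \<circ> (F \<circ> G) = id \<and> (F \<circ> G) \<circ> (G' \<circ> F') = id"
      using FG(3-6) by (simp add: fun_eq_iff)
    then show ?case using compositions.comp[OF FG(2,1)] by (rule bexI)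
  qed
  have bij: "F \<in> carrier (BijGroup UNIV)" if "F \<in> compositions S" for F
    using inv[OF that] o_bij by (auto simp: BijGroup_def Bij_def)
  have mult: "F \<otimes>\<^bsub>BijGroup UNIV\<^esub> G = F \<circ> G"
    if "F \<in> compositions S" "G \<in> compositions S" for F G
    using bij[OF that(1)] bij[OF that(2)] by (auto simp: BijGroup_def compose_def comp_def)
  interpret group "BijGroup UNIV :: ('b \<Rightarrow> 'b) monoid" by (rule group_BijGroup)
  have one: "\<one>\<^bsub>BijGroup UNIV\<^esub> = (id :: 'b \<Rightarrow> 'b)" by (auto simp: BijGroup_def)
  show ?thesis
  proof
    show "compositions S \<subseteq> carrier (BijGroup UNIV)" using bij by blast
    show "F \<otimes>\<^bsub>BijGroup UNIV\<^esub> G \<in> compositions S"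
      if "F \<in> compositions S" "G \<in> compositions S" for F G
      using mult[OF that] compositions.comp[OF that] by simp
    obtain F where "F \<in> compositions S" using assms(1) compositions.base by blast
    then show "\<one>\<^bsub>BijGroup UNIV\<^esub> \<in> compositions S"
      using inv[of F] compositions.comp unfolding one by metis
    show "inv\<^bsub>BijGroup UNIV\<^esub> F \<in> compositions S" if F: "F \<in> compositions S" for F
    proof -
      obtain G where G: "G \<in> compositions S" "G \<circ> F = id" using inv[OF F] by blast
      have "inv\<^bsub>BijGroup UNIV\<^esub> F = G"
        by (rule inv_equality) (use G bij F mult one in auto)
      then show ?thesis using G by simp
    qed
  qed
qed

lemma affine_generators_inverse:
  fixes F :: "'a::euclidean_space option \<Rightarrow> 'a option"
  assumes "F \<in> affine_generators"
  shows "\<exists>G\<in>affine_generators. G \<circ> F = id \<and> F \<circ> G = id"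
proof -
  have *: "map_option g \<circ> map_option f = id \<and> map_option f \<circ> map_option g = id"
    if "\<And>x. g (f x) = x" "\<And>x. f (g x) = x" for f g :: "'a \<Rightarrow> 'a"
    using that by (auto simp: fun_eq_iff option.map_comp comp_def option.map_ident)
  consider c where "F = map_option (\<lambda>x. x + c)" | r where "r > 0" "F = map_option (\<lambda>x. r *\<^sub>R x)"
    | A where "orthogonal_transformation A" "F = map_option A"
    using assms unfolding affine_generators_def by blast
  then show ?thesis
  proof cases
    case 1
    have "map_option (\<lambda>x. x + (- c)) \<in> affine_generators" unfolding affine_generators_def by blast
    moreover have "map_option (\<lambda>x. x + (- c)) \<circ> F = id \<and> F \<circ> map_option (\<lambda>x. x + (- c)) = id"
      unfolding 1 by (rule *) auto
    ultimately show ?thesis by blast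
  next
    case 2
    have "inverse r > 0" using 2 by simp
    then have "map_option (\<lambda>x. inverse r *\<^sub>R x) \<in> affine_generators" unfolding affine_generators_def by blast
    moreover have "map_option (\<lambda>x. inverse r *\<^sub>R x) \<circ> F = id \<and> F \<circ> map_option (\<lambda>x. inverse r *\<^sub>R x) = id"
      unfolding 2(2) by (rule *) (use 2(1) in auto)
    ultimately show ?thesis by blast
  next
    case 3
    obtain B where B: "orthogonal_transformation B" "\<And>x. A (B x) = x" "\<And>x. B (A x) = x"
      using orthogonal_transformation_adjoint[OF 3(1)] by metis
    then have "map_option B \<in> affine_generators" unfolding affine_generators_def by blast
    moreover have "map_option B \<circ> F = id \<and> F \<circ> map_option B = id"
      unfolding 3(2) by (rule *) (use B in auto)
    ultimately show ?thesis by blast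
  qed
qed

lemma inversion_simps [simp]:
  "inversion None = Some 0" "inversion (Some x) = (if x = 0 then None else Some (vinv x))"
  by (simp_all add: inversion_def vinv_def power2_norm_eq_inner)

lemma inversion_inversion: "inversion \<circ> inversion = id"
proof
  show "(inversion \<circ> inversion) p = id p" for p :: "'a option" by (cases p) auto
qed

lemma affine_generators_nonempty: "affine_generators \<noteq> {}"
  unfolding affine_generators_def by blast

lemma subgroup_affine_conformal_maps: "subgroup affine_conformal_maps (BijGroup UNIV)"
  unfolding affine_conformal_maps_def
  by (rule subgroup_compositions[OF affine_generators_nonempty affine_generators_inverse])

lemma subgroup_conformal_maps: "subgroup conformal_maps (BijGroup UNIV)"
  unfolding conformal_maps_def
proof (rule subgroup_compositions)
  fix F :: "'a option \<Rightarrow> 'a option"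
  assume "F \<in> insert inversion affine_generators"
  then show "\<exists>G\<in>insert inversion affine_generators. G \<circ> F = id \<and> F \<circ> G = id"
    using affine_generators_inverse inversion_inversion by (metis insert_iff)
qed simp

lemma similarity_comp:
  assumes "similarity f" "similarity g"
  shows "similarity (\<lambda>x. f (g x))"
proof -
  obtain r A d where f: "r > 0" "orthogonal_transformation A" "f = (\<lambda>x. r *\<^sub>R A x + d)"
    using assms(1) unfolding similarity_def by blast
  obtain s B e where g: "s > 0" "orthogonal_transformation B" "g = (\<lambda>x. s *\<^sub>R B x + e)"
    using assms(2) unfolding similarity_def by blast
  interpret A: linear A using f(2) by (rule orthogonal_transformation_linear)
  have "(\<lambda>x. f (g x)) = (\<lambda>x. (r * s) *\<^sub>R (A \<circ> B) x + (r *\<^sub>R A e + d))"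
    by (auto simp: f g A.add A.scale algebra_simps)
  moreover have "similarity (\<lambda>x. (r * s) *\<^sub>R (A \<circ> B) x + (r *\<^sub>R A e + d))"
    by (rule similarityI[OF mult_pos_pos[OF f(1) g(1)] orthogonal_transformation_compose[OF f(2) g(2)]])
  ultimately show ?thesis by simp
qed

lemma similarity_translation: "similarity (\<lambda>x. x + c)"
  using similarityI[of 1 "\<lambda>x. x" c] orthogonal_transformation_id by simp

lemma similarity_scale: "r > 0 \<Longrightarrow> similarity (\<lambda>x. r *\<^sub>R x)"
  using similarityI[of r "\<lambda>x. x" 0] orthogonal_transformation_id by simp

lemma similarity_orthogonal: "orthogonal_transformation A \<Longrightarrow> similarity A"
  using similarityI[of 1 A 0] by simp

lemma similarity_inverse:
  fixes f :: "'a::euclidean_space \<Rightarrow> 'a"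
  assumes "similarity f"
  obtains g where "similarity g" "\<And>x. f (g x) = x" "\<And>x. g (f x) = x"
proof -
  obtain r A B d where rA: "r > 0" "orthogonal_transformation A" "orthogonal_transformation B"
    "\<And>x. f x = r *\<^sub>R A x + d" "\<And>x. A (B x) = x" "\<And>x. B (A x) = x" "\<And>x y. B x \<bullet> y = x \<bullet> A y"
    using similarity_data[OF assms] by blast
  interpret A: linear A using rA(2) by (rule orthogonal_transformation_linear)
  have r: "r \<noteq> 0" using rA(1) by simp
  interpret B: linear B using rA(3) by (rule orthogonal_transformation_linear)
  show thesis
  proof (rule that[of "\<lambda>x. inverse r *\<^sub>R B x + (- inverse r *\<^sub>R B d)"])
    show "similarity (\<lambda>x. inverse r *\<^sub>R B x + (- inverse r *\<^sub>R B d))"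
      using rA by (intro similarityI) auto
    show "f (inverse r *\<^sub>R B x + (- inverse r *\<^sub>R B d)) = x" for x
      using r by (simp add: rA A.add A.scale A.neg A.diff scaleR_diff_right)
    show "inverse r *\<^sub>R B (f x) + (- inverse r *\<^sub>R B d) = x" for x
      using r by (simp add: rA B.add B.scale B.neg B.diff scaleR_add_right)
  qed
qed

lemma affine_conformal_maps_eq: "affine_conformal_maps = {map_option f | f. similarity f}"
proof (intro equalityI subsetI)
  fix F :: "'a option \<Rightarrow> 'a option"
  assume "F \<in> affine_conformal_maps"
  then show "F \<in> {map_option f | f. similarity f}"
    unfolding affine_conformal_maps_def
  proof induction
    case (base F)
    then show ?case
      unfolding affine_generators_def
      using similarity_translation similarity_scale similarity_orthogonal by blast
  next
    case (comp F G)
    then obtain f g where "similarity f" "similarity g" "F = map_option f" "G = map_option g" by blast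
    moreover have "map_option f \<circ> map_option g = map_option (\<lambda>x. f (g x))"
      by (simp add: fun_eq_iff option.map_comp comp_def)
    ultimately show ?case using similarity_comp by blast
  qed
next
  fix F :: "'a option \<Rightarrow> 'a option"
  assume "F \<in> {map_option f | f. similarity f}"
  then obtain r A d where rA: "r > 0" "orthogonal_transformation A" "F = map_option (\<lambda>x. r *\<^sub>R A x + d)"
    unfolding similarity_def by blast
  have "F = map_option (\<lambda>x. x + d) \<circ> (map_option (\<lambda>x. r *\<^sub>R x) \<circ> map_option A)"
    by (simp add: rA fun_eq_iff option.map_comp comp_def)
  moreover have "map_option (\<lambda>x. x + d) \<in> affine_generators" "map_option (\<lambda>x. r *\<^sub>R x) \<in> affine_generators"
    "map_option A \<in> affine_generators"
    using rA unfolding affine_generators_def by blast+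
  ultimately show "F \<in> affine_conformal_maps"
    unfolding affine_conformal_maps_def using compositions.intros by metis
qed

lemma affine_subset_conformal: "affine_conformal_maps \<subseteq> conformal_maps"
proof
  show "F \<in> affine_conformal_maps \<Longrightarrow> F \<in> conformal_maps" for F :: "'a option \<Rightarrow> 'a option"
    unfolding affine_conformal_maps_def conformal_maps_def
  proof (induction rule: compositions.induct)
    case (base F)
    then show ?case by (intro compositions.base) simp
  next
    case (comp F G)
    then show ?case by (intro compositions.comp)
  qed
qed

subsection \<open>Normal form\<close>

text \<open>
  A word in the generators may pass through \<open>\<infinity>\<close> at points where the composed map is finite and
  smooth, so invariance statements cannot be proved generator by generator along the word.  In the
  normal form the only point of this sort is the pole.
\<close>

text \<open>The conformal maps with a finite pole: \<open>- p\<close> is the only point with image \<open>\<infinity>\<close>.\<close>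

definition inverted_similarity :: "('a::euclidean_space \<Rightarrow> 'a) \<Rightarrow> 'a \<Rightarrow> 'a option \<Rightarrow> 'a option" where
  "inverted_similarity f p = (\<lambda>x. map_option f (inversion (map_option (\<lambda>x. x + p) x)))"

definition conformal_normal_forms :: "('a::euclidean_space option \<Rightarrow> 'a option) set" where
  "conformal_normal_forms =
     {map_option f | f. similarity f} \<union> {inverted_similarity f p | f p. similarity f}"

lemma normal_form_map: "similarity f \<Longrightarrow> map_option f \<in> conformal_normal_forms"
  and normal_form_inverted: "similarity f \<Longrightarrow> inverted_similarity f p \<in> conformal_normal_forms"
  by (auto simp: conformal_normal_forms_def)

lemma normal_form_cases:
  "F \<in> conformal_normal_forms \<Longrightarrow>
    (\<exists>f. similarity f \<and> F = map_option f) \<or> (\<exists>f p. similarity f \<and> F = inverted_similarity f p)"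
  by (auto simp: conformal_normal_forms_def)

lemma inversion_similarity:
  fixes h :: "'a::euclidean_space \<Rightarrow> 'a"
  assumes "similarity h"
  obtains g p where "similarity g" "\<And>x. inversion (map_option h x) = inverted_similarity g p x"
proof -
  obtain r A B d where rA: "r > 0" "orthogonal_transformation A" "orthogonal_transformation B"
    "\<And>x. h x = r *\<^sub>R A x + d" "\<And>x. A (B x) = x" "\<And>x. B (A x) = x" "\<And>x y. B x \<bullet> y = x \<bullet> A y"
    using similarity_data[OF assms] by blast
  interpret A: linear A using rA(2) by (rule orthogonal_transformation_linear)
  define p where "p = inverse r *\<^sub>R B d"
  have h: "h x = r *\<^sub>R A (x + p)" for x
    using rA(1)[THEN less_imp_neq] by (simp add: rA p_def A.add A.scale scaleR_add_right)
  have h0: "h x = 0 \<longleftrightarrow> x + p = 0" for x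
    using rA(1,6) A.zero by (metis h scaleR_eq_0_iff less_irrefl)
  have v: "vinv (r *\<^sub>R A y) = inverse r *\<^sub>R A (vinv y)" for y
    using rA(1,2) by (simp add: vinv_def A.scale orthogonal_transformation_def)
  show thesis
  proof (rule that[of "\<lambda>x. inverse r *\<^sub>R A x" p])
    show "similarity (\<lambda>x. inverse r *\<^sub>R A x)" using similarityI[of "inverse r" A 0] rA by simp
    show "inversion (map_option h x) = inverted_similarity (\<lambda>x. inverse r *\<^sub>R A x) p x" for x
      by (cases x) (auto simp: inverted_similarity_def h0 A.zero, simp add: h v)
  qed
qed

lemma orthogonal_transformation_reflection:
  fixes d :: "'a::euclidean_space"
  shows "orthogonal_transformation (\<lambda>x. x - (2 * (d \<bullet> x) / (d \<bullet> d)) *\<^sub>R d)"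
proof (cases "d = 0")
  case False
  then have dd: "d \<bullet> d \<noteq> 0" by simp
  show ?thesis
    unfolding orthogonal_transformation_def
  proof (intro conjI allI)
    show "linear (\<lambda>x. x - (2 * (d \<bullet> x) / (d \<bullet> d)) *\<^sub>R d)"
      by (auto intro!: linearI simp: inner_add_right add_divide_distrib algebra_simps)
    show "(v - (2 * (d \<bullet> v) / (d \<bullet> d)) *\<^sub>R d) \<bullet> (w - (2 * (d \<bullet> w) / (d \<bullet> d)) *\<^sub>R d) = v \<bullet> w" for v w
      using dd by (simp add: inner_diff_left inner_diff_right inner_commute field_simps)
  qed
qed (simp add: orthogonal_transformation_id)

text \<open>
  A translation by \<open>d \<noteq> 0\<close> conjugated by the inversion has its pole at \<open>- p\<close>, \<open>p = d / |d|\<^sup>2\<close>.  In the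
  coordinate \<open>z = x + p\<close> centred there it is \<open>|d|\<^sup>-\<^sup>2\<close> times the reflection along \<open>d\<close> of
  \<open>z / |z|\<^sup>2\<close>, plus \<open>p\<close>: a similarity after the inversion.
\<close>

lemma inversion_translation_inversion:
  fixes d :: "'a::euclidean_space"
  obtains F where "F \<in> conformal_normal_forms" "\<And>x. inversion (map_option (\<lambda>y. y + d) (inversion x)) = F x"
proof (cases "d = 0")
  case True
  have "similarity (\<lambda>x::'a. x)" using similarity_translation[of 0] by simp
  then have "map_option (\<lambda>x::'a. x) \<in> conformal_normal_forms" by (rule normal_form_map)
  moreover have "inversion (map_option (\<lambda>y. y + d) (inversion x)) = map_option (\<lambda>x. x) x" for x :: "'a option"
    using True by (cases x) (auto simp: option.map_ident)
  ultimately show thesis using that by blast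
next
  case False
  define n p where "n = d \<bullet> d" and "p = d /\<^sub>R n"
  have n: "n \<noteq> 0" "n > 0" using False by (auto simp: n_def)
  define f where "f x = inverse n *\<^sub>R (x - (2 * (d \<bullet> x) / (d \<bullet> d)) *\<^sub>R d) + p" for x
  have sim: "similarity f"
    unfolding f_def[abs_def] using n orthogonal_transformation_reflection by (intro similarityI) auto
  have f0: "f 0 = p" by (simp add: f_def)
  have p0: "p \<noteq> 0" using False n by (simp add: p_def)
  have vd: "vinv d = p" by (simp add: p_def vinv_def n_def)
  then have vp: "vinv p = d" by (metis vinv_vinv)
  have main: "vinv (vinv x + d) = f (vinv (x + p))" if x: "x \<noteq> 0" and xp: "x + p \<noteq> 0" for x
  proof -
    define z where "z = x + p"
    define m k where "m = x \<bullet> x" and "k = d \<bullet> x"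
    have m: "m \<noteq> 0" using x by (simp add: m_def)
    have zz: "z \<bullet> z = m + 2 * k / n + 1 / n"
      using n by (simp add: z_def m_def k_def p_def inner_add_left inner_add_right inner_commute flip: n_def)
        (simp add: field_simps power2_eq_square)
    have zz0: "z \<bullet> z \<noteq> 0" using xp by (simp add: z_def)
    have dz: "d \<bullet> z = k + 1" using n by (simp add: z_def k_def p_def inner_add_right flip: n_def)
    have q: "(vinv x + d) \<bullet> (vinv x + d) = n * (z \<bullet> z) / m"
      unfolding zz using m n
      by (simp add: vinv_def inner_add_left inner_add_right inner_commute flip: m_def n_def k_def)
        (simp add: field_simps)
    have "vinv (vinv x + d) = (m / (n * (z \<bullet> z))) *\<^sub>R (inverse m *\<^sub>R x + d)"
      unfolding vinv_def[of "vinv x + d"] q by (simp add: vinv_def m_def)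
    also have "\<dots> = (1 / (n * (z \<bullet> z))) *\<^sub>R x + (m / (n * (z \<bullet> z))) *\<^sub>R d"
      using m by (simp add: scaleR_add_right)
    finally have lhs: "vinv (vinv x + d) = (1 / (n * (z \<bullet> z))) *\<^sub>R x + (m / (n * (z \<bullet> z))) *\<^sub>R d" .
    define w where "w = z \<bullet> z"
    have w: "w \<noteq> 0" "m = w - 2 * k / n - 1 / n" using zz0 zz by (simp_all add: w_def)
    have "f (vinv z) = inverse n *\<^sub>R (inverse w *\<^sub>R (x + inverse n *\<^sub>R d) - (2 * (inverse w * (k + 1)) / n) *\<^sub>R d)
        + inverse n *\<^sub>R d"
      by (simp add: f_def vinv_def dz p_def flip: n_def w_def) (simp add: z_def p_def)
    also have "\<dots> = (1 / (n * w)) *\<^sub>R x + (1 / (n * w) * (1 / n) - 2 * (k + 1) / w / n / n + 1 / n) *\<^sub>R d"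
      by (rule vector_eq_ldot[THEN iffD1], intro allI)
        (simp add: inner_add_right inner_diff_right algebra_simps divide_inverse)
    also have "1 / (n * w) * (1 / n) - 2 * (k + 1) / w / n / n + 1 / n = m / (n * w)"
      unfolding w(2) using n w(1) by (simp add: field_simps)
    finally have "f (vinv z) = (1 / (n * w)) *\<^sub>R x + (m / (n * w)) *\<^sub>R d" .
    then show ?thesis using lhs by (simp add: z_def w_def)
  qed
  have "inversion (map_option (\<lambda>y. y + d) (inversion x)) = inverted_similarity f p x" for x
  proof (cases x)
    case None
    then show ?thesis using False f0 by (simp add: inverted_similarity_def vd)
  next
    case (Some y)
    consider "y = 0" | "y \<noteq> 0" "y + p = 0" | "y \<noteq> 0" "y + p \<noteq> 0" by blast
    then show ?thesis
    proof cases
      case 1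
      have "f d = inverse n *\<^sub>R (d - 2 *\<^sub>R d) + inverse n *\<^sub>R d"
        using n by (simp add: f_def p_def flip: n_def)
      then have "f d = 0" by (simp add: scaleR_2)
      then show ?thesis using Some 1 p0 by (simp add: inverted_similarity_def vp)
    next
      case 2
      then have "y = - p" by (simp add: eq_neg_iff_add_eq_0)
      then have "vinv y = - d" using vp by (simp add: vinv_def)
      then show ?thesis using Some 2 by (simp add: inverted_similarity_def)
    next
      case 3
      have "vinv y + d \<noteq> 0"
      proof
        assume "vinv y + d = 0"
        then have "vinv y = - d" by (simp add: eq_neg_iff_add_eq_0)
        then have "y = vinv (- d)" by (metis vinv_vinv)
        then have "y = - p" using vd by (simp add: vinv_def)
        then show False using 3 by simp
      qed
      then show ?thesis using Some 3 main by (simp add: inverted_similarity_def)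
    qed
  qed
  moreover have "inverted_similarity f p \<in> conformal_normal_forms"
    using sim by (rule normal_form_inverted)
  ultimately show thesis using that by blast
qed

lemma normal_form_left: "similarity f \<Longrightarrow> F \<in> conformal_normal_forms \<Longrightarrow>
  (\<lambda>x. map_option f (F x)) \<in> conformal_normal_forms"
proof -
  assume f: "similarity f" and F: "F \<in> conformal_normal_forms"
  then consider g where "similarity g" "F = map_option g"
    | g p where "similarity g" "F = inverted_similarity g p"
    using normal_form_cases[OF F] by blast
  then show ?thesis
  proof cases
    case 1
    then have "(\<lambda>x. map_option f (F x)) = map_option (\<lambda>x. f (g x))"
      by (simp add: fun_eq_iff option.map_comp comp_def)
    then show ?thesis using normal_form_map[OF similarity_comp[OF f 1(1)]] by simp
  next
    case 2
    then have "(\<lambda>x. map_option f (F x)) = inverted_similarity (\<lambda>x. f (g x)) p"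
      by (simp add: fun_eq_iff option.map_comp comp_def inverted_similarity_def)
    then show ?thesis using normal_form_inverted[OF similarity_comp[OF f 2(1)]] by simp
  qed
qed

lemma normal_form_right: "F \<in> conformal_normal_forms \<Longrightarrow> similarity f \<Longrightarrow>
  (\<lambda>x. F (map_option f x)) \<in> conformal_normal_forms"
proof -
  assume f: "similarity f" and F: "F \<in> conformal_normal_forms"
  then consider g where "similarity g" "F = map_option g"
    | g p where "similarity g" "F = inverted_similarity g p"
    using normal_form_cases[OF F] by blast
  then show ?thesis
  proof cases
    case 1
    then have "(\<lambda>x. F (map_option f x)) = map_option (\<lambda>x. g (f x))"
      by (simp add: fun_eq_iff option.map_comp comp_def)
    then show ?thesis using normal_form_map[OF similarity_comp[OF 1(1) f]] by simp
  next
    case 2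
    obtain h q where h: "similarity h"
      "\<And>x. inversion (map_option (\<lambda>x. f x + p) x) = inverted_similarity h q x"
      using inversion_similarity[OF similarity_comp[OF similarity_translation[of p] f]] by blast
    have "(\<lambda>x. F (map_option f x)) = (\<lambda>x. map_option g (inverted_similarity h q x))"
      unfolding h(2)[symmetric] by (simp add: 2 fun_eq_iff option.map_comp comp_def inverted_similarity_def)
    moreover have "inverted_similarity h q \<in> conformal_normal_forms"
      using h(1) by (rule normal_form_inverted)
    ultimately show ?thesis using normal_form_left[OF 2(1)] by simp
  qed
qed

lemma inversion_similarity_inversion:
  assumes "similarity h"
  shows "(\<lambda>x. inversion (map_option h (inversion x))) \<in> conformal_normal_forms"
proof -
  obtain g p where g: "similarity g" "\<And>x. inversion (map_option h x) = inverted_similarity g p x"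
    using inversion_similarity[OF assms] by blast
  obtain F where F: "F \<in> conformal_normal_forms"
    "\<And>x. inversion (map_option (\<lambda>y. y + p) (inversion x)) = F x"
    using inversion_translation_inversion[of p] by blast
  have "(\<lambda>x. inversion (map_option h (inversion x))) = (\<lambda>x. map_option g (F x))"
    unfolding F(2)[symmetric] g(2) inverted_similarity_def by simp
  then show ?thesis using normal_form_left[OF g(1) F(1)] by simp
qed

lemma conformal_maps_normal_form: "F \<in> conformal_maps \<Longrightarrow> F \<in> conformal_normal_forms"
  unfolding conformal_maps_def
proof (induction rule: compositions.induct)
  case (base F)
  have id: "similarity (\<lambda>x::'a. x)" using similarity_translation[of 0] by simp
  show ?case
  proof (cases "F = inversion")
    case True
    then have "F = inverted_similarity (\<lambda>x. x) 0"
      by (simp add: fun_eq_iff inverted_similarity_def option.map_ident)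
    then show ?thesis using normal_form_inverted[OF id] by simp
  next
    case False
    then have "F \<in> affine_conformal_maps"
      using base compositions.base unfolding affine_conformal_maps_def by blast
    then show ?thesis unfolding affine_conformal_maps_eq using normal_form_map by auto
  qed
next
  case (comp F G)
  have G: "G \<in> conformal_normal_forms" by fact
  consider f where "similarity f" "F = map_option f"
    | f p where "similarity f" "F = inverted_similarity f p"
    using normal_form_cases[OF comp.IH(1)] by blast
  then show ?case
  proof cases
    case 1
    then show ?thesis using normal_form_left[OF 1(1) G] by (simp add: comp_def)
  next
    case F: 2
    consider g where "similarity g" "G = map_option g"
      | g q where "similarity g" "G = inverted_similarity g q"
      using normal_form_cases[OF G] by blast
    then show ?thesis
    proof cases
      case 1
      then show ?thesis using normal_form_right[OF comp.IH(1) 1(1)] by (simp add: comp_def)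
    next
      case 2
      have "(\<lambda>x. inversion (map_option (\<lambda>x. g x + p) (inversion x))) \<in> conformal_normal_forms"
        by (rule inversion_similarity_inversion[OF similarity_comp[OF similarity_translation 2(1)]])
      from normal_form_right[OF normal_form_left[OF F(1) this] similarity_translation[of q]]
      show ?thesis by (simp add: F 2 comp_def inverted_similarity_def option.map_comp)
    qed
  qed
qed

lemma inverted_similarity_conformal:
  fixes f :: "'a::euclidean_space \<Rightarrow> 'a"
  assumes "similarity f"
  shows "inverted_similarity f p \<in> conformal_maps"
proof -
  have "map_option h \<in> conformal_maps" if "similarity h" for h :: "'a \<Rightarrow> 'a"
    using that affine_subset_conformal unfolding affine_conformal_maps_eq by blast
  moreover have "inversion \<in> conformal_maps" unfolding conformal_maps_def by (blast intro: compositions.base)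
  ultimately have "map_option f \<circ> (inversion \<circ> map_option (\<lambda>x. x + p)) \<in> conformal_maps"
    using assms similarity_translation compositions.comp unfolding conformal_maps_def by metis
  then show ?thesis by (simp add: inverted_similarity_def comp_def)
qed

section \<open>Conformal maps preserve limiting Carleman weights\<close>

lemma has_field_cong:
  assumes "open \<Omega>" "\<And>x. x \<in> \<Omega> \<Longrightarrow> \<phi> x = \<psi> x" "has_field \<Omega> \<phi> X"
  shows "has_field \<Omega> \<psi> X"
proof -
  have "(\<psi> has_derivative D) (at x)" if "x \<in> \<Omega>" "(\<phi> has_derivative D) (at x)" for x D
    by (rule has_derivative_cong_open[OF assms(1) that(1) _ that(2)]) (rule assms(2))
  then show ?thesis using assms(3) by (simp add: has_field_def)
qed

text \<open>Needed because \<open>the (F (Some x))\<close> is unspecified at the pole of \<open>F\<close>, which lies outside the domain.\<close>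

lemma LCW_cong:
  fixes \<phi> :: "'a::euclidean_space \<Rightarrow> real"
  assumes "\<And>x. x \<in> \<Omega> \<Longrightarrow> \<phi> x = \<psi> x" "LCW \<Omega> \<phi>"
  shows "LCW \<Omega> \<psi>"
proof -
  have op: "open \<Omega>" using assms(2) by (simp add: LCW_def)
  obtain X where X: "has_field \<Omega> \<phi> X" "conformal_field \<Omega> X" "smooth_field \<Omega> X"
    using LCW_imp_field[OF assms(2)] by blast
  show ?thesis by (rule LCW_if_field[OF op has_field_cong[OF op assms(1) X(1)] X(2,3)])
qed

lemma LCW_conformal:
  fixes \<phi> :: "'a::euclidean_space \<Rightarrow> real"
  assumes "LCW \<Omega> \<phi>" "F \<in> conformal_maps"
  shows "LCW {x. F (Some x) \<in> Some ` \<Omega>} (\<lambda>x. \<phi> (the (F (Some x))))"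
proof -
  consider f where "similarity f" "F = map_option f"
    | f p where "similarity f" "F = inverted_similarity f p"
    using normal_form_cases[OF conformal_maps_normal_form[OF assms(2)]] by blast
  then show ?thesis
  proof cases
    case 1
    have "{x. F (Some x) \<in> Some ` \<Omega>} = {x. f x \<in> \<Omega>}" using 1 by auto
    then show ?thesis using LCW_similarity[OF assms(1) 1(1)] 1(2) by simp
  next
    case 2
    have "{x. F (Some x) \<in> Some ` \<Omega>} = {x. x + p \<in> {x. x \<noteq> 0 \<and> vinv x \<in> {x. f x \<in> \<Omega>}}}" (is "?U = ?V")
      unfolding 2 by (auto simp: inverted_similarity_def)
    moreover have "LCW ?V (\<lambda>x. \<phi> (f (vinv (x + p))))"
      by (rule LCW_similarity[OF LCW_inversion[OF LCW_similarity[OF assms(1) 2(1)]] similarity_translation])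
    then have "LCW ?V (\<lambda>x. \<phi> (the (F (Some x))))"
      by (rule LCW_cong[rotated]) (auto simp: 2 inverted_similarity_def)
    ultimately show ?thesis by simp
  qed
qed

section \<open>The six kinds of conformal fields\<close>

lemma vector_eqI_inner: "(\<And>v. v \<bullet> x = v \<bullet> y) \<Longrightarrow> x = (y :: 'a::real_inner)"
  using vector_eq_ldot by blast

lemmas inner_expand = inner_add_left inner_add_right inner_diff_left inner_diff_right

text \<open>The generator of rotations in the plane of \<open>u\<close> and \<open>w\<close>: the skew map \<open>w \<otimes> u - u \<otimes> w\<close>.\<close>

definition rotation :: "'a \<Rightarrow> 'a \<Rightarrow> 'a::euclidean_space \<Rightarrow> 'a" where
  "rotation u w x = (u \<bullet> x) *\<^sub>R w - (w \<bullet> x) *\<^sub>R u"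

text \<open>The gradient lines of a pencil of spheres: tangent (\<open>\<kappa> = 0\<close>), intersecting (\<open>\<kappa> > 0\<close>) or disjoint
  (\<open>\<kappa> < 0\<close>).  The zeros are \<open>0\<close>; the sphere of radius \<open>\<surd>\<kappa>\<close> in the hyperplane orthogonal to \<open>b\<close>; and the
  two points on the line of \<open>b\<close> at distance \<open>\<surd>(- \<kappa>)\<close> from the origin, respectively.\<close>

definition pencil :: "real \<Rightarrow> 'a \<Rightarrow> 'a::euclidean_space \<Rightarrow> 'a" where
  "pencil \<kappa> b x = \<kappa> *\<^sub>R b + (2 * (b \<bullet> x)) *\<^sub>R x - (x \<bullet> x) *\<^sub>R b"

definition pencil_kind :: "real \<Rightarrow> nat" where
  "pencil_kind \<kappa> = (if \<kappa> = 0 then 4 else if \<kappa> > 0 then 5 else 6)"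

text \<open>The kinds are numbered as the six affine families.  In the last clause the kind is \<open>4\<close>, \<open>5\<close> or \<open>6\<close>,
  depending on the sign of \<open>\<kappa>\<close>.\<close>

inductive field_kind :: "nat \<Rightarrow> ('a::euclidean_space \<Rightarrow> 'a) \<Rightarrow> bool" where
  kind_const: "c \<noteq> 0 \<Longrightarrow> field_kind 1 (\<lambda>x. c)"
| kind_radial: "l \<noteq> 0 \<Longrightarrow> field_kind 2 (\<lambda>x. l *\<^sub>R (x - p))"
| kind_rotation: "u \<noteq> 0 \<Longrightarrow> w \<noteq> 0 \<Longrightarrow> u \<bullet> w = 0 \<Longrightarrow> field_kind 3 (\<lambda>x. rotation u w (x - p))"
| kind_pencil: "b \<noteq> 0 \<Longrightarrow> field_kind (pencil_kind \<kappa>) (\<lambda>x. pencil \<kappa> b (x - p))"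

subsection \<open>The kind is determined by the values on an open set\<close>

lemma field_kind_quadratic:
  assumes "field_kind j X"
  shows "\<exists>A B. \<forall>t. X (x + t *\<^sub>R v) = X x + t *\<^sub>R A + t\<^sup>2 *\<^sub>R B"
  using assms
proof cases
  case (kind_const c)
  then show ?thesis by (intro exI[of _ 0]) simp
next
  case (kind_radial l p)
  then show ?thesis by (intro exI[of _ "l *\<^sub>R v"] exI[of _ 0]) (simp add: algebra_simps)
next
  case (kind_rotation u w p)
  have "X (x + t *\<^sub>R v) = X x + t *\<^sub>R rotation u w v + t\<^sup>2 *\<^sub>R 0" for t
    unfolding kind_rotation by (rule vector_eqI_inner) (simp add: rotation_def inner_expand algebra_simps)
  then show ?thesis by blast
next
  case (kind_pencil b \<kappa> p)
  have "X (x + t *\<^sub>R v) = X x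
      + t *\<^sub>R ((2 * (b \<bullet> v)) *\<^sub>R (x - p) + (2 * (b \<bullet> (x - p))) *\<^sub>R v - (2 * ((x - p) \<bullet> v)) *\<^sub>R b)
      + t\<^sup>2 *\<^sub>R ((2 * (b \<bullet> v)) *\<^sub>R v - (v \<bullet> v) *\<^sub>R b)" for t
    unfolding kind_pencil
    by (rule vector_eqI_inner)
      (simp add: pencil_def inner_expand inner_commute power2_eq_square algebra_simps)
  then show ?thesis by blast
qed

text \<open>Along a line both fields are quadratic polynomials, and these agree if they do so at three points.\<close>

lemma field_kind_eq:
  assumes "field_kind j X" "field_kind j' X'" "open \<Omega>" "x \<in> \<Omega>" "\<And>x. x \<in> \<Omega> \<Longrightarrow> X x = X' x"
  shows "X y = X' y"
proof -
  define v where "v = y - x"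
  obtain A B where AB: "\<And>t. X (x + t *\<^sub>R v) = X x + t *\<^sub>R A + t\<^sup>2 *\<^sub>R B"
    using field_kind_quadratic[OF assms(1)] by blast
  obtain A' B' where AB': "\<And>t. X' (x + t *\<^sub>R v) = X' x + t *\<^sub>R A' + t\<^sup>2 *\<^sub>R B'"
    using field_kind_quadratic[OF assms(2)] by blast
  obtain d where d: "d > 0" "ball x d \<subseteq> \<Omega>" using assms(3,4) openE by blast
  define e where "e = d / (2 * (norm v + 1))"
  have nv: "norm v + 1 > 0" by (simp add: add_nonneg_pos)
  have e: "e > 0" using d nv by (simp add: e_def)
  have "e * norm v < d"
  proof -
    have "e * norm v \<le> e * (norm v + 1)" using e by simp
    also have "\<dots> = d / 2" using nv by (simp add: e_def field_simps)
    finally show ?thesis using d by simp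
  qed
  then have "x + e *\<^sub>R v \<in> \<Omega>" "x + (- e) *\<^sub>R v \<in> \<Omega>"
    using d e by (auto simp: subset_iff dist_norm)
  then have 1: "e *\<^sub>R A + e\<^sup>2 *\<^sub>R B = e *\<^sub>R A' + e\<^sup>2 *\<^sub>R B'" "(- e) *\<^sub>R A + e\<^sup>2 *\<^sub>R B = (- e) *\<^sub>R A' + e\<^sup>2 *\<^sub>R B'"
    using assms(5) AB[of e] AB'[of e] AB[of "- e"] AB'[of "- e"] assms(4) by (auto simp: add.assoc)
  have "(2 * e\<^sup>2) *\<^sub>R B = (e *\<^sub>R A + e\<^sup>2 *\<^sub>R B) + ((- e) *\<^sub>R A + e\<^sup>2 *\<^sub>R B)"
    by (simp add: scaleR_2 flip: scaleR_scaleR)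
  also have "\<dots> = (2 * e\<^sup>2) *\<^sub>R B'" unfolding 1 by (simp add: scaleR_2 flip: scaleR_scaleR)
  finally have B: "B = B'" using e by simp
  then have "A = A'" using 1 e by simp
  then show ?thesis using AB[of 1] AB'[of 1] B assms(4,5) by (simp add: v_def)
qed

text \<open>The second differences recover \<open>b\<close>.  The centre is then unique: the field is even about it, and a
  second centre would make it periodic in the direction joining the two, which the quadratic part
  excludes.  At the common centre the value is \<open>\<kappa> b\<close>.\<close>

lemma pencil_unique:
  fixes b b' :: "'a::euclidean_space"
  assumes "b \<noteq> 0" "\<And>x. pencil \<kappa> b (x - p) = pencil \<kappa>' b' (x - p')"
  shows "\<kappa> = \<kappa>'"
proof -
  have second_difference: "pencil \<kappa> b ((x + v) - p) + pencil \<kappa> b ((x - v) - p) - 2 *\<^sub>R pencil \<kappa> b (x - p) =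
      2 *\<^sub>R ((2 * (b \<bullet> v)) *\<^sub>R v - (v \<bullet> v) *\<^sub>R b)" for \<kappa> p x v and b :: 'a
    by (rule vector_eqI_inner) (simp add: pencil_def inner_expand inner_commute algebra_simps)
  have eq: "(2 * (b \<bullet> v)) *\<^sub>R v - (v \<bullet> v) *\<^sub>R b = (2 * (b' \<bullet> v)) *\<^sub>R v - (v \<bullet> v) *\<^sub>R b'" for v
  proof -
    have "2 *\<^sub>R ((2 * (b \<bullet> v)) *\<^sub>R v - (v \<bullet> v) *\<^sub>R b) =
        pencil \<kappa> b ((0 + v) - p) + pencil \<kappa> b ((0 - v) - p) - 2 *\<^sub>R pencil \<kappa> b (0 - p)"
      by (simp only: second_difference)
    also have "\<dots> = pencil \<kappa>' b' ((0 + v) - p') + pencil \<kappa>' b' ((0 - v) - p') - 2 *\<^sub>R pencil \<kappa>' b' (0 - p')"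
      by (simp only: assms(2))
    also have "\<dots> = 2 *\<^sub>R ((2 * (b' \<bullet> v)) *\<^sub>R v - (v \<bullet> v) *\<^sub>R b')"
      by (simp only: second_difference)
    finally show ?thesis by simp
  qed
  have "b \<bullet> v = b' \<bullet> v" for v
  proof (cases "v = 0")
    case False
    have "v \<bullet> ((2 * (b \<bullet> v)) *\<^sub>R v - (v \<bullet> v) *\<^sub>R b) = v \<bullet> ((2 * (b' \<bullet> v)) *\<^sub>R v - (v \<bullet> v) *\<^sub>R b')"
      by (simp only: eq)
    then have "(v \<bullet> v) * (b \<bullet> v) = (v \<bullet> v) * (b' \<bullet> v)"
      by (simp add: inner_expand inner_commute algebra_simps)
    then show ?thesis using False by simp
  qed simp
  then have b: "b' = b" by (metis vector_eq_rdot)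
  define d where "d = p' - p"
  \<comment> \<open>the field is even about each of the two centres\<close>
  have "pencil \<kappa> b ((p' + d) - p) = pencil \<kappa>' b d" "pencil \<kappa> b ((p' - d) - p) = pencil \<kappa>' b (- d)"
    using assms(2)[of "p' + d"] assms(2)[of "p' - d"] by (simp_all add: b)
  moreover have "pencil \<kappa>' b (- d) = pencil \<kappa>' b d" by (simp add: pencil_def)
  ultimately have "pencil \<kappa> b (2 *\<^sub>R d) = pencil \<kappa> b 0" by (simp add: d_def scaleR_2 algebra_simps)
  then have "(8 * (b \<bullet> d)) *\<^sub>R d = (4 * (d \<bullet> d)) *\<^sub>R b" by (simp add: pencil_def)
  then have *: "y \<bullet> ((8 * (b \<bullet> d)) *\<^sub>R d) = y \<bullet> ((4 * (d \<bullet> d)) *\<^sub>R b)" for y by simp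
  have "d = 0"
  proof (rule ccontr)
    assume "d \<noteq> 0"
    have "b \<bullet> d = 0" using *[of d] \<open>d \<noteq> 0\<close> by (simp add: inner_commute)
    then show False using *[of b] \<open>d \<noteq> 0\<close> assms(1) by simp
  qed
  then have "\<kappa> *\<^sub>R b = \<kappa>' *\<^sub>R b" using assms(2)[of p] by (simp add: d_def pencil_def b)
  then show ?thesis using assms(1) by simp
qed

text \<open>The degree two part is present precisely for the pencils; among the other kinds, radial fields are
  those with nonzero expansion, and rotations are not constant.\<close>

lemma field_kind_invariants:
  assumes "field_kind j X"
  shows "(\<exists>v. X v + X (- v) \<noteq> 2 *\<^sub>R X 0) \<longleftrightarrow> j \<ge> 4"
    and "j < 4 \<Longrightarrow> (\<exists>v. v \<bullet> (X v - X 0) \<noteq> 0) \<longleftrightarrow> j = 2"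
    and "j < 4 \<Longrightarrow> (\<forall>v. X v = X 0) \<longleftrightarrow> j = 1"
    and "j \<in> {1,2,3,4,5,6}"
    and "j \<ge> 4 \<Longrightarrow> \<exists>b \<kappa> p. b \<noteq> 0 \<and> j = pencil_kind \<kappa> \<and> X = (\<lambda>x. pencil \<kappa> b (x - p))"
proof -
  have "((\<exists>v. X v + X (- v) \<noteq> 2 *\<^sub>R X 0) \<longleftrightarrow> j \<ge> 4) \<and>
    (j < 4 \<longrightarrow> ((\<exists>v. v \<bullet> (X v - X 0) \<noteq> 0) \<longleftrightarrow> j = 2) \<and> ((\<forall>v. X v = X 0) \<longleftrightarrow> j = 1)) \<and>
    j \<in> {1,2,3,4,5,6} \<and>
    (j \<ge> 4 \<longrightarrow> (\<exists>b \<kappa> p. b \<noteq> 0 \<and> j = pencil_kind \<kappa> \<and> X = (\<lambda>x. pencil \<kappa> b (x - p))))"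
    using assms
  proof cases
    case (kind_const c)
    then show ?thesis by (simp add: scaleR_2)
  next
    case (kind_radial l p)
    obtain v :: 'a where v: "v \<noteq> 0" using nonempty_Basis nonzero_Basis by blast
    have "X v + X (- v) = 2 *\<^sub>R X 0" for v unfolding kind_radial
      by (rule vector_eqI_inner) (simp add: inner_expand algebra_simps)
    moreover have "v \<bullet> (X v - X 0) \<noteq> 0" using v kind_radial by (simp add: algebra_simps inner_expand)
    moreover have "X v \<noteq> X 0" using v kind_radial by (simp add: scaleR_diff_right)
    ultimately show ?thesis using kind_radial(1) by auto
  next
    case (kind_rotation u w p)
    have "X v + X (- v) = 2 *\<^sub>R X 0" for v unfolding kind_rotation
      by (rule vector_eqI_inner) (simp add: rotation_def inner_expand algebra_simps)
    moreover have "v \<bullet> (X v - X 0) = 0" for v unfolding kind_rotation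
      by (simp add: rotation_def inner_expand inner_commute algebra_simps)
    moreover have "w \<bullet> (X u - X 0) = (u \<bullet> u) * (w \<bullet> w)" unfolding kind_rotation
      using kind_rotation(5) by (simp add: rotation_def inner_expand inner_commute algebra_simps)
    then have "X u \<noteq> X 0" using kind_rotation by auto
    ultimately show ?thesis using kind_rotation(1) by auto
  next
    case (kind_pencil b \<kappa> p)
    have "b \<bullet> (X b + X (- b) - 2 *\<^sub>R X 0) = 2 * (b \<bullet> b) * (b \<bullet> b)" unfolding kind_pencil
      by (simp add: pencil_def inner_expand inner_commute algebra_simps)
    then have "X b + X (- b) \<noteq> 2 *\<^sub>R X 0" using kind_pencil by auto
    moreover have "j \<ge> 4" "j \<in> {1,2,3,4,5,6}" using kind_pencil(1) by (auto simp: pencil_kind_def)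
    ultimately show ?thesis using kind_pencil by auto
  qed
  then show "(\<exists>v. X v + X (- v) \<noteq> 2 *\<^sub>R X 0) \<longleftrightarrow> j \<ge> 4"
    and "j < 4 \<Longrightarrow> (\<exists>v. v \<bullet> (X v - X 0) \<noteq> 0) \<longleftrightarrow> j = 2"
    and "j < 4 \<Longrightarrow> (\<forall>v. X v = X 0) \<longleftrightarrow> j = 1"
    and "j \<in> {1,2,3,4,5,6}"
    and "j \<ge> 4 \<Longrightarrow> \<exists>b \<kappa> p. b \<noteq> 0 \<and> j = pencil_kind \<kappa> \<and> X = (\<lambda>x. pencil \<kappa> b (x - p))"
    by blast+
qed

lemma field_kind_unique:
  fixes X :: "'a::euclidean_space \<Rightarrow> 'a"
  assumes "field_kind j X" "field_kind j' X'" "open \<Omega>" "\<Omega> \<noteq> {}" "\<And>x. x \<in> \<Omega> \<Longrightarrow> X x = X' x"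
  shows "j = j'"
proof -
  obtain x where "x \<in> \<Omega>" using assms(4) by blast
  then have "X' = X" using field_kind_eq[OF assms(1,2,3) _ assms(5)] by (metis ext)
  then have X': "field_kind j' X" using assms(2) by simp
  note a = field_kind_invariants[OF assms(1)] and b = field_kind_invariants[OF X']
  show ?thesis
  proof (cases "j \<ge> 4")
    case True
    then have "j' \<ge> 4" using a(1) b(1) by blast
    then obtain b \<kappa> p b' \<kappa>' p' where *: "b \<noteq> 0" "j = pencil_kind \<kappa>" "X = (\<lambda>x. pencil \<kappa> b (x - p))"
      "j' = pencil_kind \<kappa>'" "X = (\<lambda>x. pencil \<kappa>' b' (x - p'))"
      using a(5)[OF True] b(5) by blast
    then have "\<kappa> = \<kappa>'" by (intro pencil_unique[of b \<kappa> p \<kappa>' b' p']) metis+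
    then show ?thesis using * by simp
  next
    case False
    then have "j' < 4" "j < 4" using a(1) b(1) by auto
    then have "j = 2 \<longleftrightarrow> j' = 2" "j = 1 \<longleftrightarrow> j' = 1" using a(2,3) b(2,3) by blast+
    then show ?thesis using a(4) b(4) \<open>j < 4\<close> \<open>j' < 4\<close> by auto
  qed
qed

subsection \<open>Similarities and rescaling preserve the kind\<close>

lemma field_kind_rescale:
  assumes "field_kind j X" "a \<noteq> 0"
  shows "field_kind j (\<lambda>x. X x /\<^sub>R a)"
  using assms(1)
proof cases
  case (kind_const c)
  then show ?thesis using assms(2) field_kind.kind_const[of "c /\<^sub>R a"] by simp
next
  case (kind_radial l p)
  then show ?thesis using assms(2) field_kind.kind_radial[of "inverse a * l" p] by simp
next
  case (kind_rotation u w p)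
  have "(\<lambda>x. X x /\<^sub>R a) = (\<lambda>x. rotation (u /\<^sub>R a) w (x - p))"
    unfolding kind_rotation by (simp add: rotation_def algebra_simps)
  then show ?thesis using assms(2) kind_rotation field_kind.kind_rotation[of "u /\<^sub>R a" w p] by simp
next
  case (kind_pencil b \<kappa> p)
  have "(\<lambda>x. X x /\<^sub>R a) = (\<lambda>x. pencil \<kappa> (b /\<^sub>R a) (x - p))"
    unfolding kind_pencil by (simp add: pencil_def algebra_simps)
  then show ?thesis using assms(2) kind_pencil field_kind.kind_pencil[of "b /\<^sub>R a" \<kappa> p] by simp
qed

text \<open>All four shapes are built from inner products, so an orthogonal map can be moved into the
  parameters.  For a pencil a dilation by \<open>r\<close> replaces \<open>\<kappa>\<close> by \<open>\<kappa> / r\<^sup>2\<close>, which keeps its sign.\<close>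

lemma field_kind_similarity:
  fixes X A B :: "'a::euclidean_space \<Rightarrow> 'a"
  assumes "field_kind j X" and r: "r > 0" and A: "orthogonal_transformation A"
    and B: "orthogonal_transformation B" and AB: "\<And>x. A (B x) = x" and BA: "\<And>x. B (A x) = x"
    and adj: "\<And>x y. B x \<bullet> y = x \<bullet> A y"
  shows "field_kind j (\<lambda>x. B (X (r *\<^sub>R A x + d)) /\<^sub>R r)"
proof -
  interpret A: linear A using A by (rule orthogonal_transformation_linear)
  interpret B: linear B using B by (rule orthogonal_transformation_linear)
  have r0: "r \<noteq> 0" using r by simp
  have B0: "B y = 0 \<longleftrightarrow> y = 0" for y by (metis AB A.zero B.zero)
  have Bdot: "B x \<bullet> B y = x \<bullet> y" and Adot: "A x \<bullet> A y = x \<bullet> y" for x y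
    using A B by (simp_all add: orthogonal_transformation_def)
  define q where "q p = B (p - d) /\<^sub>R r" for p
  have q: "r *\<^sub>R A x + d - p = r *\<^sub>R A (x - q p)" for x p
    using r0 by (simp add: q_def A.diff A.scale AB scaleR_diff_right)
  show ?thesis
    using assms(1)
  proof cases
    case (kind_const c)
    then show ?thesis using r field_kind.kind_const[of "B c /\<^sub>R r"] by (simp add: B0)
  next
    case (kind_radial l p)
    have "(\<lambda>x. B (X (r *\<^sub>R A x + d)) /\<^sub>R r) = (\<lambda>x. l *\<^sub>R (x - q p))"
      unfolding kind_radial q using r0 by (simp add: B.scale BA mult.left_commute[of _ l])
    then show ?thesis using kind_radial field_kind.kind_radial by simp
  next
    case (kind_rotation u w p)
    have "(\<lambda>x. B (X (r *\<^sub>R A x + d)) /\<^sub>R r) = (\<lambda>x. rotation (B u) (B w) (x - q p))"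
      unfolding kind_rotation q using r0
      by (simp add: rotation_def B.scale B.diff adj scaleR_diff_right flip: mult.assoc)
    then show ?thesis using kind_rotation field_kind.kind_rotation[of "B u" "B w" "q p"] by (simp add: B0 Bdot)
  next
    case (kind_pencil b \<kappa> p)
    have "(\<lambda>x. B (X (r *\<^sub>R A x + d)) /\<^sub>R r) = (\<lambda>x. pencil (\<kappa> / r\<^sup>2) (r *\<^sub>R B b) (x - q p))"
      unfolding kind_pencil q using r
      by (simp add: pencil_def B.scale B.diff B.add adj Adot BA scaleR_diff_right scaleR_add_right
          field_simps power2_eq_square)
    moreover have "pencil_kind (\<kappa> / r\<^sup>2) = pencil_kind \<kappa>" using r by (simp add: pencil_kind_def zero_less_divide_iff)
    ultimately show ?thesis using kind_pencil r field_kind.kind_pencil[of "r *\<^sub>R B b" "\<kappa> / r\<^sup>2" "q p"] by (simp add: B0)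
  qed
qed

subsection \<open>The inversion pairs the kinds\<close>

text \<open>The conformal class (\<open>\<psi>\<^sub>1\<close>, \<open>\<psi>\<^sub>2\<close> or \<open>\<psi>\<^sub>3\<close>) into which the inversion merges the affine kinds.\<close>

definition weight_class :: "nat \<Rightarrow> nat" where
  "weight_class j = (if j = 4 then 1 else if j = 6 then 2 else if j = 5 then 3 else j)"

text \<open>A common shape for all kinds.  The skew linear part of a general conformal field need not be a
  single plane rotation, but for fields of weights it is.\<close>

definition quadratic_field :: "'a \<Rightarrow> real \<Rightarrow> 'a \<Rightarrow> 'a \<Rightarrow> 'a \<Rightarrow> 'a::euclidean_space \<Rightarrow> 'a" where
  "quadratic_field c l u w b x = c + l *\<^sub>R x + rotation u w x + ((2 * (b \<bullet> x)) *\<^sub>R x - (x \<bullet> x) *\<^sub>R b)"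

text \<open>Up to sign, the inversion exchanges the translations, given by \<open>c\<close>, with the special conformal
  fields, given by \<open>b\<close>; it reverses dilations and fixes rotations.\<close>

lemma inverted_quadratic_field:
  assumes "x \<noteq> 0"
  shows "inverted_field (quadratic_field c l u w b) x = quadratic_field (- b) (- l) u w (- c) x"
proof -
  define n where "n = x \<bullet> x"
  have n: "n \<noteq> 0" using assms by (simp add: n_def)
  have "v \<bullet> inverted_field (quadratic_field c l u w b) x = v \<bullet> quadratic_field (- b) (- l) u w (- c) x" for v
    using n
    by (simp add: inverted_field_def quadratic_field_def rotation_def vinv_def inner_expand flip: n_def)
      (simp add: field_simps inner_commute)
  then show ?thesis by (rule vector_eqI_inner)
qed

text \<open>Inverting a field of degree at most one creates the quadratic part \<open>b = - X 0\<close>.  If it is nonzero,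
  the centre \<open>q\<close> of the resulting pencil is found by killing the linear part: on the line through the
  origin and the centre \<open>p\<close> for a radial field, which gives \<open>\<kappa> = - |q|\<^sup>2\<close>, and perpendicular to \<open>b\<close> in the plane of rotation,
  which gives \<open>\<kappa> = |q|\<^sup>2\<close>.\<close>

lemma inverted_field_kind:
  fixes X :: "'a::euclidean_space \<Rightarrow> 'a"
  assumes "field_kind j X" "j < 4"
  shows "\<exists>j' Y. field_kind j' Y \<and> weight_class j' = j \<and> (\<forall>x. x \<noteq> 0 \<longrightarrow> inverted_field X x = Y x)"
  using assms(1)
proof cases
  case (kind_const c)
  have "X = quadratic_field c 0 0 0 0" by (simp add: kind_const quadratic_field_def rotation_def fun_eq_iff)
  moreover have "quadratic_field 0 0 0 0 (- c) = (\<lambda>x. pencil 0 (- c) (x - 0))"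
    by (simp add: fun_eq_iff quadratic_field_def pencil_def rotation_def)
  moreover have "field_kind (pencil_kind 0) (\<lambda>x. pencil 0 (- c) (x - 0))"
    using kind_const by (intro kind_pencil) simp
  ultimately show ?thesis using inverted_quadratic_field[of _ c 0 0 0 0] kind_const
    by (intro exI[of _ 4] exI[of _ "quadratic_field 0 0 0 0 (- c)"]) (auto simp: pencil_kind_def weight_class_def)
next
  case (kind_radial l p)
  have X: "X = quadratic_field (- l *\<^sub>R p) l 0 0 0"
    by (simp add: kind_radial quadratic_field_def rotation_def fun_eq_iff algebra_simps)
  define Y where "Y = quadratic_field 0 (- l) 0 0 (l *\<^sub>R p)"
  have inv: "\<forall>x. x \<noteq> 0 \<longrightarrow> inverted_field X x = Y x"
    using inverted_quadratic_field[of _ "- l *\<^sub>R p" l 0 0 0] unfolding X Y_def by simp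
  show ?thesis
  proof (cases "p = 0")
    case True
    have "Y = (\<lambda>x. (- l) *\<^sub>R (x - 0))" by (simp add: Y_def quadratic_field_def True fun_eq_iff rotation_def)
    then have "field_kind 2 Y" using field_kind.kind_radial[of "- l" 0] kind_radial by simp
    then show ?thesis using inv kind_radial by (intro exI[of _ 2] exI[of _ Y]) (simp add: weight_class_def)
  next
    case False
    \<comment> \<open>the linear part \<open>- l\<close> vanishes at \<open>q\<close> because \<open>2 (l p) \<bullet> q = l\<close>\<close>
    define n q where "n = p \<bullet> p" and "q = p /\<^sub>R (2 * n)"
    have n: "n > 0" using False by (simp add: n_def)
    have "Y x = pencil (- (q \<bullet> q)) (l *\<^sub>R p) (x - q)" for x
    proof (rule vector_eqI_inner)
      show "v \<bullet> Y x = v \<bullet> pencil (- (q \<bullet> q)) (l *\<^sub>R p) (x - q)" for v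
        using n
        by (simp add: Y_def q_def quadratic_field_def rotation_def pencil_def inner_expand flip: n_def)
          (simp add: field_simps inner_commute)
    qed
    moreover have "q \<noteq> 0" using False n by (simp add: q_def)
    then have "pencil_kind (- (q \<bullet> q)) = 6" by (simp add: pencil_kind_def not_less)
    moreover have "field_kind (pencil_kind (- (q \<bullet> q))) (\<lambda>x. pencil (- (q \<bullet> q)) (l *\<^sub>R p) (x - q))"
      using False kind_radial by (intro field_kind.kind_pencil) simp
    ultimately have "field_kind 6 Y" by (simp add: ext[of Y "\<lambda>x. pencil (- (q \<bullet> q)) (l *\<^sub>R p) (x - q)"])
    then show ?thesis using inv kind_radial by (intro exI[of _ 6] exI[of _ Y]) (simp add: weight_class_def)
  qed
next
  case (kind_rotation u w p)
  define b where "b = rotation u w p"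
  have X: "X = quadratic_field (- b) 0 u w 0"
    by (simp add: kind_rotation quadratic_field_def rotation_def fun_eq_iff b_def algebra_simps)
  define Y where "Y = quadratic_field 0 0 u w b"
  have inv: "\<forall>x. x \<noteq> 0 \<longrightarrow> inverted_field X x = Y x"
    using inverted_quadratic_field[of _ "- b" 0 u w 0] unfolding X Y_def by simp
  show ?thesis
  proof (cases "b = 0")
    case True
    have "Y = (\<lambda>x. rotation u w (x - 0))" by (simp add: Y_def quadratic_field_def True fun_eq_iff)
    then have "field_kind 3 Y" using field_kind.kind_rotation[of u w 0] kind_rotation by simp
    then show ?thesis using inv kind_rotation by (intro exI[of _ 3] exI[of _ Y]) (simp add: weight_class_def)
  next
    case False
    \<comment> \<open>the quarter turn of \<open>b\<close> in the plane of rotation carries the centre of the pencil\<close>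
    define n q where "n = b \<bullet> b" and "q = (- 1 / (2 * n)) *\<^sub>R rotation u w b"
    define U W s t where "U = u \<bullet> u" and "W = w \<bullet> w" and "s = u \<bullet> p" and "t = w \<bullet> p"
    have n: "n > 0" using False by (simp add: n_def)
    have b: "b = s *\<^sub>R w - t *\<^sub>R u" by (simp add: b_def rotation_def s_def t_def)
    have uw: "u \<bullet> w = 0" "w \<bullet> u = 0" using kind_rotation by (simp_all add: inner_commute)
    have rb: "rotation u w b = (- t * U) *\<^sub>R w - (s * W) *\<^sub>R u"
      by (simp add: rotation_def b inner_expand uw U_def W_def)
    have n_eq: "n = s\<^sup>2 * W + t\<^sup>2 * U"
      by (simp add: n_def b inner_expand uw U_def W_def power2_eq_square)
    have bq: "b \<bullet> q = 0"
      by (simp add: q_def rb) (simp add: b inner_expand uw flip: U_def W_def)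
    have turn: "(b \<bullet> x) *\<^sub>R rotation u w b - (rotation u w b \<bullet> x) *\<^sub>R b = n *\<^sub>R rotation u w x" for x
      unfolding rb unfolding b n_eq rotation_def[of u w x]
      by (rule vector_eqI_inner) (simp add: inner_expand algebra_simps power2_eq_square)
    have rq: "(2 * (q \<bullet> x)) *\<^sub>R b - (2 * (b \<bullet> x)) *\<^sub>R q = rotation u w x" for x
    proof -
      have "(2 * (q \<bullet> x)) *\<^sub>R b - (2 * (b \<bullet> x)) *\<^sub>R q =
          (1 / n) *\<^sub>R ((b \<bullet> x) *\<^sub>R rotation u w b - (rotation u w b \<bullet> x) *\<^sub>R b)"
        using n by (simp add: q_def scaleR_diff_right)
      then show ?thesis using n by (simp add: turn)
    qed
    have "Y x = pencil (q \<bullet> q) b (x - q)" for x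
    proof -
      have "pencil (q \<bullet> q) b (x - q) = (2 * (q \<bullet> x)) *\<^sub>R b - (2 * (b \<bullet> x)) *\<^sub>R q
          + ((2 * (b \<bullet> x)) *\<^sub>R x - (x \<bullet> x) *\<^sub>R b)"
        by (rule vector_eqI_inner) (simp add: pencil_def inner_expand bq inner_commute algebra_simps)
      then show ?thesis by (simp add: rq Y_def quadratic_field_def)
    qed
    moreover have "q \<noteq> 0"
    proof
      assume "q = 0"
      then have "n *\<^sub>R rotation u w x = 0" for x using rq[of x] by simp
      then have "rotation u w u = 0" using n by simp
      then show False using kind_rotation by (simp add: rotation_def uw)
    qed
    then have "pencil_kind (q \<bullet> q) = 5" by (simp add: pencil_kind_def)
    moreover have "field_kind (pencil_kind (q \<bullet> q)) (\<lambda>x. pencil (q \<bullet> q) b (x - q))"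
      using False by (intro field_kind.kind_pencil)
    ultimately have "field_kind 5 Y" by (simp add: ext[of Y "\<lambda>x. pencil (q \<bullet> q) b (x - q)"])
    then show ?thesis using inv kind_rotation by (intro exI[of _ 5] exI[of _ Y]) (simp add: weight_class_def)
  qed
next
  case (kind_pencil b \<kappa> p)
  then show ?thesis using assms(2) by (simp add: pencil_kind_def split: if_splits)
qed

text \<open>Every pencil field has a zero \<open>z\<close>; moved to the origin it removes the constant coefficient, so that
  the inverted field has no quadratic part.  The type of the result is the linear part of the field
  at \<open>z\<close>: zero, a multiple of the identity, or a plane rotation.\<close>

lemma inverted_pencil:
  fixes b p :: "'a::euclidean_space"
  assumes dim: "DIM('a) \<ge> 2" and "b \<noteq> 0"
  shows "\<exists>z Y. field_kind (weight_class (pencil_kind \<kappa>)) Y \<and> pencil \<kappa> b (z - p) = 0 \<and>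
    (\<forall>x. x \<noteq> 0 \<longrightarrow> inverted_field (\<lambda>x. pencil \<kappa> b (x + z - p)) x = Y x)"
proof -
  consider "\<kappa> = 0" | "\<kappa> < 0" | "\<kappa> > 0" by linarith
  then show ?thesis
  proof cases
    case 1
    have Q: "(\<lambda>x. pencil \<kappa> b (x + p - p)) = quadratic_field 0 0 0 0 b"
      by (simp add: fun_eq_iff pencil_def quadratic_field_def rotation_def 1)
    have "inverted_field (\<lambda>x. pencil \<kappa> b (x + p - p)) x = - b" if "x \<noteq> 0" for x
      unfolding Q inverted_quadratic_field[OF that] by (simp add: quadratic_field_def rotation_def)
    moreover have "field_kind 1 (\<lambda>x. - b)" using assms(2) by (intro kind_const) simp
    moreover have "weight_class (pencil_kind \<kappa>) = 1" "pencil \<kappa> b (p - p) = 0"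
      using 1 by (simp_all add: pencil_kind_def weight_class_def pencil_def)
    ultimately show ?thesis by metis
  next
    case 2
    define e where "e = (sqrt (- \<kappa>) / norm b) *\<^sub>R b"
    define l where "l = 2 * (b \<bullet> e)"
    have "l = 2 * sqrt (- \<kappa>) * norm b"
      using assms(2) by (simp add: l_def e_def dot_square_norm power2_eq_square)
    then have l: "l \<noteq> 0" using 2 assms(2) by simp
    have ee: "e \<bullet> e = - \<kappa>"
      using 2 assms(2) by (simp add: e_def dot_square_norm power2_eq_square)
    have par: "(b \<bullet> x) *\<^sub>R e = (e \<bullet> x) *\<^sub>R b" for x by (simp add: e_def)
    have be: "(b \<bullet> e) *\<^sub>R e = (- \<kappa>) *\<^sub>R b" using par[of e] by (simp add: ee)
    have vanish: "\<kappa> *\<^sub>R b + 2 *\<^sub>R ((b \<bullet> e) *\<^sub>R e) - (e \<bullet> e) *\<^sub>R b = 0"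
      unfolding be ee by (rule vector_eqI_inner) (simp add: inner_expand algebra_simps)
    have "pencil \<kappa> b (x + (p + e) - p) = quadratic_field 0 l 0 0 b x" for x
    proof -
      have "pencil \<kappa> b (x + e) = (\<kappa> *\<^sub>R b + 2 *\<^sub>R ((b \<bullet> e) *\<^sub>R e) - (e \<bullet> e) *\<^sub>R b)
          + (l *\<^sub>R x + 2 *\<^sub>R ((b \<bullet> x) *\<^sub>R e - (e \<bullet> x) *\<^sub>R b) + ((2 * (b \<bullet> x)) *\<^sub>R x - (x \<bullet> x) *\<^sub>R b))"
        by (rule vector_eqI_inner) (simp add: pencil_def l_def inner_expand inner_commute algebra_simps)
      then show ?thesis
        unfolding vanish unfolding par by (simp add: quadratic_field_def rotation_def add.commute)
    qed
    then have Q: "(\<lambda>x. pencil \<kappa> b (x + (p + e) - p)) = quadratic_field 0 l 0 0 b" by (rule ext)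
    define Y where "Y x = (- l) *\<^sub>R (x - (- 1 / l) *\<^sub>R b)" for x
    have "inverted_field (\<lambda>x. pencil \<kappa> b (x + (p + e) - p)) x = Y x" if "x \<noteq> 0" for x
      unfolding Q inverted_quadratic_field[OF that] Y_def
      using l by (simp add: quadratic_field_def rotation_def algebra_simps)
    moreover have "field_kind 2 Y" unfolding Y_def[abs_def] using l by (intro kind_radial) simp
    moreover have "pencil \<kappa> b (p + e - p) = 0" using vanish by (simp add: pencil_def)
    ultimately show ?thesis using 2
      by (intro exI[of _ "p + e"] exI[of _ Y]) (simp add: pencil_kind_def weight_class_def)
  next
    case 3
    obtain y where y: "y \<noteq> 0" "orthogonal b y" using orthogonal_to_vector_exists[OF dim] by blast
    define e where "e = (sqrt \<kappa> / norm y) *\<^sub>R y"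
    have be: "b \<bullet> e = 0" using y by (simp add: e_def orthogonal_def)
    have ee: "e \<bullet> e = \<kappa>" using 3 y by (simp add: e_def dot_square_norm power2_eq_square)
    have "pencil \<kappa> b (x + (p + e) - p) = quadratic_field 0 0 b (2 *\<^sub>R e) b x" for x
      by (rule vector_eqI_inner)
        (simp add: pencil_def quadratic_field_def rotation_def be ee inner_expand inner_commute algebra_simps)
    then have Q: "(\<lambda>x. pencil \<kappa> b (x + (p + e) - p)) = quadratic_field 0 0 b (2 *\<^sub>R e) b" by (rule ext)
    define Y where "Y x = rotation b (2 *\<^sub>R e) (x - (- 1 / (2 * \<kappa>)) *\<^sub>R e)" for x
    have "inverted_field (\<lambda>x. pencil \<kappa> b (x + (p + e) - p)) x = Y x" if "x \<noteq> 0" for x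
      unfolding Q inverted_quadratic_field[OF that] Y_def
      using 3 be ee by (simp add: quadratic_field_def rotation_def inner_expand algebra_simps)
    moreover have "field_kind 3 Y" unfolding Y_def[abs_def]
      using 3 assms(2) ee be by (intro kind_rotation) auto
    moreover have "pencil \<kappa> b (p + e - p) = 0" using be by (simp add: pencil_def ee)
    ultimately show ?thesis using 3
      by (intro exI[of _ "p + e"] exI[of _ Y]) (simp add: pencil_kind_def weight_class_def)
  qed
qed

subsection \<open>Smoothness and conformality of quadratic fields\<close>

lemma smooth_field_quadratic_field:
  assumes op: "open \<Omega>"
  shows "smooth_field \<Omega> (quadratic_field c l u w b)"
proof -
  note id = smooth_on_inner_left[OF op]
  have id': "smooth_on \<Omega> (\<lambda>x. v \<bullet> x)" for v using id[of v] by (simp add: inner_commute)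
  have "smooth_on \<Omega> (\<lambda>x. c \<bullet> v + l * (x \<bullet> v) + ((u \<bullet> x) * (w \<bullet> v) - (w \<bullet> x) * (u \<bullet> v))
      + ((2 * (b \<bullet> x)) * (x \<bullet> v) - (x \<bullet> x) * (b \<bullet> v)))" for v
    by (intro smooth_on_add smooth_on_diff smooth_on_mult smooth_on_const op id id' smooth_on_inner[OF op id id])
  then show ?thesis
    by (simp add: smooth_field_def quadratic_field_def rotation_def inner_expand)
qed

lemma conformal_field_quadratic_field: "conformal_field \<Omega> (quadratic_field c l u w b)"
  unfolding conformal_field_def
proof
  fix x assume "x \<in> \<Omega>"
  have "(quadratic_field c l u w b has_derivative
      (\<lambda>v. l *\<^sub>R v + rotation u w v + ((2 * (b \<bullet> v)) *\<^sub>R x + (2 * (b \<bullet> x)) *\<^sub>R v - (2 * (x \<bullet> v)) *\<^sub>R b))) (at x)"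
    unfolding quadratic_field_def[abs_def] rotation_def
    by (auto intro!: derivative_eq_intros simp: inner_commute algebra_simps scaleR_2)
  moreover have "v \<bullet> (l *\<^sub>R v + rotation u w v + ((2 * (b \<bullet> v)) *\<^sub>R x + (2 * (b \<bullet> x)) *\<^sub>R v - (2 * (x \<bullet> v)) *\<^sub>R b))
      = (l + 2 * (b \<bullet> x)) * (v \<bullet> v)" for v
    by (simp add: rotation_def inner_expand inner_commute algebra_simps)
  ultimately show "\<exists>L f. (quadratic_field c l u w b has_derivative L) (at x) \<and> (\<forall>v. v \<bullet> L v = f * (v \<bullet> v))"
    by blast
qed

section \<open>Liouville's theorem for conformal fields\<close>

lemma
  assumes "smooth_on \<Omega> f" "smooth_on \<Omega> g" "x \<in> \<Omega>"
  shows dir_deriv_add: "dir_deriv v (\<lambda>x. f x + g x) x = dir_deriv v f x + dir_deriv v g x"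
    and dir_deriv_diff: "dir_deriv v (\<lambda>x. f x - g x) x = dir_deriv v f x - dir_deriv v g x"
    and dir_deriv_cmult: "dir_deriv v (\<lambda>x. c * f x) x = c * dir_deriv v f x"
  using has_derivative_add[OF smooth_on_has_derivative[OF assms(1,3)] smooth_on_has_derivative[OF assms(2,3)]]
    has_derivative_diff[OF smooth_on_has_derivative[OF assms(1,3)] smooth_on_has_derivative[OF assms(2,3)]]
    has_derivative_mult_right[OF smooth_on_has_derivative[OF assms(1,3)], of c]
  by (simp_all add: frechet_derivativeI)

lemma constant_if_dir_deriv_zero:
  fixes g :: "'a::euclidean_space \<Rightarrow> real"
  assumes "open \<Omega>" "connected \<Omega>" "\<And>x. x \<in> \<Omega> \<Longrightarrow> (g has_derivative D x) (at x)"
    "\<And>x v. x \<in> \<Omega> \<Longrightarrow> D x v = 0" "x \<in> \<Omega>" "y \<in> \<Omega>"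
  shows "g x = g y"
proof (rule has_derivative_zero_unique_connected[OF assms(1,2) _ assms(5,6)])
  show "(g has_derivative (\<lambda>x. 0)) (at z)" if "z \<in> \<Omega>" for z
    using assms(3)[OF that] assms(4)[OF that] by (metis (no_types, lifting) ext)
qed

lemma orthogonal_to_two_exists:
  fixes x y :: "'a::euclidean_space"
  assumes "DIM('a) \<ge> 3"
  obtains z where "z \<noteq> 0" "z \<bullet> x = 0" "z \<bullet> y = 0"
proof -
  have "dim {x, y} \<le> card {x, y}" by (rule dim_le_card) (auto intro: span_base)
  also have "\<dots> \<le> 2" by (simp add: card_insert_if)
  finally have "dim {x, y} < DIM('a)" using assms by simp
  then obtain z where "z \<noteq> 0" "\<And>w. w \<in> span {x, y} \<Longrightarrow> orthogonal z w"
    using orthogonal_to_subspace_exists by metis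
  then show thesis using that[of z] by (simp add: orthogonal_def span_base)
qed

text \<open>
  As with Christoffel symbols, the conformality equation differentiated once and permuted cyclically
  expresses all second derivatives of \<open>X\<close> by the gradient of the scale factor \<open>f\<close>.  Symmetry of the
  third derivatives then relates the Hessian \<open>h\<close> of \<open>f\<close> on orthonormal pairs,
  \<open>h v v = - h z z\<close>.  Three mutually orthogonal directions leave only \<open>h = 0\<close>.
\<close>

lemma conformal_factor_hessian_zero:
  fixes X :: "'a::euclidean_space \<Rightarrow> 'a" and f :: "'a \<Rightarrow> real"
  assumes dim: "DIM('a) \<ge> 3" and op: "open \<Omega>" and smX: "\<And>w. smooth_on \<Omega> (\<lambda>x. X x \<bullet> w)"
    and smf: "smooth_on \<Omega> f"
    and conf: "\<And>x v w. x \<in> \<Omega> \<Longrightarrow> dir_deriv v (\<lambda>x. X x \<bullet> w) x + dir_deriv w (\<lambda>x. X x \<bullet> v) x = 2 * (v \<bullet> w) * f x"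
  shows "x \<in> \<Omega> \<Longrightarrow> dir_deriv z (dir_deriv v (\<lambda>x. X x \<bullet> w)) x =
      (v \<bullet> w) * dir_deriv z f x + (z \<bullet> w) * dir_deriv v f x - (z \<bullet> v) * dir_deriv w f x"
    and "x \<in> \<Omega> \<Longrightarrow> dir_deriv z (dir_deriv v f) x = 0"
proof -
  define U where "U w = (\<lambda>x. X x \<bullet> w)" for w
  have smU: "smooth_on \<Omega> (U w)" for w using smX by (simp add: U_def)
  have T: "dir_deriv z (dir_deriv v (U w)) x = (v \<bullet> w) * dir_deriv z f x + (z \<bullet> w) * dir_deriv v f x - (z \<bullet> v) * dir_deriv w f x"
    if x: "x \<in> \<Omega>" for x z v w
  proof -
    have d: "dir_deriv z (dir_deriv v (U w)) x + dir_deriv z (dir_deriv w (U v)) x = 2 * (v \<bullet> w) * dir_deriv z f x" for z v w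
    proof -
      have "dir_deriv z (dir_deriv v (U w)) x + dir_deriv z (dir_deriv w (U v)) x = dir_deriv z (\<lambda>x. dir_deriv v (U w) x + dir_deriv w (U v) x) x"
        by (rule dir_deriv_add[OF smooth_on_dir_deriv[OF smU] smooth_on_dir_deriv[OF smU] x, symmetric])
      also have "\<dots> = dir_deriv z (\<lambda>x. 2 * (v \<bullet> w) * f x) x"
        using frechet_derivative_cong_open[OF op x, of "\<lambda>x. dir_deriv v (U w) x + dir_deriv w (U v) x" "\<lambda>x. 2 * (v \<bullet> w) * f x"]
          conf by (simp add: U_def)
      also have "\<dots> = 2 * (v \<bullet> w) * dir_deriv z f x" by (rule dir_deriv_cmult[OF smf smf x])
      finally show ?thesis .
    qed
    have s: "dir_deriv z (dir_deriv v (U w)) x = dir_deriv v (dir_deriv z (U w)) x" for z v w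
      by (rule dir_deriv_commute[OF op smU x])
    define S where "S z v w = dir_deriv z (dir_deriv v (U w)) x" for z v w
    have S: "S z v w + S z w v = 2 * (v \<bullet> w) * dir_deriv z f x" "S z v w = S v z w" for z v w
      unfolding S_def by (rule d, rule s)
    have "S v w z + S v z w = 2 * (z \<bullet> w) * dir_deriv v f x" "S w z v + S w v z = 2 * (z \<bullet> v) * dir_deriv w f x"
      using S(1)[of v w z] S(1)[of w z v] by (simp_all add: inner_commute)
    then show ?thesis
      using S(1)[of z v w] S(2)[of z v w] S(2)[of z w v] S(2)[of v w z] unfolding S_def[symmetric]
      by linarith
  qed
  then show "x \<in> \<Omega> \<Longrightarrow> dir_deriv z (dir_deriv v (\<lambda>x. X x \<bullet> w)) x =
      (v \<bullet> w) * dir_deriv z f x + (z \<bullet> w) * dir_deriv v f x - (z \<bullet> v) * dir_deriv w f x" by (simp add: U_def)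
  assume x: "x \<in> \<Omega>"
  define h where "h a b = dir_deriv a (dir_deriv b f) x" for a b
  have h_sym: "h a b = h b a" for a b unfolding h_def by (rule dir_deriv_commute[OF op smf x])
  have "bounded_linear (frechet_derivative (dir_deriv b f) (at x))" for b
    using smooth_on_has_derivative[OF smooth_on_dir_deriv[OF smf] x] by (rule has_derivative_bounded_linear)
  then have h_lin: "h (a + a') b = h a b + h a' b" "h (r *\<^sub>R a) b = r * h a b" for a a' b r
    by (simp_all add: h_def linear_simps)
  have third: "(v \<bullet> w) * h t z + (z \<bullet> w) * h t v - (z \<bullet> v) * h t w =
      (v \<bullet> w) * h z t + (t \<bullet> w) * h z v - (t \<bullet> v) * h z w" for t z v w
  proof -
    have d: "dir_deriv t (dir_deriv z (dir_deriv v (U w))) x = (v \<bullet> w) * h t z + (z \<bullet> w) * h t v - (z \<bullet> v) * h t w" for t z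
    proof -
      note sm = smooth_on_mult[OF op smooth_on_const[OF op] smooth_on_dir_deriv[OF smf]]
      note d2 = dir_deriv_cmult[OF smooth_on_dir_deriv[OF smf] smooth_on_dir_deriv[OF smf] x]
      have "dir_deriv t (dir_deriv z (dir_deriv v (U w))) x =
          dir_deriv t (\<lambda>x. ((v \<bullet> w) * dir_deriv z f x + (z \<bullet> w) * dir_deriv v f x) - (z \<bullet> v) * dir_deriv w f x) x"
        using frechet_derivative_cong_open[OF op x, of "dir_deriv z (dir_deriv v (U w))"] T by simp
      also have "\<dots> = dir_deriv t (\<lambda>x. (v \<bullet> w) * dir_deriv z f x + (z \<bullet> w) * dir_deriv v f x) x - dir_deriv t (\<lambda>x. (z \<bullet> v) * dir_deriv w f x) x"
        by (rule dir_deriv_diff[OF smooth_on_add[OF op sm sm] sm x])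
      also have "dir_deriv t (\<lambda>x. (v \<bullet> w) * dir_deriv z f x + (z \<bullet> w) * dir_deriv v f x) x =
          dir_deriv t (\<lambda>x. (v \<bullet> w) * dir_deriv z f x) x + dir_deriv t (\<lambda>x. (z \<bullet> w) * dir_deriv v f x) x"
        by (rule dir_deriv_add[OF sm sm x])
      finally show ?thesis by (simp only: d2 h_def)
    qed
    have "dir_deriv t (dir_deriv z (dir_deriv v (U w))) x = dir_deriv z (dir_deriv t (dir_deriv v (U w))) x"
      by (rule dir_deriv_commute[OF op smooth_on_dir_deriv[OF smU] x])
    then show ?thesis by (simp only: d)
  qed
  have pair: "h v v = - h z z" if "norm z = 1" "norm v = 1" "z \<bullet> v = 0" for z v
    using third[where v = v and w = z and t = v and z = z] that by (simp add: inner_commute norm_eq_1)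
  have unit: "h z z = 0" if z: "norm z = 1" for z
  proof -
    obtain u where u: "u \<noteq> 0" "u \<bullet> z = 0" using orthogonal_to_two_exists[OF dim, of z z] by blast
    obtain v where v: "v \<noteq> 0" "v \<bullet> z = 0" "v \<bullet> u = 0" using orthogonal_to_two_exists[OF dim] by blast
    define u' v' where "u' = u /\<^sub>R norm u" and "v' = v /\<^sub>R norm v"
    have "norm u' = 1" "norm v' = 1" "z \<bullet> u' = 0" "z \<bullet> v' = 0" "u' \<bullet> v' = 0"
      using u v by (simp_all add: u'_def v'_def inner_commute)
    then show ?thesis using pair[OF z, of u'] pair[OF z, of v'] pair[of u' v'] by simp
  qed
  have diag: "h a a = 0" for a
  proof (cases "a = 0")
    case True
    then show ?thesis using h_lin(2)[of 0 a a] by simp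
  next
    case False
    then have "norm (a /\<^sub>R norm a) = 1" by simp
    from unit[OF this] have "h (norm a *\<^sub>R (a /\<^sub>R norm a)) (norm a *\<^sub>R (a /\<^sub>R norm a)) = 0"
      by (metis h_lin(2) h_sym mult_zero_right)
    then show ?thesis using False by simp
  qed
  have "h (z + v) (z + v) = h z z + 2 * h z v + h v v"
    using h_lin(1)[of z v "z + v"] h_lin(1)[of z v z] h_lin(1)[of z v v]
      h_sym[of z "z + v"] h_sym[of v "z + v"] h_sym[of v z] by linarith
  then show "dir_deriv z (dir_deriv v f) x = 0" using diag by (simp add: h_def)
qed

text \<open>Integrating three times: the Hessian of the scale factor vanishes, so its gradient \<open>2 b\<close> is
  constant, so the second derivatives of \<open>X\<close> are constant.  At each stage the difference to the
  explicit polynomial has derivative zero on the connected set.\<close>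

lemma conformal_field_quadratic_near:
  fixes X :: "'a::euclidean_space \<Rightarrow> 'a"
  assumes dim: "DIM('a) \<ge> 3" and op: "open \<Omega>" and con: "connected \<Omega>" and x0: "x0 \<in> \<Omega>"
    and sm: "smooth_field \<Omega> X" and conf: "conformal_field \<Omega> X"
  shows "\<exists>L l b. linear L \<and> (\<forall>v. v \<bullet> L v = l * (v \<bullet> v)) \<and> (\<forall>x\<in>\<Omega>. X x = X x0 + L (x - x0) +
    ((2 * (b \<bullet> (x - x0))) *\<^sub>R (x - x0) - ((x - x0) \<bullet> (x - x0)) *\<^sub>R b))"
proof -
  have smX: "smooth_on \<Omega> (\<lambda>x. X x \<bullet> w)" for w using sm by (simp add: smooth_field_def)
  obtain e :: 'a where e: "e \<bullet> e = 1" using nonempty_Basis inner_Basis by fastforce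
  define f where "f = dir_deriv e (\<lambda>x. X x \<bullet> e)"
  have smf: "smooth_on \<Omega> f" unfolding f_def by (rule smooth_on_dir_deriv[OF smX])
  have LL: "\<exists>L. linear L \<and> (\<forall>v w. dir_deriv v (\<lambda>x. X x \<bullet> w) x = L v \<bullet> w) \<and> (\<forall>v. v \<bullet> L v = f x * (v \<bullet> v))"
    if x: "x \<in> \<Omega>" for x
  proof -
    obtain L k where L: "(X has_derivative L) (at x)" "\<And>v. v \<bullet> L v = k * (v \<bullet> v)"
      using conf x unfolding conformal_field_def by blast
    have d: "dir_deriv v (\<lambda>x. X x \<bullet> w) x = L v \<bullet> w" for v w
      using has_derivative_inner_left[OF L(1), of w] by (simp add: frechet_derivativeI)
    have "f x = k" using L(2)[of e] e by (simp add: f_def d) (simp add: inner_commute)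
    then show ?thesis using L d has_derivative_linear[OF L(1)] by blast
  qed
  have conf': "dir_deriv v (\<lambda>x. X x \<bullet> w) x + dir_deriv w (\<lambda>x. X x \<bullet> v) x = 2 * (v \<bullet> w) * f x" if x: "x \<in> \<Omega>" for x v w
  proof -
    obtain L where L: "linear L" "\<And>v w. dir_deriv v (\<lambda>x. X x \<bullet> w) x = L v \<bullet> w" "\<And>v. v \<bullet> L v = f x * (v \<bullet> v)"
      using LL[OF x] by blast
    have "(v + w) \<bullet> L (v + w) = f x * ((v + w) \<bullet> (v + w))" by (rule L(3))
    then have "v \<bullet> L w + w \<bullet> L v = 2 * (v \<bullet> w) * f x" using L(3)[of v] L(3)[of w] linear_add[OF L(1)]
      by (simp add: inner_expand inner_commute algebra_simps)
    then show ?thesis unfolding L(2) by (simp add: inner_commute add.commute)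
  qed
  note hess = conformal_factor_hessian_zero[OF dim op smX smf conf']
  obtain G where G: "\<And>w. dir_deriv w f x0 = G \<bullet> w" using dir_deriv_representation[OF smf x0] by blast
  define b where "b = G /\<^sub>R 2"
  have f1: "dir_deriv w f x = 2 * (b \<bullet> w)" if x: "x \<in> \<Omega>" for x w
  proof -
    have "dir_deriv w f x = dir_deriv w f x0"
      by (rule constant_if_dir_deriv_zero[OF op con smooth_on_has_derivative[OF smooth_on_dir_deriv[OF smf]] hess(2) x x0])
    then show ?thesis by (simp add: G b_def)
  qed
  obtain L where L: "linear L" "\<And>v w. dir_deriv v (\<lambda>x. X x \<bullet> w) x0 = L v \<bullet> w" "\<And>v. v \<bullet> L v = f x0 * (v \<bullet> v)"
    using LL[OF x0] by blast
  have "bounded_linear L" using L(1) by (simp add: linear_linear)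
  then interpret L: bounded_linear L .
  have X1: "dir_deriv v (\<lambda>x. X x \<bullet> w) x = L v \<bullet> w
      + 2 * ((v \<bullet> w) * (b \<bullet> (x - x0)) + ((x - x0) \<bullet> w) * (b \<bullet> v) - ((x - x0) \<bullet> v) * (b \<bullet> w))"
    if x: "x \<in> \<Omega>" for x v w
  proof -
    let ?q = "\<lambda>x. 2 * ((v \<bullet> w) * (b \<bullet> (x - x0)) + ((x - x0) \<bullet> w) * (b \<bullet> v) - ((x - x0) \<bullet> v) * (b \<bullet> w))"
    have "((\<lambda>x. dir_deriv v (\<lambda>x. X x \<bullet> w) x - ?q x) has_derivative
        (\<lambda>z. dir_deriv z (dir_deriv v (\<lambda>x. X x \<bullet> w)) y - 2 * ((v \<bullet> w) * (b \<bullet> z) + (z \<bullet> w) * (b \<bullet> v) - (z \<bullet> v) * (b \<bullet> w)))) (at y)"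
      if y: "y \<in> \<Omega>" for y
      by (intro has_derivative_diff smooth_on_has_derivative[OF smooth_on_dir_deriv[OF smX] y])
        (auto intro!: derivative_eq_intros simp: algebra_simps)
    then have "dir_deriv v (\<lambda>x. X x \<bullet> w) x - ?q x = dir_deriv v (\<lambda>x. X x \<bullet> w) x0 - ?q x0"
      by (rule constant_if_dir_deriv_zero[OF op con _ _ x x0]) (simp_all add: hess(1) f1 algebra_simps)
    then show ?thesis by (simp add: L(2))
  qed
  have X0: "X x \<bullet> w = X x0 \<bullet> w + L (x - x0) \<bullet> w
      + (2 * (b \<bullet> (x - x0)) * ((x - x0) \<bullet> w) - ((x - x0) \<bullet> (x - x0)) * (b \<bullet> w))"
    if x: "x \<in> \<Omega>" for x w
  proof -
    let ?q = "\<lambda>x. L (x - x0) \<bullet> w + (2 * (b \<bullet> (x - x0)) * ((x - x0) \<bullet> w) - ((x - x0) \<bullet> (x - x0)) * (b \<bullet> w))"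
    have "((\<lambda>x. X x \<bullet> w - ?q x) has_derivative
        (\<lambda>v. dir_deriv v (\<lambda>x. X x \<bullet> w) y - (L v \<bullet> w + 2 * ((v \<bullet> w) * (b \<bullet> (y - x0)) + ((y - x0) \<bullet> w) * (b \<bullet> v) - ((y - x0) \<bullet> v) * (b \<bullet> w))))) (at y)"
      if y: "y \<in> \<Omega>" for y
      by (intro has_derivative_diff smooth_on_has_derivative[OF smX y])
        (auto intro!: derivative_eq_intros L.has_derivative simp: algebra_simps inner_commute)
    then have "X x \<bullet> w - ?q x = X x0 \<bullet> w - ?q x0"
      by (rule constant_if_dir_deriv_zero[OF op con _ _ x x0]) (simp_all only: X1 diff_self)
    then show ?thesis by (simp add: L.zero)
  qed
  have "X x = X x0 + L (x - x0) + ((2 * (b \<bullet> (x - x0))) *\<^sub>R (x - x0) - ((x - x0) \<bullet> (x - x0)) *\<^sub>R b)"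
    if "x \<in> \<Omega>" for x
  proof (rule vector_eqI_inner)
    show "w \<bullet> X x = w \<bullet> (X x0 + L (x - x0) + ((2 * (b \<bullet> (x - x0))) *\<^sub>R (x - x0) - ((x - x0) \<bullet> (x - x0)) *\<^sub>R b))" for w
      using X0[OF that, of w] by (simp add: inner_expand inner_commute[of w])
  qed
  then show ?thesis using L(1,3) by blast
qed

section \<open>Classification of the fields of weights\<close>

text \<open>A skew form that vanishes on the complement of \<open>X\<close> is divisible by \<open>X\<close>.\<close>

lemma skew_eq_rotation:
  fixes B :: "'a::euclidean_space \<Rightarrow> 'a"
  assumes "linear B" and skew: "\<And>v w. v \<bullet> B w = - (w \<bullet> B v)" and "X \<noteq> 0"
    and van: "\<And>V W. V \<bullet> X = 0 \<Longrightarrow> W \<bullet> X = 0 \<Longrightarrow> V \<bullet> B W = 0"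
  shows "B v = rotation X (B X /\<^sub>R (X \<bullet> X)) v"
proof (rule vector_eqI_inner)
  fix y
  interpret linear B by fact
  define n where "n = X \<bullet> X"
  have n: "n \<noteq> 0" using assms(3) by (simp add: n_def)
  define V W where "V = v - ((v \<bullet> X) / n) *\<^sub>R X" and "W = y - ((y \<bullet> X) / n) *\<^sub>R X"
  have "V \<bullet> X = 0" "W \<bullet> X = 0" using n by (simp_all add: V_def W_def inner_expand flip: n_def)
  then have "W \<bullet> B V = 0" using van by blast
  moreover have "X \<bullet> B X = 0" using skew[of X X] by simp
  ultimately have "y \<bullet> B v = ((v \<bullet> X) / n) * (y \<bullet> B X) + ((y \<bullet> X) / n) * (X \<bullet> B v)"
    by (simp add: V_def W_def inner_expand diff scale algebra_simps)
  also have "X \<bullet> B v = - (v \<bullet> B X)" by (rule skew)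
  finally show "y \<bullet> B v = y \<bullet> rotation X (B X /\<^sub>R (X \<bullet> X)) v"
    by (simp add: rotation_def inner_expand divide_inverse inner_commute flip: n_def; simp add: algebra_simps)
qed

text \<open>With \<open>c\<close>, \<open>w\<close> and \<open>b\<close> in one plane, an inhomogeneous field is recentred inside that plane.  For
  \<open>b = 0\<close> the relation between \<open>b\<close>, \<open>c\<close> and \<open>w\<close> excludes the mixed (spiral) case.\<close>

lemma quadratic_field_kind:
  fixes c w :: "'a::euclidean_space"
  assumes c: "c \<noteq> 0" and wc: "w \<bullet> c = 0" and b: "b = \<beta> *\<^sub>R c - (l / 2) *\<^sub>R w"
  shows "\<exists>j. field_kind j (quadratic_field c l c w b)"
proof (cases "b = 0")
  case True
  have "c \<bullet> (\<beta> *\<^sub>R c) = c \<bullet> ((l / 2) *\<^sub>R w)" using b True by simp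
  then have "\<beta> = 0" using c wc by (simp add: inner_commute)
  then have lw: "l = 0 \<or> w = 0" using b True by auto
  show ?thesis
  proof (cases "w = 0")
    case w: True
    show ?thesis
    proof (cases "l = 0")
      case True
      then have "quadratic_field c l c w b = (\<lambda>x. c)"
        by (simp add: w \<open>b = 0\<close> fun_eq_iff quadratic_field_def rotation_def)
      then show ?thesis using kind_const[OF c] by auto
    next
      case False
      then have "quadratic_field c l c w b = (\<lambda>x. l *\<^sub>R (x - (- 1 / l) *\<^sub>R c))"
        by (simp add: w \<open>b = 0\<close> fun_eq_iff quadratic_field_def rotation_def scaleR_add_right)
      then show ?thesis using kind_radial[OF False] by metis
    qed
  next
    case False
    then have "l = 0" using lw by simp
    then have "quadratic_field c l c w b = (\<lambda>x. rotation c w (x - w /\<^sub>R (w \<bullet> w)))"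
      using False wc by (simp add: \<open>b = 0\<close> fun_eq_iff quadratic_field_def rotation_def inner_expand
          inner_commute scaleR_diff_left)
    then show ?thesis using kind_rotation[OF c False] wc by (metis inner_commute)
  qed
next
  case False
  \<comment> \<open>\<open>p\<close> is the solution of the two linear equations \<open>b \<bullet> p = - l / 2\<close> and
    \<open>\<beta> \<nu> - \<eta> \<mu> = - 1 / 2\<close>, which express that the scalar and the skew linear part vanish at \<open>p\<close>\<close>
  define \<eta> C W n where "\<eta> = - (l / 2)" and "C = c \<bullet> c" and "W = w \<bullet> w" and "n = b \<bullet> b"
  define \<mu> \<nu> p where "\<mu> = \<eta> * (\<beta> + W / 2) / n" and "\<nu> = (\<eta>\<^sup>2 - \<beta> * C / 2) / n" and "p = \<mu> *\<^sub>R c + \<nu> *\<^sub>R w"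
  have cw: "c \<bullet> w = 0" using wc by (simp add: inner_commute)
  have b': "b = \<beta> *\<^sub>R c + \<eta> *\<^sub>R w" by (simp add: b \<eta>_def)
  have l: "l = - 2 * \<eta>" by (simp add: \<eta>_def)
  have n: "n \<noteq> 0" using False by (simp add: n_def)
  have n_eq: "n = \<beta>\<^sup>2 * C + \<eta>\<^sup>2 * W"
    by (simp add: n_def b' inner_expand wc cw power2_eq_square flip: C_def W_def)
  have det: "\<beta> * \<nu> - \<eta> * \<mu> = - 1 / 2"
  proof -
    have "\<beta> * \<nu> - \<eta> * \<mu> = - (\<beta>\<^sup>2 * C + \<eta>\<^sup>2 * W) / (2 * n)"
      using n by (simp add: \<mu>_def \<nu>_def field_simps power2_eq_square)
    then show ?thesis using n by (simp flip: n_eq)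
  qed
  have bp: "b \<bullet> p = \<eta>"
  proof -
    have "b \<bullet> p = \<eta> * (\<beta>\<^sup>2 * C + \<eta>\<^sup>2 * W) / n"
      using n by (simp add: b' p_def inner_expand wc cw flip: C_def W_def)
        (simp add: \<mu>_def \<nu>_def field_simps power2_eq_square)
    then show ?thesis using n by (simp flip: n_eq)
  qed
  have rot: "(2 * (p \<bullet> x)) *\<^sub>R b - (2 * (b \<bullet> x)) *\<^sub>R p = rotation c w x" for x
  proof -
    have "(2 * (p \<bullet> x)) *\<^sub>R b - (2 * (b \<bullet> x)) *\<^sub>R p = (- 2 * (\<beta> * \<nu> - \<eta> * \<mu>)) *\<^sub>R rotation c w x"
      by (rule vector_eqI_inner) (simp add: b' p_def rotation_def inner_expand algebra_simps)
    then show ?thesis by (simp add: det)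
  qed
  have const: "(p \<bullet> p - 2 * \<nu>) *\<^sub>R b + (2 * \<eta>) *\<^sub>R p - (p \<bullet> p) *\<^sub>R b = c"
  proof -
    have "(p \<bullet> p - 2 * \<nu>) *\<^sub>R b + (2 * \<eta>) *\<^sub>R p - (p \<bullet> p) *\<^sub>R b = (- 2 * (\<beta> * \<nu> - \<eta> * \<mu>)) *\<^sub>R c"
      by (rule vector_eqI_inner) (simp add: b' p_def[of] inner_expand algebra_simps)
    then show ?thesis by (simp add: det)
  qed
  have "quadratic_field c l c w b x = pencil (p \<bullet> p - 2 * \<nu>) b (x - p)" for x
  proof -
    have "pencil (p \<bullet> p - 2 * \<nu>) b (x - p) =
        ((p \<bullet> p - 2 * \<nu>) *\<^sub>R b + (2 * (b \<bullet> p)) *\<^sub>R p - (p \<bullet> p) *\<^sub>R b) + (- 2 * (b \<bullet> p)) *\<^sub>R x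
        + ((2 * (p \<bullet> x)) *\<^sub>R b - (2 * (b \<bullet> x)) *\<^sub>R p) + ((2 * (b \<bullet> x)) *\<^sub>R x - (x \<bullet> x) *\<^sub>R b)"
      by (rule vector_eqI_inner) (simp add: pencil_def inner_expand inner_commute algebra_simps)
    then show ?thesis unfolding bp const rot by (simp add: quadratic_field_def l)
  qed
  then have "quadratic_field c l c w b = (\<lambda>x. pencil (p \<bullet> p - 2 * \<nu>) b (x - p))" by (rule ext)
  then show ?thesis using kind_pencil[OF False] by metis
qed

text \<open>By the Frobenius condition the skew part \<open>A y\<close> of the derivative is divisible by \<open>Q y\<close>, so
  \<open>Q y \<and> A y = 0\<close>.  At \<open>y = 0\<close> this says \<open>B = c \<and> w\<close> for the skew linear part \<open>B\<close>.  To first order in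
  \<open>y = t x\<close>, tested on \<open>c\<close>, on \<open>x\<close> itself and on \<open>V\<close>, with \<open>x\<close> orthogonal to \<open>c\<close> and \<open>V\<close>, it says that
  \<open>2 b + l w\<close> is orthogonal to every \<open>V\<close> perpendicular to \<open>c\<close>.  Hence \<open>b\<close> lies in the plane of \<open>c\<close> and
  \<open>w\<close>, with its \<open>w\<close> component determined by \<open>l\<close>.\<close>

lemma irrotational_conformal_kind:
  fixes c b :: "'a::euclidean_space" and L :: "'a \<Rightarrow> 'a"
  assumes dim: "DIM('a) \<ge> 3" and L: "linear L" and Ll: "\<And>v. v \<bullet> L v = l * (v \<bullet> v)" and e: "e > 0"
    and Q: "\<And>y. Q y = c + L y + ((2 * (b \<bullet> y)) *\<^sub>R y - (y \<bullet> y) *\<^sub>R b)"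
    and nz: "\<And>y. norm y < e \<Longrightarrow> Q y \<noteq> 0"
    and irr: "\<And>y V W. norm y < e \<Longrightarrow> V \<bullet> Q y = 0 \<Longrightarrow> W \<bullet> Q y = 0 \<Longrightarrow>
      V \<bullet> (L W + (2 * (b \<bullet> W)) *\<^sub>R y - (2 * (y \<bullet> W)) *\<^sub>R b) = W \<bullet> (L V + (2 * (b \<bullet> V)) *\<^sub>R y - (2 * (y \<bullet> V)) *\<^sub>R b)"
  shows "\<exists>j. field_kind j Q"
proof -
  interpret L: linear L by fact
  define B where "B v = L v - l *\<^sub>R v" for v
  have polar: "v \<bullet> L w + w \<bullet> L v = 2 * l * (v \<bullet> w)" for v w
    using Ll[of "v + w"] Ll[of v] Ll[of w] by (simp add: L.add inner_expand inner_commute algebra_simps)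
  have skewB: "v \<bullet> B w = - (w \<bullet> B v)" for v w
    using polar[of v w] by (simp add: B_def inner_expand inner_commute algebra_simps)
  have linB: "linear B"
    unfolding B_def by (auto intro!: linearI simp: L.add L.scale algebra_simps)
  interpret B: linear B by (rule linB)
  define A where "A y v = B v + (2 * (b \<bullet> v)) *\<^sub>R y - (2 * (y \<bullet> v)) *\<^sub>R b" for y v
  have linA: "linear (A y)" for y
    unfolding A_def by (auto intro!: linearI simp: B.add B.scale inner_add_right algebra_simps)
  have skewA: "v \<bullet> A y w = - (w \<bullet> A y v)" for v w y
    using skewB[of v w] by (simp add: A_def inner_expand inner_commute algebra_simps)
  have rot: "A y v = rotation (Q y) (A y (Q y) /\<^sub>R (Q y \<bullet> Q y)) v" if y: "norm y < e" for y v
  proof (rule skew_eq_rotation[OF linA skewA nz[OF y]])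
    fix V W assume "V \<bullet> Q y = 0" "W \<bullet> Q y = 0"
    from irr[OF y this] have "V \<bullet> A y W = W \<bullet> A y V"
      by (simp add: A_def B_def inner_expand inner_commute algebra_simps)
    then show "V \<bullet> A y W = 0" using skewA[of V y W] by simp
  qed
  \<comment> \<open>the vanishing of the wedge product of the field and its skew derivative\<close>
  have wedge: "(Q y \<bullet> p) * (q \<bullet> A y r) + (Q y \<bullet> q) * (r \<bullet> A y p) + (Q y \<bullet> r) * (p \<bullet> A y q) = 0"
    if y: "norm y < e" for y p q r
  proof -
    obtain \<omega> where "A y v = rotation (Q y) \<omega> v" for v using rot[OF y] by blast
    then have "A y v = (Q y \<bullet> v) *\<^sub>R \<omega> - (\<omega> \<bullet> v) *\<^sub>R Q y" for v by (simp add: rotation_def)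
    then show ?thesis by (simp only: inner_expand inner_scaleR_right) (simp add: inner_commute algebra_simps)
  qed
  have Q0: "Q 0 = c" by (simp add: Q L.zero)
  have c: "c \<noteq> 0" using nz[of 0] e by (simp add: Q0)
  define w where "w = B c /\<^sub>R (c \<bullet> c)"
  have Bw: "B v = rotation c w v" for v
    using rot[of 0 v] e by (simp add: A_def Q0 w_def)
  have wc: "w \<bullet> c = 0" "c \<bullet> w = 0" using skewB[of c c] by (simp_all add: w_def inner_commute)
  have key: "(2 *\<^sub>R b + l *\<^sub>R w) \<bullet> V = 0" if V: "V \<bullet> c = 0" for V
  proof -
    obtain x where x: "x \<noteq> 0" "x \<bullet> c = 0" "x \<bullet> V = 0" using orthogonal_to_two_exists[OF dim] by blast
    note orth = V x(2,3) V[unfolded inner_commute[of V]] x(2)[unfolded inner_commute[of x]] x(3)[unfolded inner_commute[of x]] wc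
    define C xx where "C = c \<bullet> c" and "xx = x \<bullet> x"
    define c1 c2 where "c1 = xx * C * (2 * (b \<bullet> V) + l * (w \<bullet> V))"
      and "c2 = xx * C * ((b \<bullet> x) * (w \<bullet> V) - (b \<bullet> V) * (w \<bullet> x))"
    have poly: "t * c1 + t\<^sup>2 * c2 = 0" if t: "norm (t *\<^sub>R x) < e" for t :: real
    proof -
      have QB: "Q (t *\<^sub>R x) = c + t *\<^sub>R (l *\<^sub>R x - (w \<bullet> x) *\<^sub>R c) + t\<^sup>2 *\<^sub>R ((2 * (b \<bullet> x)) *\<^sub>R x - xx *\<^sub>R b)"
      proof -
        have "L x = l *\<^sub>R x + rotation c w x" using Bw[of x] by (simp add: B_def algebra_simps)
        then have "L x = l *\<^sub>R x - (w \<bullet> x) *\<^sub>R c" by (simp add: rotation_def orth)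
        then show ?thesis
          by (simp add: Q L.scale xx_def power2_eq_square scaleR_diff_right ac_simps)
      qed
      have q1: "Q (t *\<^sub>R x) \<bullet> c = C - t * (w \<bullet> x) * C - t\<^sup>2 * xx * (b \<bullet> c)"
        and q2: "Q (t *\<^sub>R x) \<bullet> x = t * l * xx + t\<^sup>2 * (b \<bullet> x) * xx"
        and q3: "Q (t *\<^sub>R x) \<bullet> V = - t\<^sup>2 * xx * (b \<bullet> V)"
        unfolding QB by (simp_all add: inner_expand orth C_def xx_def algebra_simps)
      have a1: "x \<bullet> A (t *\<^sub>R x) V = 2 * t * (b \<bullet> V) * xx"
        and a2: "V \<bullet> A (t *\<^sub>R x) c = C * (w \<bullet> V)"
        and a3: "c \<bullet> A (t *\<^sub>R x) x = - C * (w \<bullet> x) - 2 * t * xx * (b \<bullet> c)"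
        unfolding A_def Bw rotation_def
        by (simp_all add: inner_expand orth C_def xx_def inner_commute algebra_simps)
      show ?thesis
        using wedge[OF t, of c x V] unfolding q1 q2 q3 a1 a2 a3 c1_def c2_def
        by (simp add: algebra_simps power2_eq_square)
    qed
    define t where "t = e / (2 * norm x)"
    have t: "t > 0" "norm (t *\<^sub>R x) < e" "norm ((t / 2) *\<^sub>R x) < e"
      using e x(1) by (simp_all add: t_def)
    \<comment> \<open>the cubic terms have cancelled, so two values of \<open>t\<close> isolate the linear coefficient\<close>
    have "t * c1 = 4 * ((t / 2) * c1 + (t / 2)\<^sup>2 * c2) - (t * c1 + t\<^sup>2 * c2)"
      by (simp add: field_simps power2_eq_square)
    also have "\<dots> = 0" by (simp only: poly[OF t(2)] poly[OF t(3)] mult_zero_right diff_self)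
    finally have "t * c1 = 0" .
    then have "c1 = 0" using t(1) by simp
    moreover have "xx * C \<noteq> 0" using x(1) c by (simp add: xx_def C_def)
    ultimately show ?thesis by (simp add: c1_def inner_expand)
  qed
  define u \<beta> where "u = 2 *\<^sub>R b + l *\<^sub>R w" and "\<beta> = (u \<bullet> c) / (2 * (c \<bullet> c))"
  define V where "V = u - (2 * \<beta>) *\<^sub>R c"
  have Vc: "V \<bullet> c = 0" using c by (simp add: V_def \<beta>_def inner_expand)
  have "V \<bullet> V = u \<bullet> V" using Vc by (simp add: V_def[of] inner_expand inner_commute)
  then have "V = 0" using key[OF Vc] by (simp add: u_def)
  then have "2 *\<^sub>R b = (2 * \<beta>) *\<^sub>R c - l *\<^sub>R w" by (simp add: V_def u_def algebra_simps)
  then have "(1 / 2) *\<^sub>R (2 *\<^sub>R b) = (1 / 2) *\<^sub>R ((2 * \<beta>) *\<^sub>R c - l *\<^sub>R w)" by simp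
  then have "b = \<beta> *\<^sub>R c - (l / 2) *\<^sub>R w" by (simp add: scaleR_diff_right)
  moreover have "Q = quadratic_field c l c w b"
  proof
    show "Q y = quadratic_field c l c w b y" for y
      using Bw[of y] by (simp add: Q quadratic_field_def B_def algebra_simps)
  qed
  ultimately show ?thesis using quadratic_field_kind[OF c wc(1)] by metis
qed

theorem LCW_field_kind:
  fixes \<phi> :: "'a::euclidean_space \<Rightarrow> real"
  assumes dim: "DIM('a) \<ge> 3" and LCW: "LCW \<Omega> \<phi>" and con: "connected \<Omega>" and ne: "\<Omega> \<noteq> {}"
  shows "\<exists>j X. field_kind j X \<and> has_field \<Omega> \<phi> X"
proof -
  have op: "open \<Omega>" using LCW by (simp add: LCW_def)
  obtain X where X: "has_field \<Omega> \<phi> X" "conformal_field \<Omega> X" "smooth_field \<Omega> X" "irrotational_field \<Omega> X"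
    using LCW_imp_field[OF LCW] by blast
  obtain x0 where x0: "x0 \<in> \<Omega>" using ne by blast
  obtain e where e: "e > 0" "ball x0 e \<subseteq> \<Omega>" using op x0 openE by blast
  obtain L l b where L: "linear L" "\<And>v. v \<bullet> L v = l * (v \<bullet> v)"
    "\<And>x. x \<in> \<Omega> \<Longrightarrow> X x = X x0 + L (x - x0) + ((2 * (b \<bullet> (x - x0))) *\<^sub>R (x - x0) - ((x - x0) \<bullet> (x - x0)) *\<^sub>R b)"
    using conformal_field_quadratic_near[OF dim op con x0 X(3,2)] by blast
  have "bounded_linear L" using L(1) by (simp add: linear_linear)
  then interpret L: bounded_linear L .
  define Q where "Q y = X x0 + L y + ((2 * (b \<bullet> y)) *\<^sub>R y - (y \<bullet> y) *\<^sub>R b)" for y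
  have XQ: "X x = Q (x - x0)" if "x \<in> \<Omega>" for x using L(3)[OF that] by (simp add: Q_def)
  have "\<exists>j. field_kind j Q"
  proof (rule irrotational_conformal_kind[OF dim L(1,2) e(1) Q_def])
    fix y :: 'a assume y: "norm y < e"
    have x: "x0 + y \<in> \<Omega>" using e(2) y by (auto simp: subset_iff dist_norm)
    then show "Q y \<noteq> 0" using X(1) XQ[OF x] by (auto simp: has_field_def)
    fix V W assume VW: "V \<bullet> Q y = 0" "W \<bullet> Q y = 0"
    let ?D = "\<lambda>v. L v + (2 * (b \<bullet> v)) *\<^sub>R y + (2 * (b \<bullet> y)) *\<^sub>R v - (2 * (y \<bullet> v)) *\<^sub>R b"
    have "((\<lambda>x. Q (x - x0)) has_derivative ?D) (at (x0 + y))"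
      unfolding Q_def
      by (auto intro!: derivative_eq_intros L.has_derivative simp: inner_commute algebra_simps scaleR_2)
    then have "(X has_derivative ?D) (at (x0 + y))"
      by (rule has_derivative_cong_open[OF op x, rotated]) (simp add: XQ)
    moreover have "V \<bullet> X (x0 + y) = 0" "W \<bullet> X (x0 + y) = 0" using VW by (simp_all add: XQ[OF x])
    ultimately have "V \<bullet> ?D W = W \<bullet> ?D V"
      using X(4) x unfolding irrotational_field_def by blast
    then show "V \<bullet> (L W + (2 * (b \<bullet> W)) *\<^sub>R y - (2 * (y \<bullet> W)) *\<^sub>R b) = W \<bullet> (L V + (2 * (b \<bullet> V)) *\<^sub>R y - (2 * (y \<bullet> V)) *\<^sub>R b)"
      by (simp add: inner_expand inner_commute)
  qed
  then obtain j where "field_kind j Q" by blast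
  then have "field_kind j (\<lambda>x. Q (1 *\<^sub>R x + (- x0)) /\<^sub>R 1)"
    by (rule field_kind_similarity[where A = "\<lambda>x. x" and B = "\<lambda>x. x"]) (simp_all add: orthogonal_transformation_id)
  then have "field_kind j (\<lambda>x. Q (x - x0))" by simp
  moreover have "has_field \<Omega> \<phi> (\<lambda>x. Q (x - x0))"
    using X(1) XQ by (simp add: has_field_def)
  ultimately show ?thesis by blast
qed

section \<open>Branches of the arctangent\<close>

text \<open>This form of membership has no case distinction on \<open>q = 0\<close> and no integer multiple of \<open>\<pi>\<close>.\<close>

lemma arctan_values_iff:
  "t \<in> arctan_values p q \<longleftrightarrow> (p \<noteq> 0 \<or> q \<noteq> 0) \<and> p * cos t = q * sin t"
proof (cases "q = 0")
  case True
  have "(\<exists>k. t = pi / 2 + of_int k * pi) \<longleftrightarrow> cos t = 0"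
    unfolding cos_zero_iff_int2 by (simp add: add.commute)
  then show ?thesis using True by (auto simp: arctan_values_def)
next
  case False
  define a where "a = arctan (p / q)"
  have ca: "cos a > 0" by (simp add: a_def cos_arctan add_pos_nonneg)
  have "tan a = p / q" by (simp add: a_def tan_arctan)
  then have sa: "sin a = (p / q) * cos a" using ca by (simp add: tan_def field_simps)
  have "(\<exists>k. t = a + of_int k * pi) \<longleftrightarrow> (\<exists>k. t - a = of_int k * pi)" by (simp add: algebra_simps)
  also have "\<dots> \<longleftrightarrow> sin (t - a) = 0" by (simp add: sin_zero_iff_int2)
  also have "sin (t - a) = cos a * (sin t - (p / q) * cos t)" by (simp add: sin_diff sa algebra_simps)
  also have "\<dots> = 0 \<longleftrightarrow> p * cos t = q * sin t" using ca False by (auto simp: field_simps)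
  finally show ?thesis using False by (auto simp: arctan_values_def a_def)
qed

text \<open>The vector \<open>(q, p)\<close> in polar form \<open>r (cos \<theta>, sin \<theta>)\<close>, turned back by the angle \<open>t\<close>, where \<open>c = cos t\<close> and
  \<open>s = sin t\<close>, and turned again.\<close>

lemma turn_identities:
  fixes p q c s :: real
  shows "(p * c - q * s) * c + (q * c + p * s) * s = p * (c\<^sup>2 + s\<^sup>2)"
    and "(q * c + p * s) * c - (p * c - q * s) * s = q * (c\<^sup>2 + s\<^sup>2)"
    and "(p * c - q * s)\<^sup>2 + (q * c + p * s)\<^sup>2 = (p\<^sup>2 + q\<^sup>2) * (c\<^sup>2 + s\<^sup>2)"
  by (simp_all add: power2_eq_square algebra_simps)

text \<open>Turning \<open>(q, p)\<close> back by the value of the branch at \<open>x\<close> makes the new first coordinate nonzero near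
  \<open>x\<close>, so there the branch is a constant plus the principal arctangent.  Continuity of the branch
  is what selects the right multiple of \<open>\<pi>\<close>.\<close>

lemma arctan_branch_has_derivative:
  fixes \<phi> :: "'a::euclidean_space \<Rightarrow> real"
  assumes op: "open \<Omega>" and cont: "continuous_on \<Omega> \<phi>" and br: "\<And>x. x \<in> \<Omega> \<Longrightarrow> \<phi> x \<in> arctan_values (p x) (q x)"
    and x: "x \<in> \<Omega>" and P: "(p has_derivative P) (at x)" and Q: "(q has_derivative Q) (at x)"
  shows "(\<phi> has_derivative (\<lambda>v. (q x * P v - p x * Q v) / ((p x)\<^sup>2 + (q x)\<^sup>2))) (at x)"
proof -
  define t where "t = \<phi> x"
  define p' q' where "p' y = p y * cos t - q y * sin t" and "q' y = q y * cos t + p y * sin t" for y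
  have P': "(p' has_derivative (\<lambda>v. P v * cos t - Q v * sin t)) (at x)"
    and Q': "(q' has_derivative (\<lambda>v. Q v * cos t + P v * sin t)) (at x)"
    unfolding p'_def[abs_def] q'_def[abs_def] by (auto intro!: derivative_eq_intros P Q)
  have pq: "p x \<noteq> 0 \<or> q x \<noteq> 0" and p'0: "p' x = 0"
    using br[OF x] by (simp_all add: arctan_values_iff p'_def t_def)
  have "p' x * cos t + q' x * sin t = p x" "q' x * cos t - p' x * sin t = q x"
    unfolding p'_def q'_def turn_identities by simp_all
  then have px: "p x = q' x * sin t" and qx: "q x = q' x * cos t" using p'0 by simp_all
  then have q'0: "q' x \<noteq> 0" using pq by auto
  have "(p' x)\<^sup>2 + (q' x)\<^sup>2 = (p x)\<^sup>2 + (q x)\<^sup>2"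
    unfolding p'_def q'_def turn_identities by simp
  then have rr: "(p x)\<^sup>2 + (q x)\<^sup>2 = (q' x)\<^sup>2" using p'0 by simp
  have "(arctan has_derivative (*) (inverse (1 + (p' x / q' x)\<^sup>2))) (at (p' x / q' x))"
    using DERIV_arctan[of "p' x / q' x"] by (simp add: has_field_derivative_def)
  from has_derivative_add[OF has_derivative_const has_derivative_compose[OF has_derivative_divide'[OF P' Q' q'0] this], of t]
  have D: "((\<lambda>y. t + arctan (p' y / q' y)) has_derivative
      (\<lambda>v. (q x * P v - p x * Q v) / ((p x)\<^sup>2 + (q x)\<^sup>2))) (at x)"
    unfolding rr unfolding px qx using q'0 by (simp add: p'0 field_simps power2_eq_square)
  have "isCont q' x" using Q' by (rule has_derivative_continuous)
  then have ev1: "\<forall>\<^sub>F y in at x. q' y \<noteq> 0" using q'0 by (intro tendsto_imp_eventually_ne) (auto simp: isCont_def)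
  have "isCont \<phi> x" using cont x op by (simp add: continuous_on_eq_continuous_at)
  then have ev2: "\<forall>\<^sub>F y in at x. dist (\<phi> y) t < pi / 2"
    unfolding isCont_def t_def by (rule tendstoD) simp
  have ev3: "\<forall>\<^sub>F y in at x. y \<in> \<Omega>" using eventually_at_in_open'[OF op x] .
  have "\<forall>\<^sub>F y in at x. t + arctan (p' y / q' y) = \<phi> y"
    using ev1 ev2 ev3
  proof eventually_elim
    case (elim y)
    define s where "s = \<phi> y - t"
    have "\<bar>s\<bar> < pi / 2" using elim(2) by (simp add: s_def dist_real_def)
    then have s: "- (pi / 2) < s" "s < pi / 2" by linarith+
    then have "cos s > 0" by (simp add: cos_gt_zero_pi)
    have "p y * cos (s + t) = q y * sin (s + t)"
      using br[OF elim(3)] by (simp add: arctan_values_iff s_def)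
    then have "cos s * p' y = sin s * q' y"
      by (simp add: cos_add sin_add p'_def q'_def algebra_simps)
    then have "tan s = p' y / q' y" using \<open>cos s > 0\<close> elim(1) by (simp add: tan_def field_simps)
    then have "arctan (p' y / q' y) = s" using s arctan_tan by metis
    then show ?case by (simp add: s_def)
  qed
  then show ?thesis
    by (rule has_derivative_transform_eventually[OF D]) (simp_all add: p'0, simp add: t_def)
qed

text \<open>
  Conversely, if \<open>\<phi>\<close> has the gradient of the angle of \<open>(q, p)\<close>, then the unit vector in this
  direction, turned back by \<open>\<phi>\<close>, is constant; its angle is the additive constant.
\<close>

lemma arctan_branch_exists:
  fixes \<phi> :: "'a::euclidean_space \<Rightarrow> real"
  assumes op: "open \<Omega>" and con: "connected \<Omega>"
    and P: "\<And>x. x \<in> \<Omega> \<Longrightarrow> (p has_derivative P x) (at x)" and Q: "\<And>x. x \<in> \<Omega> \<Longrightarrow> (q has_derivative Q x) (at x)"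
    and nz: "\<And>x. x \<in> \<Omega> \<Longrightarrow> p x \<noteq> 0 \<or> q x \<noteq> 0"
    and D: "\<And>x. x \<in> \<Omega> \<Longrightarrow> (\<phi> has_derivative (\<lambda>v. (q x * P x v - p x * Q x v) / ((p x)\<^sup>2 + (q x)\<^sup>2))) (at x)"
  shows "\<exists>\<beta>. \<forall>x\<in>\<Omega>. \<phi> x - \<beta> \<in> arctan_values (p x) (q x)"
proof (cases "\<Omega> = {}")
  case False
  then obtain x0 where x0: "x0 \<in> \<Omega>" by blast
  define \<rho> N S where "\<rho> x = (p x)\<^sup>2 + (q x)\<^sup>2" and "N x = p x * cos (\<phi> x) - q x * sin (\<phi> x)"
    and "S x = q x * cos (\<phi> x) + p x * sin (\<phi> x)" for x
  have \<rho>: "\<rho> x > 0" if "x \<in> \<Omega>" for x using nz[OF that] by (auto simp: \<rho>_def sum_power2_gt_zero_iff)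
  \<comment> \<open>the logarithmic derivative of \<open>\<surd>(p\<^sup>2 + q\<^sup>2)\<close>, shared by both coordinates of the turned vector\<close>
  define \<omega> where "\<omega> x v = (p x * P x v + q x * Q x v) / \<rho> x" for x v
  have DN: "(N has_derivative (\<lambda>v. N x * \<omega> x v)) (at x)" and DS: "(S has_derivative (\<lambda>v. S x * \<omega> x v)) (at x)"
    if x: "x \<in> \<Omega>" for x
  proof -
    define d where "d v = (q x * P x v - p x * Q x v) / \<rho> x" for v
    have D\<phi>: "(\<phi> has_derivative d) (at x)" using D[OF x] by (simp add: d_def[abs_def] \<rho>_def)
    have "(N has_derivative (\<lambda>v. P x v * cos (\<phi> x) - Q x v * sin (\<phi> x) - S x * d v)) (at x)"
      unfolding N_def[abs_def] S_def by (auto intro!: derivative_eq_intros P[OF x] Q[OF x] D\<phi> simp: algebra_simps)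
    moreover have "P x v * cos (\<phi> x) - Q x v * sin (\<phi> x) - S x * d v = N x * \<omega> x v" for v
    proof -
      have "\<rho> x * (P x v * cos (\<phi> x) - Q x v * sin (\<phi> x)) - S x * (q x * P x v - p x * Q x v) = N x * (p x * P x v + q x * Q x v)"
        by (simp add: \<rho>_def N_def S_def power2_eq_square algebra_simps)
      then show ?thesis using \<rho>[OF x] by (simp add: d_def \<omega>_def field_simps)
    qed
    ultimately show "(N has_derivative (\<lambda>v. N x * \<omega> x v)) (at x)" by simp
    have "(S has_derivative (\<lambda>v. Q x v * cos (\<phi> x) + P x v * sin (\<phi> x) + N x * d v)) (at x)"
      unfolding S_def[abs_def] N_def by (auto intro!: derivative_eq_intros P[OF x] Q[OF x] D\<phi> simp: algebra_simps)
    moreover have "Q x v * cos (\<phi> x) + P x v * sin (\<phi> x) + N x * d v = S x * \<omega> x v" for v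
    proof -
      have "\<rho> x * (Q x v * cos (\<phi> x) + P x v * sin (\<phi> x)) + N x * (q x * P x v - p x * Q x v) = S x * (p x * P x v + q x * Q x v)"
        by (simp add: \<rho>_def N_def S_def power2_eq_square algebra_simps)
      then show ?thesis using \<rho>[OF x] by (simp add: d_def \<omega>_def field_simps)
    qed
    ultimately show "(S has_derivative (\<lambda>v. S x * \<omega> x v)) (at x)" by simp
  qed
  have D\<rho>: "((\<lambda>x. sqrt (\<rho> x)) has_derivative (\<lambda>v. sqrt (\<rho> x) * \<omega> x v)) (at x)" if x: "x \<in> \<Omega>" for x
  proof -
    have "((\<lambda>x. sqrt (\<rho> x)) has_derivative (\<lambda>v. (2 * p x * P x v + 2 * q x * Q x v) * (inverse (sqrt (\<rho> x)) / 2))) (at x)"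
      unfolding \<rho>_def using \<rho>[OF x] unfolding \<rho>_def
      by (auto intro!: derivative_eq_intros P[OF x] Q[OF x] simp: algebra_simps)
    moreover have "(2 * p x * P x v + 2 * q x * Q x v) * (inverse (sqrt (\<rho> x)) / 2) = sqrt (\<rho> x) * \<omega> x v" for v
    proof -
      have "sqrt (\<rho> x) * \<omega> x v = (p x * P x v + q x * Q x v) * (sqrt (\<rho> x) / \<rho> x)"
        by (simp add: \<omega>_def)
      also have "sqrt (\<rho> x) / \<rho> x = inverse (sqrt (\<rho> x))"
        using \<rho>[OF x] by (simp add: sqrt_divide_self_eq)
      finally show ?thesis by (simp add: algebra_simps)
    qed
    ultimately show ?thesis by simp
  qed
  have const: "f x / sqrt (\<rho> x) = f x0 / sqrt (\<rho> x0)"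
    if "\<And>x. x \<in> \<Omega> \<Longrightarrow> (f has_derivative (\<lambda>v. f x * \<omega> x v)) (at x)" and x: "x \<in> \<Omega>" for f x
  proof (rule constant_if_dir_deriv_zero[OF op con _ _ x x0])
    fix y assume y: "y \<in> \<Omega>"
    show "((\<lambda>x. f x / sqrt (\<rho> x)) has_derivative
        (\<lambda>v. (f y * \<omega> y v * sqrt (\<rho> y) - f y * (sqrt (\<rho> y) * \<omega> y v)) / (sqrt (\<rho> y) * sqrt (\<rho> y)))) (at y)"
      using \<rho>[OF y] by (intro has_derivative_divide' that(1)[OF y] D\<rho>[OF y]) simp
  qed simp
  define c s where "c = N x0 / sqrt (\<rho> x0)" and "s = S x0 / sqrt (\<rho> x0)"
  have NS: "N x = c * sqrt (\<rho> x)" "S x = s * sqrt (\<rho> x)" if "x \<in> \<Omega>" for x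
    using const[of N x, OF DN that] const[of S x, OF DS that] \<rho>[OF that] by (simp_all add: c_def s_def field_simps)
  have "(N x0)\<^sup>2 + (S x0)\<^sup>2 = \<rho> x0" unfolding N_def S_def turn_identities \<rho>_def by simp
  moreover have "c\<^sup>2 = (N x0)\<^sup>2 / \<rho> x0" "s\<^sup>2 = (S x0)\<^sup>2 / \<rho> x0"
    using \<rho>[OF x0] by (simp_all add: c_def s_def power_divide)
  ultimately have "s\<^sup>2 + (- c)\<^sup>2 = 1"
    using \<rho>[OF x0] by (simp add: add.commute flip: add_divide_distrib)
  then obtain \<beta> where \<beta>: "s = cos \<beta>" "- c = sin \<beta>" using sincos_total_2pi by metis
  have "\<phi> x - \<beta> \<in> arctan_values (p x) (q x)" if x: "x \<in> \<Omega>" for x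
  proof -
    have "p x * cos (\<phi> x - \<beta>) - q x * sin (\<phi> x - \<beta>) = N x * cos \<beta> + S x * sin \<beta>"
      by (simp add: cos_diff sin_diff N_def S_def algebra_simps)
    also have "\<dots> = 0" by (simp add: NS[OF x] \<beta>[symmetric])
    finally show ?thesis using nz[OF x] by (simp add: arctan_values_iff)
  qed
  then show ?thesis by blast
qed simp

section \<open>The six families and their fields\<close>

lemma has_field_continuous: "has_field \<Omega> \<phi> X \<Longrightarrow> continuous_on \<Omega> \<phi>"
  unfolding has_field_def by (metis continuous_at_imp_continuous_on has_derivative_continuous)

text \<open>On connected open sets the branches of the multivalued function \<open>\<psi>\<close> are, up to additive
  constants, the functions with field \<open>X\<close>.  The last conjunct excludes the vacuous case.\<close>

definition weight_with_field :: "('a::euclidean_space \<Rightarrow> real set) \<Rightarrow> ('a \<Rightarrow> 'a) \<Rightarrow> bool" where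
  "weight_with_field \<psi> X \<longleftrightarrow>
     (\<forall>\<Omega> \<phi>. open \<Omega> \<longrightarrow> (branch_on \<Omega> \<psi> \<phi> \<longrightarrow> has_field \<Omega> \<phi> X) \<and>
       (connected \<Omega> \<longrightarrow> has_field \<Omega> \<phi> X \<longrightarrow> (\<exists>\<beta>. branch_on \<Omega> (rescale 1 \<beta> \<psi>) \<phi>))) \<and>
     (\<exists>\<Omega> \<phi>. open \<Omega> \<and> connected \<Omega> \<and> \<Omega> \<noteq> {} \<and> branch_on \<Omega> \<psi> \<phi>)"

lemma single_valued_weight:
  fixes g :: "'a::euclidean_space \<Rightarrow> real"
  assumes \<psi>: "\<And>x. \<psi> x = (if X x = 0 then {} else {g x})"
    and g: "\<And>x. X x \<noteq> 0 \<Longrightarrow> (g has_derivative (\<lambda>v. X x \<bullet> v / (X x \<bullet> X x))) (at x)"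
    and X: "continuous_on UNIV X" "X x1 \<noteq> 0"
  shows "weight_with_field \<psi> X"
  unfolding weight_with_field_def
proof (intro conjI allI impI)
  fix \<Omega> \<phi> assume op: "open \<Omega>" and "branch_on \<Omega> \<psi> \<phi>"
  then have "X x \<noteq> 0" "g x = \<phi> x" if "x \<in> \<Omega>" for x
    using that by (auto simp: branch_on_def \<psi> split: if_splits)
  moreover from this have "has_field \<Omega> g X" using g by (simp add: has_field_def)
  ultimately show "has_field \<Omega> \<phi> X" using has_field_cong[OF op] by blast
next
  fix \<Omega> \<phi> assume op: "open \<Omega>" and con: "connected \<Omega>" and F: "has_field \<Omega> \<phi> X"
  have "\<exists>\<beta>. \<forall>x\<in>\<Omega>. \<phi> x = g x + \<beta>"
  proof (cases "\<Omega> = {}")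
    case False
    then obtain x0 where x0: "x0 \<in> \<Omega>" by blast
    have "\<phi> x - g x = \<phi> x0 - g x0" if x: "x \<in> \<Omega>" for x
    proof (rule constant_if_dir_deriv_zero[OF op con _ _ x x0])
      show "((\<lambda>x. \<phi> x - g x) has_derivative (\<lambda>v. X y \<bullet> v / (X y \<bullet> X y) - X y \<bullet> v / (X y \<bullet> X y))) (at y)"
        if "y \<in> \<Omega>" for y
        using F that g by (intro has_derivative_diff) (auto simp: has_field_def)
    qed simp
    then show ?thesis by (metis add.commute diff_add_cancel)
  qed simp
  then obtain \<beta> where "\<forall>x\<in>\<Omega>. \<phi> x = g x + \<beta>" by blast
  then show "\<exists>\<beta>. branch_on \<Omega> (rescale 1 \<beta> \<psi>) \<phi>"
    using F has_field_continuous[OF F] by (intro exI[of _ \<beta>]) (auto simp: branch_on_def rescale_def \<psi> has_field_def)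
next
  have "open {x. X x \<noteq> 0}" by (rule open_Collect_neq[OF X(1) continuous_on_const])
  then obtain e where e: "e > 0" "ball x1 e \<subseteq> {x. X x \<noteq> 0}" using X(2) openE by blast
  then have "has_field (ball x1 e) g X" using g by (auto simp: has_field_def)
  then have "branch_on (ball x1 e) \<psi> g"
    using e has_field_continuous by (auto simp: branch_on_def \<psi>)
  then show "\<exists>\<Omega> \<phi>. open \<Omega> \<and> connected \<Omega> \<and> \<Omega> \<noteq> {} \<and> branch_on \<Omega> \<psi> \<phi>"
    using e(1) by (intro exI[of _ "ball x1 e"] exI[of _ g]) simp
qed

lemma arctan_weight:
  fixes p q :: "'a::euclidean_space \<Rightarrow> real"
  assumes \<psi>: "\<And>x. \<psi> x = (\<lambda>t. k * t) ` arctan_values (p x) (q x)" and k: "k \<noteq> 0"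
    and P: "\<And>x. (p has_derivative P x) (at x)" and Q: "\<And>x. (q has_derivative Q x) (at x)"
    and X0: "\<And>x. X x = 0 \<longleftrightarrow> p x = 0 \<and> q x = 0"
    and X: "\<And>x v. X x \<noteq> 0 \<Longrightarrow> X x \<bullet> v / (X x \<bullet> X x) = k * ((q x * P x v - p x * Q x v) / ((p x)\<^sup>2 + (q x)\<^sup>2))"
    and q: "q x1 \<noteq> 0"
  shows "weight_with_field \<psi> X"
  unfolding weight_with_field_def
proof (intro conjI allI impI)
  fix \<Omega> \<phi> assume op: "open \<Omega>" and br: "branch_on \<Omega> \<psi> \<phi>"
  define \<theta> where "\<theta> x = \<phi> x / k" for x
  have \<theta>: "\<theta> x \<in> arctan_values (p x) (q x)" if "x \<in> \<Omega>" for x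
    using br that k by (auto simp: branch_on_def \<psi> \<theta>_def)
  have cont: "continuous_on \<Omega> \<theta>"
    using br k by (auto simp: branch_on_def \<theta>_def[abs_def] intro!: continuous_intros)
  have "X x \<noteq> 0 \<and> (\<phi> has_derivative (\<lambda>v. X x \<bullet> v / (X x \<bullet> X x))) (at x)" if x: "x \<in> \<Omega>" for x
  proof
    show "X x \<noteq> 0" using \<theta>[OF x] by (auto simp: arctan_values_iff X0)
    have "((\<lambda>x. k * \<theta> x) has_derivative (\<lambda>v. k * ((q x * P x v - p x * Q x v) / ((p x)\<^sup>2 + (q x)\<^sup>2)))) (at x)"
      by (rule has_derivative_mult_right[OF arctan_branch_has_derivative[OF op cont \<theta> x P Q]])
    then show "(\<phi> has_derivative (\<lambda>v. X x \<bullet> v / (X x \<bullet> X x))) (at x)"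
      using k \<open>X x \<noteq> 0\<close> by (simp add: X \<theta>_def)
  qed
  then show "has_field \<Omega> \<phi> X" by (simp add: has_field_def)
next
  fix \<Omega> \<phi> assume op: "open \<Omega>" and con: "connected \<Omega>" and F: "has_field \<Omega> \<phi> X"
  have "\<exists>\<beta>. \<forall>x\<in>\<Omega>. \<phi> x / k - \<beta> \<in> arctan_values (p x) (q x)"
  proof (rule arctan_branch_exists[OF op con P Q])
    fix x assume x: "x \<in> \<Omega>"
    then have "X x \<noteq> 0" using F by (simp add: has_field_def)
    then show "p x \<noteq> 0 \<or> q x \<noteq> 0" by (simp add: X0)
    have "(\<phi> has_derivative (\<lambda>v. X x \<bullet> v / (X x \<bullet> X x))) (at x)"
      using F x by (simp add: has_field_def)
    then have "(\<phi> has_derivative (\<lambda>v. k * ((q x * P x v - p x * Q x v) / ((p x)\<^sup>2 + (q x)\<^sup>2)))) (at x)"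
      unfolding X[OF \<open>X x \<noteq> 0\<close>] .
    from has_derivative_mult_right[OF this, of "1 / k"]
    show "((\<lambda>x. \<phi> x / k) has_derivative (\<lambda>v. (q x * P x v - p x * Q x v) / ((p x)\<^sup>2 + (q x)\<^sup>2))) (at x)"
      using k by (simp add: mult.commute)
  qed
  then obtain \<beta> where \<beta>: "\<And>x. x \<in> \<Omega> \<Longrightarrow> \<phi> x / k - \<beta> \<in> arctan_values (p x) (q x)" by blast
  have "\<phi> x \<in> rescale 1 (k * \<beta>) \<psi> x" if "x \<in> \<Omega>" for x
  proof -
    have "\<phi> x = 1 * (k * (\<phi> x / k - \<beta>)) + k * \<beta>" using k by (simp add: algebra_simps)
    then show ?thesis using \<beta>[OF that] unfolding rescale_def \<psi> by blast
  qed
  then show "\<exists>\<beta>. branch_on \<Omega> (rescale 1 \<beta> \<psi>) \<phi>"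
    using has_field_continuous[OF F] unfolding branch_on_def by blast
next
  have cont: "continuous_on S p" "continuous_on S q" for S
    using P Q has_derivative_continuous by (blast intro: continuous_at_imp_continuous_on)+
  have "open {x. q x \<noteq> 0}" by (rule open_Collect_neq[OF cont(2) continuous_on_const])
  then obtain e where e: "e > 0" "ball x1 e \<subseteq> {x. q x \<noteq> 0}" using q openE by blast
  have "arctan (p x / q x) \<in> arctan_values (p x) (q x)" if "q x \<noteq> 0" for x
    using that by (auto simp: arctan_values_def intro!: exI[of _ 0])
  then have "branch_on (ball x1 e) \<psi> (\<lambda>x. k * arctan (p x / q x))"
    unfolding branch_on_def \<psi> using e(2) by (auto intro!: continuous_intros cont)
  then show "\<exists>\<Omega> \<phi>. open \<Omega> \<and> connected \<Omega> \<and> \<Omega> \<noteq> {} \<and> branch_on \<Omega> \<psi> \<phi>"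
    using e(1) by (intro exI[of _ "ball x1 e"] exI[of _ "\<lambda>x. k * arctan (p x / q x)"]) simp
qed

text \<open>The factor \<open>1 / 2\<close> accounts for the factors \<open>- 2\<close> and \<open>1 / \<surd>s\<close> in the last three families.\<close>

definition family_field :: "'a::euclidean_space \<Rightarrow> 'a \<Rightarrow> real \<Rightarrow> nat \<Rightarrow> 'a \<Rightarrow> 'a" where
  "family_field \<gamma> \<sigma> s j x =
     (if j = 1 then \<gamma> else if j = 2 then x else if j = 3 then rotation \<sigma> \<gamma> x
      else (1 / 2) *\<^sub>R pencil (if j = 4 then 0 else if j = 5 then s else - s) \<gamma> x)"

text \<open>The squared length is \<open>s\<^sup>2 (p\<^sup>2 + q\<^sup>2)\<close> for the fifth and \<open>s\<^sup>2 (q\<^sup>2 - p\<^sup>2)\<close> for the sixth family, where \<open>p / q\<close> is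
  the argument of the arctangent or the artanh; so the zeros of the field are the
  points where the weight is undefined.\<close>

lemma pencil_inner_pencil:
  assumes "\<gamma> \<bullet> \<gamma> = 1"
  shows "pencil \<kappa> \<gamma> x \<bullet> pencil \<kappa> \<gamma> x = (\<kappa> - x \<bullet> x)\<^sup>2 + 4 * \<kappa> * (\<gamma> \<bullet> x)\<^sup>2"
  using assms
  by (simp add: pencil_def inner_expand inner_commute[of x \<gamma>] power2_eq_square algebra_simps)

lemma family_weight:
  fixes \<gamma> \<sigma> :: "'a::euclidean_space"
  assumes adm: "admissible \<gamma> \<sigma> s" and j: "j \<in> {1,2,3,4,5,6}"
  shows "weight_with_field (affine_family \<gamma> \<sigma> s j) (family_field \<gamma> \<sigma> s j)"
proof -
  have gg: "\<gamma> \<bullet> \<gamma> = 1" and ss: "\<sigma> \<bullet> \<sigma> = 1" and gs: "\<gamma> \<bullet> \<sigma> = 0" "\<sigma> \<bullet> \<gamma> = 0" and s: "s > 0"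
    using adm by (auto simp: admissible_def norm_eq_1 inner_commute)
  define r where "r = sqrt s"
  have r: "r > 0" "s = r * r" using s by (simp_all add: r_def)
  have inner_square: "((\<lambda>x. x \<bullet> x) has_derivative (\<lambda>v. 2 * (x \<bullet> v))) (at x)" for x :: 'a
    using has_derivative_inner[OF has_derivative_ident has_derivative_ident, of x UNIV] by (simp add: inner_commute)
  have inner_right: "((\<lambda>x. u \<bullet> x) has_derivative (\<lambda>v. u \<bullet> v)) (at x)" for u x :: 'a
    by (auto intro!: derivative_eq_intros)
  have continuous_pencil: "continuous_on UNIV (\<lambda>x. (1 / 2) *\<^sub>R pencil \<kappa> \<gamma> x)" for \<kappa>
    unfolding pencil_def by (intro continuous_intros)
  consider "j = 1" | "j = 2" | "j = 3" | "j = 4" | "j = 5" | "j = 6" using j by blast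
  then show ?thesis
  proof cases
    case 1
    have g0: "\<gamma> \<noteq> 0" using gg by auto
    have D: "((\<lambda>x. \<gamma> \<bullet> x) has_derivative (\<lambda>v. \<gamma> \<bullet> v / (\<gamma> \<bullet> \<gamma>))) (at x)" for x
      by (auto intro!: derivative_eq_intros simp: gg)
    have "affine_family \<gamma> \<sigma> s j x = (if \<gamma> = 0 then {} else {\<gamma> \<bullet> x})" for x
      using g0 by (simp add: 1 affine_family_def)
    moreover have "family_field \<gamma> \<sigma> s j = (\<lambda>x. \<gamma>)" by (simp add: 1 family_field_def fun_eq_iff)
    ultimately show ?thesis
      using single_valued_weight[of "affine_family \<gamma> \<sigma> s j" "\<lambda>x. \<gamma>", OF _ D] g0 by simp
  next
    case 2
    have D: "((\<lambda>x. ln (norm x)) has_derivative (\<lambda>v. x \<bullet> v / (x \<bullet> x))) (at x)" if "x \<noteq> 0" for x :: 'a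
    proof -
      have "x \<bullet> x > 0" using that by simp
      then have "(ln has_derivative (*) (1 / (x \<bullet> x))) (at (x \<bullet> x))"
        using DERIV_ln_divide[of "x \<bullet> x"] by (simp add: has_field_derivative_def)
      from has_derivative_mult_right[OF has_derivative_compose[OF inner_square this], of "1 / 2"]
      have "((\<lambda>x. ln (x \<bullet> x) / 2) has_derivative (\<lambda>v. x \<bullet> v / (x \<bullet> x))) (at x)" by simp
      moreover have "ln (x \<bullet> x) / 2 = ln (norm x)" if "x \<in> - {0}" for x :: 'a
        using that by (simp add: norm_eq_sqrt_inner ln_sqrt)
      ultimately show ?thesis
        using has_derivative_cong_open[of "- {0}" x "\<lambda>x. ln (x \<bullet> x) / 2" "\<lambda>x. ln (norm x)"] that by auto
    qed
    have "\<gamma> \<noteq> 0" using gg by auto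
    moreover have "affine_family \<gamma> \<sigma> s j x = (if x = 0 then {} else {ln (norm x)})" for x
      by (simp add: 2 affine_family_def)
    moreover have "family_field \<gamma> \<sigma> s j = (\<lambda>x. x)" by (simp add: 2 family_field_def fun_eq_iff)
    ultimately show ?thesis
      using single_valued_weight[of "affine_family \<gamma> \<sigma> s j" "\<lambda>x. x", OF _ D, of \<gamma>] by simp
  next
    case 3
    have XX: "rotation \<sigma> \<gamma> x \<bullet> rotation \<sigma> \<gamma> x = (\<gamma> \<bullet> x)\<^sup>2 + (\<sigma> \<bullet> x)\<^sup>2" for x
      by (simp add: rotation_def inner_expand gg ss gs power2_eq_square)
    have X0: "rotation \<sigma> \<gamma> x = 0 \<longleftrightarrow> \<gamma> \<bullet> x = 0 \<and> \<sigma> \<bullet> x = 0" for x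
      using XX[of x] by (metis inner_eq_zero_iff sum_power2_eq_zero_iff)
    have X: "rotation \<sigma> \<gamma> x \<bullet> v / (rotation \<sigma> \<gamma> x \<bullet> rotation \<sigma> \<gamma> x) =
        1 * (((\<sigma> \<bullet> x) * (\<gamma> \<bullet> v) - (\<gamma> \<bullet> x) * (\<sigma> \<bullet> v)) / ((\<gamma> \<bullet> x)\<^sup>2 + (\<sigma> \<bullet> x)\<^sup>2))" for x v
      unfolding XX by (simp add: rotation_def inner_expand)
    show ?thesis
      using arctan_weight[of "affine_family \<gamma> \<sigma> s j" 1 "\<lambda>x. \<gamma> \<bullet> x" "\<lambda>x. \<sigma> \<bullet> x" "\<lambda>x v. \<gamma> \<bullet> v" "\<lambda>x v. \<sigma> \<bullet> v"
          "rotation \<sigma> \<gamma>" \<sigma>, OF _ _ inner_right inner_right X0 X] ss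
      by (simp add: 3 affine_family_def family_field_def[abs_def])
  next
    case 4
    have XX: "((1 / 2) *\<^sub>R pencil 0 \<gamma> x) \<bullet> ((1 / 2) *\<^sub>R pencil 0 \<gamma> x) = (x \<bullet> x)\<^sup>2 / 4" for x
      using pencil_inner_pencil[OF gg, of 0 x] by simp
    have X0: "(1 / 2) *\<^sub>R pencil 0 \<gamma> x = 0 \<longleftrightarrow> x = 0" for x
      using XX[of x] by (metis inner_eq_zero_iff divide_eq_0_iff power2_eq_iff_nonneg zero_neq_numeral power_zero_numeral zero_eq_power2)
    have D: "((\<lambda>x. - 2 * ((\<gamma> \<bullet> x) / (norm x)\<^sup>2)) has_derivative
        (\<lambda>v. ((1 / 2) *\<^sub>R pencil 0 \<gamma> x) \<bullet> v / (((1 / 2) *\<^sub>R pencil 0 \<gamma> x) \<bullet> ((1 / 2) *\<^sub>R pencil 0 \<gamma> x)))) (at x)"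
      if "x \<noteq> 0" for x
    proof -
      define n where "n = x \<bullet> x"
      have n: "n \<noteq> 0" using that by (simp add: n_def)
      have "((\<lambda>x. - 2 * ((\<gamma> \<bullet> x) / (x \<bullet> x))) has_derivative
          (\<lambda>v. - 2 * (((\<gamma> \<bullet> v) * n - (\<gamma> \<bullet> x) * (2 * (x \<bullet> v))) / (n * n)))) (at x)"
        using n unfolding n_def
        by (intro has_derivative_mult_right has_derivative_divide' inner_right inner_square)
      moreover have "- 2 * (((\<gamma> \<bullet> v) * n - (\<gamma> \<bullet> x) * (2 * (x \<bullet> v))) / (n * n)) =
          ((1 / 2) *\<^sub>R pencil 0 \<gamma> x) \<bullet> v / (((1 / 2) *\<^sub>R pencil 0 \<gamma> x) \<bullet> ((1 / 2) *\<^sub>R pencil 0 \<gamma> x))" for v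
        unfolding XX using n by (simp add: pencil_def inner_expand flip: n_def) (simp add: field_simps power2_eq_square)
      ultimately show ?thesis by (simp add: power2_norm_eq_inner)
    qed
    have D': "((\<lambda>x. - 2 * ((\<gamma> \<bullet> x) / (norm x)\<^sup>2)) has_derivative
        (\<lambda>v. ((1 / 2) *\<^sub>R pencil 0 \<gamma> x) \<bullet> v / (((1 / 2) *\<^sub>R pencil 0 \<gamma> x) \<bullet> ((1 / 2) *\<^sub>R pencil 0 \<gamma> x)))) (at x)"
      if "(1 / 2) *\<^sub>R pencil 0 \<gamma> x \<noteq> 0" for x
      by (rule D) (use that X0 in blast)
    have fam: "affine_family \<gamma> \<sigma> s j x =
        (if (1 / 2) *\<^sub>R pencil 0 \<gamma> x = 0 then {} else {- 2 * ((\<gamma> \<bullet> x) / (norm x)\<^sup>2)})" for x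
      unfolding X0 by (simp add: 4 affine_family_def)
    have field: "family_field \<gamma> \<sigma> s j = (\<lambda>x. (1 / 2) *\<^sub>R pencil 0 \<gamma> x)"
      by (simp add: 4 family_field_def fun_eq_iff)
    have nz: "(1 / 2) *\<^sub>R pencil 0 \<gamma> \<gamma> \<noteq> 0" unfolding X0 using gg by auto
    show ?thesis unfolding field by (rule single_valued_weight[OF fam D' continuous_pencil nz])
  next
    case 5
    define p q where "p x = - 2 * (\<gamma> \<bullet> x) / r" and "q x = (x \<bullet> x) / s - 1" for x
    define X where "X x = (1 / 2) *\<^sub>R pencil s \<gamma> x" for x
    have XX: "X x \<bullet> X x = s\<^sup>2 / 4 * ((p x)\<^sup>2 + (q x)\<^sup>2)" for x
    proof -
      have *: "X x \<bullet> X x = ((s - x \<bullet> x)\<^sup>2 + 4 * s * (\<gamma> \<bullet> x)\<^sup>2) / 4"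
        using pencil_inner_pencil[OF gg, of s x] by (simp add: X_def)
      show ?thesis unfolding * p_def q_def r(2) using r(1)
        by (simp add: field_simps power2_eq_square)
    qed
    have X0: "X x = 0 \<longleftrightarrow> p x = 0 \<and> q x = 0" for x
    proof -
      have "X x = 0 \<longleftrightarrow> s\<^sup>2 / 4 * ((p x)\<^sup>2 + (q x)\<^sup>2) = 0" unfolding XX[symmetric] by simp
      then show ?thesis using s by (auto simp: sum_power2_eq_zero_iff)
    qed
    have P: "(p has_derivative (\<lambda>v. - 2 * (\<gamma> \<bullet> v) / r)) (at x)" for x
      unfolding p_def[abs_def] using r by (auto intro!: derivative_eq_intros)
    have Q: "(q has_derivative (\<lambda>v. 2 * (x \<bullet> v) / s)) (at x)" for x
      unfolding q_def[abs_def] using s by (auto intro!: derivative_eq_intros simp: inner_commute)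
    have Xv: "X x \<bullet> v / (X x \<bullet> X x) = (1 / r) * ((q x * (- 2 * (\<gamma> \<bullet> v) / r) - p x * (2 * (x \<bullet> v) / s)) / ((p x)\<^sup>2 + (q x)\<^sup>2))"
      if "X x \<noteq> 0" for x v
    proof -
      have nz: "(p x)\<^sup>2 + (q x)\<^sup>2 \<noteq> 0" using that X0[of x] by (simp add: sum_power2_eq_zero_iff)
      define M N where "M = q x * (- 2 * (\<gamma> \<bullet> v) / r) - p x * (2 * (x \<bullet> v) / s)" and "N = (p x)\<^sup>2 + (q x)\<^sup>2"
      have M: "(1 / r) * M = (4 / s\<^sup>2) * (X x \<bullet> v)"
        using r(1) unfolding M_def p_def q_def X_def r(2)
        by (simp add: pencil_def inner_expand field_simps power2_eq_square)
      have "(1 / r) * (M / N) = (4 / s\<^sup>2) * (X x \<bullet> v) / N" by (simp only: M times_divide_eq_right)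
      also have "\<dots> = X x \<bullet> v / (s\<^sup>2 / 4 * N)" using s nz by (simp add: N_def field_simps)
      finally show ?thesis unfolding XX M_def N_def by simp
    qed
    have "affine_family \<gamma> \<sigma> s j x = (\<lambda>t. 1 / r * t) ` arctan_values (p x) (q x)" for x
      by (simp add: 5 affine_family_def p_def q_def r_def power2_norm_eq_inner)
    moreover have "family_field \<gamma> \<sigma> s j = X" by (simp add: 5 family_field_def X_def fun_eq_iff)
    ultimately show ?thesis
      using arctan_weight[of "affine_family \<gamma> \<sigma> s j" "1 / r" p q, OF _ _ P Q X0 Xv, of 0] r(1)
      by (simp add: q_def)
  next
    case 6
    define p q where "p x = - 2 * (\<gamma> \<bullet> x) / r" and "q x = (x \<bullet> x) / s + 1" for x
    define X where "X x = (1 / 2) *\<^sub>R pencil (- s) \<gamma> x" for x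
    have q: "q x > 0" for x using s by (simp add: q_def add_nonneg_pos)
    have XX: "X x \<bullet> X x = s\<^sup>2 / 4 * ((q x)\<^sup>2 - (p x)\<^sup>2)" for x
    proof -
      have *: "X x \<bullet> X x = ((- s - x \<bullet> x)\<^sup>2 + 4 * (- s) * (\<gamma> \<bullet> x)\<^sup>2) / 4"
        using pencil_inner_pencil[OF gg, of "- s" x] by (simp add: X_def)
      show ?thesis unfolding * p_def q_def r(2) using r(1)
        by (simp add: field_simps power2_eq_square)
    qed
    have X0: "X x \<noteq> 0 \<longleftrightarrow> \<bar>p x / q x\<bar> < 1" for x
    proof -
      have "X x \<noteq> 0 \<longleftrightarrow> 0 < s\<^sup>2 / 4 * ((q x)\<^sup>2 - (p x)\<^sup>2)" unfolding XX[symmetric] by simp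
      also have "\<dots> \<longleftrightarrow> (p x)\<^sup>2 < (q x)\<^sup>2" using s by (simp add: zero_less_mult_iff)
      also have "\<dots> \<longleftrightarrow> \<bar>p x\<bar> < \<bar>q x\<bar>" by (simp add: abs_le_square_iff flip: not_le)
      also have "\<dots> \<longleftrightarrow> \<bar>p x / q x\<bar> < 1" using q[of x] by simp
      finally show ?thesis .
    qed
    have P: "(p has_derivative (\<lambda>v. - 2 * (\<gamma> \<bullet> v) / r)) (at x)" for x
      unfolding p_def[abs_def] using r by (auto intro!: derivative_eq_intros)
    have Q: "(q has_derivative (\<lambda>v. 2 * (x \<bullet> v) / s)) (at x)" for x
      unfolding q_def[abs_def] using s by (auto intro!: derivative_eq_intros simp: inner_commute)
    have D: "((\<lambda>x. 1 / r * artanh (p x / q x)) has_derivative (\<lambda>v. X x \<bullet> v / (X x \<bullet> X x))) (at x)"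
      if "X x \<noteq> 0" for x
    proof -
      have z: "\<bar>p x / q x\<bar> < 1" using that X0 by blast
      have "0 < s\<^sup>2 / 4 * ((q x)\<^sup>2 - (p x)\<^sup>2)" using that unfolding XX[symmetric] by simp
      then have nz: "(q x)\<^sup>2 - (p x)\<^sup>2 \<noteq> 0" by auto
      have dz: "((\<lambda>x. p x / q x) has_derivative
          (\<lambda>v. ((- 2 * (\<gamma> \<bullet> v) / r) * q x - p x * (2 * (x \<bullet> v) / s)) / (q x * q x))) (at x)"
        using q[of x] by (intro has_derivative_divide' P Q) simp
      have "(artanh has_derivative (*) (1 / (1 - (p x / q x)\<^sup>2))) (at (p x / q x))"
        using artanh_real_has_field_derivative[OF z, of UNIV] by (simp add: has_field_derivative_def)
      from has_derivative_mult_right[OF has_derivative_compose[OF dz this], of "1 / r"]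
      have "((\<lambda>x. 1 / r * artanh (p x / q x)) has_derivative (\<lambda>v. 1 / r * (1 / (1 - (p x / q x)\<^sup>2) *
          (((- 2 * (\<gamma> \<bullet> v) / r) * q x - p x * (2 * (x \<bullet> v) / s)) / (q x * q x))))) (at x)" .
      moreover have "1 / r * (1 / (1 - (p x / q x)\<^sup>2) *
          (((- 2 * (\<gamma> \<bullet> v) / r) * q x - p x * (2 * (x \<bullet> v) / s)) / (q x * q x))) = X x \<bullet> v / (X x \<bullet> X x)" for v
      proof -
        define M N where "M = (- 2 * (\<gamma> \<bullet> v) / r) * q x - p x * (2 * (x \<bullet> v) / s)" and "N = (q x)\<^sup>2 - (p x)\<^sup>2"
        have frac: "1 / (1 - (p x / q x)\<^sup>2) * (M / (q x * q x)) = M / N"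
          using q[of x] nz by (simp add: N_def field_simps power2_eq_square)
        have M: "(1 / r) * M = (4 / s\<^sup>2) * (X x \<bullet> v)"
          using r(1) unfolding M_def p_def q_def X_def r(2)
          by (simp add: pencil_def inner_expand field_simps power2_eq_square)
        have "1 / r * (1 / (1 - (p x / q x)\<^sup>2) * (M / (q x * q x))) = (1 / r * M) / N"
          by (simp only: frac) simp
        also have "\<dots> = (4 / s\<^sup>2) * (X x \<bullet> v) / N" by (simp only: M)
        also have "\<dots> = X x \<bullet> v / (s\<^sup>2 / 4 * N)" using s nz by (simp add: N_def field_simps)
        also have "\<dots> = X x \<bullet> v / (X x \<bullet> X x)" by (simp only: XX N_def)
        finally show ?thesis unfolding M_def .
      qed
      ultimately show ?thesis by simp
    qed
    have cont: "continuous_on UNIV X" unfolding X_def[abs_def] by (rule continuous_pencil)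
    have X1: "X 0 \<noteq> 0" using s gg by (auto simp: X_def pencil_def)
    have "affine_family \<gamma> \<sigma> s j x = (if X x = 0 then {} else {1 / r * artanh (p x / q x)})" for x
      using X0[of x] by (simp add: 6 affine_family_def p_def q_def r_def Let_def power2_norm_eq_inner)
    moreover have "family_field \<gamma> \<sigma> s j = X" by (simp add: 6 family_field_def X_def fun_eq_iff)
    ultimately show ?thesis
      using single_valued_weight[of "affine_family \<gamma> \<sigma> s j" X, OF _ D cont X1] by simp
  qed
qed

lemma family_field_kind:
  fixes \<gamma> \<sigma> :: "'a::euclidean_space"
  assumes "admissible \<gamma> \<sigma> s" "j \<in> {1,2,3,4,5,6}"
  shows "field_kind j (family_field \<gamma> \<sigma> s j)"
proof -
  have g: "\<gamma> \<noteq> 0" "\<sigma> \<noteq> 0" "\<sigma> \<bullet> \<gamma> = 0" "s > 0"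
    using assms(1) by (auto simp: admissible_def inner_commute)
  have pen: "field_kind (pencil_kind \<kappa>) (\<lambda>x. (1 / 2) *\<^sub>R pencil \<kappa> \<gamma> x)" for \<kappa>
  proof -
    have "(\<lambda>x. (1 / 2) *\<^sub>R pencil \<kappa> \<gamma> x) = (\<lambda>x. pencil \<kappa> ((1 / 2) *\<^sub>R \<gamma>) (x - 0))"
      by (simp add: fun_eq_iff pencil_def scaleR_add_right scaleR_diff_right)
    then show ?thesis using kind_pencil[of "(1 / 2) *\<^sub>R \<gamma>" \<kappa> 0] g(1) by simp
  qed
  consider "j = 1" | "j = 2" | "j = 3" | "j = 4" | "j = 5" | "j = 6" using assms(2) by blast
  then show ?thesis
  proof cases
    case 1
    then show ?thesis using kind_const[OF g(1)] by (simp add: family_field_def[abs_def])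
  next
    case 2
    then show ?thesis using kind_radial[of 1 "0::'a"] by (simp add: family_field_def[abs_def])
  next
    case 3
    then show ?thesis using kind_rotation[OF g(2,1,3), of 0] by (simp add: family_field_def[abs_def])
  qed (use pen[of 0] pen[of s] pen[of "- s"] g(4) in \<open>simp_all add: family_field_def[abs_def] pencil_kind_def\<close>)
qed

lemma rotation_scaleR: "rotation (a *\<^sub>R u) (b *\<^sub>R w) x = (a * b) *\<^sub>R rotation u w x"
  by (rule vector_eqI_inner) (simp add: rotation_def inner_expand algebra_simps)

lemma pencil_scaleR: "pencil \<kappa> (a *\<^sub>R b) x = a *\<^sub>R pencil \<kappa> b x"
  by (rule vector_eqI_inner) (simp add: pencil_def inner_expand algebra_simps)

text \<open>For the pencils \<open>s = |\<kappa>|\<close>, and for the other kinds \<open>s\<close> is arbitrary; likewise \<open>\<sigma>\<close> is any unit vector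
  orthogonal to \<open>\<gamma>\<close> except for rotations.\<close>

lemma field_kind_family:
  fixes X :: "'a::euclidean_space \<Rightarrow> 'a"
  assumes "field_kind j X" and dim: "DIM('a) \<ge> 2"
  shows "\<exists>\<gamma> \<sigma> s a p. admissible \<gamma> \<sigma> s \<and> a \<noteq> 0 \<and> (\<forall>x. X x = a *\<^sub>R family_field \<gamma> \<sigma> s j (x - p))"
proof -
  have adm: "\<exists>\<sigma>. admissible (c /\<^sub>R norm c) \<sigma> s" if "c \<noteq> 0" "s > 0" for c :: 'a and s
  proof -
    obtain y where "y \<noteq> 0" "orthogonal c y" using orthogonal_to_vector_exists[OF dim] by blast
    then have "admissible (c /\<^sub>R norm c) (y /\<^sub>R norm y) s"
      using that by (simp add: admissible_def orthogonal_def)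
    then show ?thesis by blast
  qed
  show ?thesis
    using assms(1)
  proof cases
    case (kind_const c)
    obtain \<sigma> where "admissible (c /\<^sub>R norm c) \<sigma> 1" using adm[OF kind_const(3), of 1] by auto
    moreover have "X x = norm c *\<^sub>R family_field (c /\<^sub>R norm c) \<sigma> 1 j (x - 0)" for x
      using kind_const by (simp add: family_field_def)
    ultimately show ?thesis using kind_const(3) norm_eq_zero by blast
  next
    case (kind_radial l p)
    obtain c :: 'a where "c \<noteq> 0" using nonempty_Basis nonzero_Basis by blast
    then obtain \<sigma> where "admissible (c /\<^sub>R norm c) \<sigma> 1" using adm[of c 1] by auto
    moreover have "X x = l *\<^sub>R family_field (c /\<^sub>R norm c) \<sigma> 1 j (x - p)" for x
      using kind_radial by (simp add: family_field_def)
    ultimately show ?thesis using kind_radial(3) by blast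
  next
    case (kind_rotation u w p)
    have "admissible (w /\<^sub>R norm w) (u /\<^sub>R norm u) 1"
      using kind_rotation by (simp add: admissible_def inner_commute)
    moreover have "X x = (norm u * norm w) *\<^sub>R family_field (w /\<^sub>R norm w) (u /\<^sub>R norm u) 1 j (x - p)" for x
    proof -
      have "norm u * norm w * (inverse (norm u) * inverse (norm w)) = 1"
        using kind_rotation by (simp add: field_simps)
      then show ?thesis using kind_rotation by (simp add: family_field_def rotation_scaleR)
    qed
    moreover have "norm u * norm w \<noteq> 0" using kind_rotation by simp
    ultimately show ?thesis by blast
  next
    case (kind_pencil b \<kappa> p)
    define s where "s = (if \<kappa> = 0 then 1 else \<bar>\<kappa>\<bar>)"
    have "s > 0" by (simp add: s_def)
    then obtain \<sigma> where "admissible (b /\<^sub>R norm b) \<sigma> s" using adm[OF kind_pencil(3)] by blast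
    moreover have "X x = (2 * norm b) *\<^sub>R family_field (b /\<^sub>R norm b) \<sigma> s j (x - p)" for x
      using kind_pencil by (simp add: family_field_def pencil_scaleR pencil_kind_def s_def)
    moreover have "2 * norm b \<noteq> 0" using kind_pencil by simp
    ultimately show ?thesis by blast
  qed
qed

lemma field_kind_quadratic_field:
  assumes "field_kind j X"
  shows "\<exists>c l u w b. X = quadratic_field c l u w b"
  using assms
proof cases
  case (kind_const c)
  have "X = quadratic_field c 0 0 0 0" by (simp add: kind_const quadratic_field_def rotation_def fun_eq_iff)
  then show ?thesis by blast
next
  case (kind_radial l p)
  have "X = quadratic_field (- l *\<^sub>R p) l 0 0 0"
    by (simp add: kind_radial quadratic_field_def rotation_def fun_eq_iff scaleR_diff_right)
  then show ?thesis by blast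
next
  case (kind_rotation u w p)
  have "X = quadratic_field (- rotation u w p) 0 u w 0"
    by (simp add: kind_rotation quadratic_field_def rotation_def fun_eq_iff algebra_simps)
  then show ?thesis by blast
next
  case (kind_pencil b \<kappa> p)
  have "X x = quadratic_field (\<kappa> *\<^sub>R b + (2 * (b \<bullet> p)) *\<^sub>R p - (p \<bullet> p) *\<^sub>R b) (- 2 * (b \<bullet> p)) b (- 2 *\<^sub>R p) b x" for x
    unfolding kind_pencil
    by (rule vector_eqI_inner)
      (simp add: quadratic_field_def pencil_def rotation_def inner_expand inner_commute algebra_simps)
  then show ?thesis by blast
qed

lemma LCW_if_field_kind:
  fixes \<phi> :: "'a::euclidean_space \<Rightarrow> real"
  assumes "open \<Omega>" "field_kind j X" "has_field \<Omega> \<phi> X"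
  shows "LCW \<Omega> \<phi>"
proof -
  obtain c l u w b where "X = quadratic_field c l u w b" using field_kind_quadratic_field[OF assms(2)] by blast
  then show ?thesis
    using LCW_if_field[OF assms(1,3)] smooth_field_quadratic_field[OF assms(1)] conformal_field_quadratic_field by blast
qed

lemma LCW_family:
  fixes \<gamma> \<sigma> :: "'a::euclidean_space"
  assumes "admissible \<gamma> \<sigma> s" "j \<in> {1,2,3,4,5,6}" "open \<Omega>" "branch_on \<Omega> (affine_family \<gamma> \<sigma> s j) \<phi>"
  shows "LCW \<Omega> \<phi>"
  using LCW_if_field_kind[OF assms(3) family_field_kind[OF assms(1,2)]] family_weight[OF assms(1,2)]
    assms(3,4) unfolding weight_with_field_def by blast

section \<open>Orbits under the affine conformal maps\<close>

lemma pullback_map_option [simp]: "pullback (map_option f) \<psi> = (\<lambda>x. \<psi> (f x))"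
  by (simp add: pullback_def fun_eq_iff)

lemma pullback_inverted_similarity:
  "pullback (inverted_similarity f p) \<psi> x = (if x + p = 0 then {} else \<psi> (f (vinv (x + p))))"
  by (simp add: pullback_def inverted_similarity_def)

lemma has_field_unique:
  assumes "has_field \<Omega> \<phi> X" "has_field \<Omega> \<phi> Y" "x \<in> \<Omega>"
  shows "X x = Y x"
proof -
  have "(\<lambda>v. X x \<bullet> v / (X x \<bullet> X x)) = (\<lambda>v. Y x \<bullet> v / (Y x \<bullet> Y x))"
    using assms has_derivative_unique unfolding has_field_def by blast
  then have "vinv (X x) \<bullet> v = vinv (Y x) \<bullet> v" for v
    by (auto simp: vinv_def divide_inverse mult.commute dest: fun_cong[of _ _ v])
  then have "vinv (X x) = vinv (Y x)" by (metis vector_eq_rdot)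
  then show ?thesis by (metis vinv_vinv)
qed

lemma has_field_translation:
  fixes \<phi> :: "'a::euclidean_space \<Rightarrow> real"
  assumes "has_field \<Omega> \<phi> X" "\<And>x. x \<in> \<Omega>' \<Longrightarrow> x + d \<in> \<Omega>"
  shows "has_field \<Omega>' (\<lambda>x. \<phi> (x + d)) (\<lambda>x. X (x + d))"
  using has_field_similarity[OF assms(1), of 1 "\<lambda>x. x" "\<lambda>x. x" \<Omega>' d] assms(2)
  by (simp add: orthogonal_transformation_id)

lemma field_kind_translation:
  fixes X :: "'a::euclidean_space \<Rightarrow> 'a"
  assumes "field_kind j X"
  shows "field_kind j (\<lambda>x. X (x + d))"
  using field_kind_similarity[OF assms, of 1 "\<lambda>x. x" "\<lambda>x. x" d]
  by (simp add: orthogonal_transformation_id)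

lemma has_field_cong_field:
  assumes "has_field \<Omega> \<phi> X" "\<And>x. x \<in> \<Omega> \<Longrightarrow> X x = Y x"
  shows "has_field \<Omega> \<phi> Y"
  using assms by (simp add: has_field_def)

text \<open>A branch of a pulled back family becomes a branch of the family itself after transport by the
  inverse similarity and rescaling; the field of the latter is known and is transported back.\<close>

lemma affine_branch_field:
  fixes \<gamma> \<sigma> :: "'a::euclidean_space"
  assumes adm: "admissible \<gamma> \<sigma> s" and j: "j \<in> {1,2,3,4,5,6}" and f: "similarity f" and a: "a \<noteq> 0"
    and op: "open \<Omega>" and br: "branch_on \<Omega> (rescale a b (\<lambda>x. affine_family \<gamma> \<sigma> s j (f x))) \<phi>"
  shows "\<exists>X. field_kind j X \<and> has_field \<Omega> \<phi> X"
proof -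
  obtain g where g: "similarity g" "\<And>x. f (g x) = x" "\<And>x. g (f x) = x"
    using similarity_inverse[OF f] by metis
  define \<Omega>' \<phi>' where "\<Omega>' = {y. g y \<in> \<Omega>}" and "\<phi>' y = (\<phi> (g y) - b) / a" for y
  have op': "open \<Omega>'" unfolding \<Omega>'_def by (rule open_similarity_vimage[OF g(1) op])
  have "branch_on \<Omega>' (affine_family \<gamma> \<sigma> s j) \<phi>'"
    unfolding branch_on_def
  proof
    have "continuous_on \<Omega> \<phi>" using br by (simp add: branch_on_def)
    then have "continuous_on \<Omega>' (\<lambda>y. \<phi> (g y))"
      by (rule continuous_on_compose2[OF _ similarity_continuous[OF g(1)]]) (auto simp: \<Omega>'_def)
    then show "continuous_on \<Omega>' \<phi>'" unfolding \<phi>'_def using a by (intro continuous_intros) auto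
    show "\<forall>y\<in>\<Omega>'. \<phi>' y \<in> affine_family \<gamma> \<sigma> s j y"
    proof
      fix y assume "y \<in> \<Omega>'"
      then have "\<phi> (g y) \<in> rescale a b (\<lambda>x. affine_family \<gamma> \<sigma> s j (f x)) (g y)"
        using br by (simp add: branch_on_def \<Omega>'_def)
      then have "\<phi> (g y) \<in> (\<lambda>t. a * t + b) ` affine_family \<gamma> \<sigma> s j y"
        by (simp add: rescale_def g(2))
      then show "\<phi>' y \<in> affine_family \<gamma> \<sigma> s j y" using a by (auto simp: \<phi>'_def)
    qed
  qed
  then have F: "has_field \<Omega>' \<phi>' (family_field \<gamma> \<sigma> s j)" using family_weight[OF adm j] op' unfolding weight_with_field_def by blast
  obtain r A B d where r: "r > 0" and A: "orthogonal_transformation A" and B: "orthogonal_transformation B"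
    and fx: "\<And>x. f x = r *\<^sub>R A x + d" and AB: "\<And>x. A (B x) = x" "\<And>x. B (A x) = x"
    and adj: "\<And>x y. B x \<bullet> y = x \<bullet> A y"
    using similarity_data[OF f] by blast
  let ?Y = "\<lambda>x. B (family_field \<gamma> \<sigma> s j (r *\<^sub>R A x + d)) /\<^sub>R r"
  have "has_field \<Omega> (\<lambda>x. \<phi>' (r *\<^sub>R A x + d)) ?Y"
    by (rule has_field_similarity[OF F r A AB(1)]) (simp add: \<Omega>'_def g(3) flip: fx)
  then have "has_field \<Omega> (\<lambda>x. \<phi>' (f x)) ?Y" by (simp add: fx)
  from has_field_rescale[OF this a, of b]
  have "has_field \<Omega> \<phi> (\<lambda>x. ?Y x /\<^sub>R a)" using a by (simp add: \<phi>'_def g(3))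
  moreover have "field_kind j (\<lambda>x. ?Y x /\<^sub>R a)"
    by (rule field_kind_rescale[OF field_kind_similarity[OF family_field_kind[OF adm j] r A B AB adj] a])
  ultimately show ?thesis by blast
qed

text \<open>The family absorbs directions and sizes in its parameters, so a translation suffices as similarity.\<close>

lemma field_affine_branch:
  fixes X :: "'a::euclidean_space \<Rightarrow> 'a"
  assumes kind: "field_kind j X" and dim: "DIM('a) \<ge> 2" and op: "open \<Omega>" and con: "connected \<Omega>"
    and F: "has_field \<Omega> \<phi> X"
  shows "\<exists>\<gamma> \<sigma> s f a b. admissible \<gamma> \<sigma> s \<and> similarity f \<and> a \<noteq> 0 \<and>
    branch_on \<Omega> (rescale a b (\<lambda>x. affine_family \<gamma> \<sigma> s j (f x))) \<phi>"
proof -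
  obtain \<gamma> \<sigma> s a p where adm: "admissible \<gamma> \<sigma> s" and a: "a \<noteq> 0"
    and X: "\<And>x. X x = a *\<^sub>R family_field \<gamma> \<sigma> s j (x - p)"
    using field_kind_family[OF kind dim] by blast
  have j: "j \<in> {1,2,3,4,5,6}" by (rule field_kind_invariants(4)[OF kind])
  define \<Omega>' where "\<Omega>' = {y. y + p \<in> \<Omega>}"
  have op': "open \<Omega>'" unfolding \<Omega>'_def by (rule open_similarity_vimage[OF similarity_translation op])
  have "\<Omega>' = (\<lambda>x. x - p) ` \<Omega>"
    unfolding \<Omega>'_def by (auto simp: image_iff algebra_simps intro!: bexI[of _ "_ + p"])
  then have con': "connected \<Omega>'" using con by (auto intro!: connected_continuous_image continuous_intros)
  have "has_field \<Omega>' (\<lambda>y. \<phi> (y + p)) (\<lambda>y. X (y + p))"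
    by (rule has_field_translation[OF F]) (simp add: \<Omega>'_def)
  from has_field_rescale[OF this a, of 0]
  have "has_field \<Omega>' (\<lambda>y. a * \<phi> (y + p)) (family_field \<gamma> \<sigma> s j)" using a by (simp add: X)
  then obtain \<beta> where br: "branch_on \<Omega>' (rescale 1 \<beta> (affine_family \<gamma> \<sigma> s j)) (\<lambda>y. a * \<phi> (y + p))"
    using family_weight[OF adm j] op' con' unfolding weight_with_field_def by blast
  have "branch_on \<Omega> (rescale (1 / a) (\<beta> / a) (\<lambda>x. affine_family \<gamma> \<sigma> s j (x + (- p)))) \<phi>"
    unfolding branch_on_def
  proof
    show "continuous_on \<Omega> \<phi>" by (rule has_field_continuous[OF F])
    show "\<forall>x\<in>\<Omega>. \<phi> x \<in> rescale (1 / a) (\<beta> / a) (\<lambda>x. affine_family \<gamma> \<sigma> s j (x + (- p))) x"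
    proof
      fix x assume "x \<in> \<Omega>"
      then have "x - p \<in> \<Omega>'" by (simp add: \<Omega>'_def)
      then have "a * \<phi> x \<in> (\<lambda>t. 1 * t + \<beta>) ` affine_family \<gamma> \<sigma> s j (x - p)"
        using br by (auto simp: branch_on_def rescale_def)
      then obtain t where t: "t \<in> affine_family \<gamma> \<sigma> s j (x - p)" "a * \<phi> x = t + \<beta>" by auto
      then have "\<phi> x = 1 / a * t + \<beta> / a" using a by (simp add: field_simps)
      then show "\<phi> x \<in> rescale (1 / a) (\<beta> / a) (\<lambda>x. affine_family \<gamma> \<sigma> s j (x + (- p))) x"
        using t(1) unfolding rescale_def by (intro image_eqI[of _ _ t]) simp_all
    qed
  qed
  moreover have "similarity (\<lambda>x. x + (- p))" by (rule similarity_translation)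
  moreover have "1 / a \<noteq> 0" using a by simp
  ultimately show ?thesis using adm by blast
qed

lemma reflection_onto:
  fixes x y :: "'a::euclidean_space"
  assumes "norm x = norm y"
  obtains A where "orthogonal_transformation A" "A x = y" "\<And>z. z \<bullet> (x - y) = 0 \<Longrightarrow> A z = z"
proof
  let ?A = "\<lambda>z. z - (2 * ((x - y) \<bullet> z) / ((x - y) \<bullet> (x - y))) *\<^sub>R (x - y)"
  show "orthogonal_transformation ?A" by (rule orthogonal_transformation_reflection)
  show "?A z = z" if "z \<bullet> (x - y) = 0" for z using that by (simp add: inner_commute)
  show "?A x = y"
  proof (cases "x = y")
    case False
    have "2 * ((x - y) \<bullet> x) = (x - y) \<bullet> (x - y)"
      using assms by (simp add: norm_eq inner_expand inner_commute)
    then show ?thesis using False by simp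
  qed simp
qed

text \<open>Two reflections suffice: the second one moves the image of \<open>\<sigma>'\<close> to \<open>\<sigma>\<close>, and it fixes \<open>\<gamma>\<close>
  because both vectors are orthogonal to \<open>\<gamma>\<close>.\<close>

lemma orthonormal_pair_map:
  fixes \<gamma> \<sigma> \<gamma>' \<sigma>' :: "'a::euclidean_space"
  assumes "norm \<gamma> = 1" "norm \<sigma> = 1" "\<gamma> \<bullet> \<sigma> = 0" "norm \<gamma>' = 1" "norm \<sigma>' = 1" "\<gamma>' \<bullet> \<sigma>' = 0"
  obtains A where "orthogonal_transformation A" "A \<gamma>' = \<gamma>" "A \<sigma>' = \<sigma>"
proof -
  obtain A1 where A1: "orthogonal_transformation A1" "A1 \<gamma>' = \<gamma>"
    using reflection_onto[of \<gamma>' \<gamma>] assms by metis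
  have "norm (A1 \<sigma>') = norm \<sigma>" using A1(1) assms by (simp add: orthogonal_transformation_norm)
  then obtain A2 where A2: "orthogonal_transformation A2" "A2 (A1 \<sigma>') = \<sigma>"
    "\<And>z. z \<bullet> (A1 \<sigma>' - \<sigma>) = 0 \<Longrightarrow> A2 z = z"
    using reflection_onto by metis
  have "\<gamma> \<bullet> A1 \<sigma>' = 0" using A1 assms(6) by (metis orthogonal_transformation_def)
  then have "A2 \<gamma> = \<gamma>" using assms(3) by (intro A2(3)) (simp add: inner_diff_right)
  then show thesis
    using that[of "A2 \<circ> A1"] orthogonal_transformation_compose[OF A2(1) A1(1)] A1(2) A2(2) by simp
qed

text \<open>An orthogonal map aligns \<open>\<gamma>\<close> and \<open>\<sigma>\<close>, and a dilation matches \<open>s\<close> in the last two families.\<close>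

lemma affine_family_orbit:
  fixes \<gamma> \<sigma> \<gamma>' \<sigma>' :: "'a::euclidean_space"
  assumes adm: "admissible \<gamma> \<sigma> s" and adm': "admissible \<gamma>' \<sigma>' s'" and j: "j \<in> {1,2,3,4,5,6}"
  shows "\<exists>f a b. similarity f \<and> a \<noteq> 0 \<and> affine_family \<gamma>' \<sigma>' s' j = rescale a b (\<lambda>x. affine_family \<gamma> \<sigma> s j (f x))"
proof -
  obtain A where A: "orthogonal_transformation A" "A \<gamma>' = \<gamma>" "A \<sigma>' = \<sigma>"
    using orthonormal_pair_map[of \<gamma> \<sigma> \<gamma>' \<sigma>'] adm adm' by (auto simp: admissible_def)
  have g: "\<gamma> \<bullet> A x = \<gamma>' \<bullet> x" "\<sigma> \<bullet> A x = \<sigma>' \<bullet> x" for x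
    using A by (metis orthogonal_transformation_def)+
  have n: "norm (A x) = norm x" for x using A(1) by (rule orthogonal_transformation_norm)
  have A0: "A x = 0 \<longleftrightarrow> x = 0" for x by (metis n norm_eq_zero)
  have s: "s > 0" "s' > 0" using adm adm' by (simp_all add: admissible_def)
  show ?thesis
  proof (cases "j < 5")
    case True
    have "affine_family \<gamma>' \<sigma>' s' j x = rescale 1 0 (\<lambda>x. affine_family \<gamma> \<sigma> s j (A x)) x" for x
      using True j by (simp add: affine_family_def rescale_def g n A0)
    then have "affine_family \<gamma>' \<sigma>' s' j = rescale 1 0 (\<lambda>x. affine_family \<gamma> \<sigma> s j (A x))" by (rule ext)
    moreover have "similarity A" "(1::real) \<noteq> 0" using similarity_orthogonal[OF A(1)] by simp_all
    ultimately show ?thesis by blast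
  next
    case False
    \<comment> \<open>the dilation for which \<open>|k x|\<^sup>2 / s = |x|\<^sup>2 / s'\<close>\<close>
    define k where "k = sqrt s / sqrt s'"
    have k: "k > 0" using s by (simp add: k_def)
    have sim: "similarity (\<lambda>x. k *\<^sub>R A x)" using similarityI[OF k A(1), of 0] by simp
    have p: "- 2 * (\<gamma> \<bullet> (k *\<^sub>R A x)) / sqrt s = - 2 * (\<gamma>' \<bullet> x) / sqrt s'" for x
      using s by (simp add: g k_def)
    have q: "(norm (k *\<^sub>R A x))\<^sup>2 / s = (norm x)\<^sup>2 / s'" for x
      using s by (simp add: n k_def power_mult_distrib power_divide)
    have kt: "k * t / sqrt s = t / sqrt s'" for t using s by (simp add: k_def)
    have "affine_family \<gamma>' \<sigma>' s' j x = rescale k 0 (\<lambda>x. affine_family \<gamma> \<sigma> s j (k *\<^sub>R A x)) x" for x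
    proof -
      consider "j = 5" | "j = 6" using j False by auto
      then show ?thesis
      proof cases
        case 1
        then show ?thesis unfolding affine_family_def rescale_def p q by (simp add: image_image kt)
      next
        case 2
        then show ?thesis unfolding affine_family_def rescale_def p q by (simp add: Let_def kt)
      qed
    qed
    then have "affine_family \<gamma>' \<sigma>' s' j = rescale k 0 (\<lambda>x. affine_family \<gamma> \<sigma> s j (k *\<^sub>R A x))" by (rule ext)
    moreover have "k \<noteq> 0" using k by simp
    ultimately show ?thesis using sim by blast
  qed
qed

section \<open>Orbits under all conformal maps\<close>

lemma psi_eq_affine_family: "i \<in> {1,2,3} \<Longrightarrow> psi e1 e2 i = affine_family e1 e2 s i"
  by (auto simp: psi_def affine_family_def fun_eq_iff)

text \<open>When \<open>F\<close> has a finite pole, the weight is transported by the inversion centred at the pole.  It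
  becomes a branch of an affine pullback of \<open>\<psi>\<close>, so its field has kind \<open>i\<close>; inverting back yields a
  kind of the same class.\<close>

lemma conformal_branch_field:
  fixes e1 e2 :: "'a::euclidean_space"
  assumes F: "F \<in> conformal_maps" and adm: "admissible e1 e2 1" and i: "i \<in> {1,2,3}" and a: "a \<noteq> 0"
    and op: "open \<Omega>" and br: "branch_on \<Omega> (rescale a b (pullback F (psi e1 e2 i))) \<phi>"
  shows "\<exists>j X. field_kind j X \<and> weight_class j = i \<and> has_field \<Omega> \<phi> X"
proof -
  have i6: "i \<in> {1,2,3,4,5,6}" "i < 4" using i by auto
  note psi = psi_eq_affine_family[OF i, of e1 e2 1]
  consider f where "similarity f" "F = map_option f"
    | f p where "similarity f" "F = inverted_similarity f p"
    using normal_form_cases[OF conformal_maps_normal_form[OF F]] by blast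
  then show ?thesis
  proof cases
    case 1
    then obtain X where "field_kind i X" "has_field \<Omega> \<phi> X"
      using affine_branch_field[OF adm i6(1) 1(1) a op, of b \<phi>] br by (auto simp: psi)
    moreover have "weight_class i = i" using i by (auto simp: weight_class_def)
    ultimately show ?thesis by blast
  next
    case 2
    define \<Omega>1 where "\<Omega>1 = {x. x + (- p) \<in> \<Omega>}"
    define \<Omega>' where "\<Omega>' = {y. y \<noteq> 0 \<and> vinv y \<in> \<Omega>1}"
    define \<phi>' where "\<phi>' y = \<phi> (vinv y + (- p))" for y
    have op1: "open \<Omega>1" unfolding \<Omega>1_def by (rule open_similarity_vimage[OF similarity_translation op])
    have op': "open \<Omega>'" unfolding \<Omega>'_def by (rule open_vinv_vimage[OF op1])
    have "branch_on \<Omega>' (rescale a b (\<lambda>y. affine_family e1 e2 1 i (f y))) \<phi>'"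
      unfolding branch_on_def
    proof
      have "continuous_on \<Omega>' (\<lambda>y. vinv y + (- p))"
        unfolding vinv_def by (intro continuous_intros) (auto simp: \<Omega>'_def)
      moreover have "continuous_on \<Omega> \<phi>" using br by (simp add: branch_on_def)
      ultimately show "continuous_on \<Omega>' \<phi>'"
        unfolding \<phi>'_def using continuous_on_compose2[of \<Omega> \<phi> \<Omega>' "\<lambda>y. vinv y + (- p)"]
        by (force simp: \<Omega>'_def \<Omega>1_def)
      show "\<forall>y\<in>\<Omega>'. \<phi>' y \<in> rescale a b (\<lambda>y. affine_family e1 e2 1 i (f y)) y"
      proof
        fix y assume y: "y \<in> \<Omega>'"
        then have "\<phi>' y \<in> rescale a b (pullback F (psi e1 e2 i)) (vinv y + (- p))"
          using br by (simp add: branch_on_def \<Omega>'_def \<Omega>1_def \<phi>'_def)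
        then show "\<phi>' y \<in> rescale a b (\<lambda>y. affine_family e1 e2 1 i (f y)) y"
          using y unfolding 2(2) rescale_def pullback_inverted_similarity by (simp add: psi \<Omega>'_def)
      qed
    qed
    then obtain X where X: "field_kind i X" "has_field \<Omega>' \<phi>' X"
      using affine_branch_field[OF adm i6(1) 2(1) a op'] by blast
    obtain j Y where Y: "field_kind j Y" "weight_class j = i" "\<And>x. x \<noteq> 0 \<Longrightarrow> inverted_field X x = Y x"
      using inverted_field_kind[OF X(1) i6(2)] by blast
    have nz: "x \<noteq> 0" if "x \<in> \<Omega>1" for x
    proof
      assume "x = 0"
      have "\<phi> (x + (- p)) \<in> rescale a b (pullback F (psi e1 e2 i)) (x + (- p))"
        using br that by (simp add: branch_on_def \<Omega>1_def)
      then show False unfolding 2(2) rescale_def pullback_inverted_similarity by (simp add: \<open>x = 0\<close>)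
    qed
    have "has_field \<Omega>1 (\<lambda>x. \<phi>' (vinv x)) (inverted_field X)"
      by (rule has_field_inversion[OF X(2)]) (use nz in \<open>simp add: \<Omega>'_def\<close>)
    then have "has_field \<Omega>1 (\<lambda>x. \<phi> (x + (- p))) Y"
      using has_field_cong_field[OF _ Y(3)[OF nz]] by (simp add: \<phi>'_def)
    from has_field_translation[OF this, of \<Omega> p]
    have "has_field \<Omega> \<phi> (\<lambda>x. Y (x + p))" by (simp add: \<Omega>1_def)
    then show ?thesis using field_kind_translation[OF Y(1)] Y(2) by blast
  qed
qed

lemma field_psi_branch:
  fixes X :: "'a::euclidean_space \<Rightarrow> 'a"
  assumes kind: "field_kind i X" and i: "i \<in> {1,2,3}" and dim: "DIM('a) \<ge> 2" and adm: "admissible e1 e2 1"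
    and op: "open \<Omega>" and con: "connected \<Omega>" and F: "has_field \<Omega> \<phi> X"
  shows "\<exists>f a b. similarity f \<and> a \<noteq> 0 \<and> branch_on \<Omega> (rescale a b (\<lambda>x. psi e1 e2 i (f x))) \<phi>"
proof -
  obtain \<gamma> \<sigma> s f a b where 1: "admissible \<gamma> \<sigma> s" "similarity f" "a \<noteq> 0"
    "branch_on \<Omega> (rescale a b (\<lambda>x. affine_family \<gamma> \<sigma> s i (f x))) \<phi>"
    using field_affine_branch[OF kind dim op con F] by blast
  have "i \<in> {1,2,3,4,5,6}" using i by auto
  then obtain g c d where 2: "similarity g" "c \<noteq> 0"
    "affine_family \<gamma> \<sigma> s i = rescale c d (\<lambda>x. affine_family e1 e2 1 i (g x))"
    using affine_family_orbit[OF adm 1(1)] by blast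
  have "rescale a b (\<lambda>x. affine_family \<gamma> \<sigma> s i (f x)) = rescale (a * c) (a * d + b) (\<lambda>x. psi e1 e2 i (g (f x)))"
    unfolding 2(3) psi_eq_affine_family[OF i, of e1 e2 1]
    by (simp add: rescale_def fun_eq_iff image_image algebra_simps)
  then have "branch_on \<Omega> (rescale (a * c) (a * d + b) (\<lambda>x. psi e1 e2 i (g (f x)))) \<phi>" using 1(4) by simp
  moreover have "similarity (\<lambda>x. g (f x))" "a * c \<noteq> 0" using similarity_comp[OF 2(1) 1(2)] 1(3) 2(2) by simp_all
  ultimately show ?thesis by blast
qed

text \<open>For the pencils, the inversion centred at a zero \<open>z\<close> of the field reduces to the first three kinds.
  The zero does not lie in \<open>\<Omega>\<close>, where the field has no zeros, so the transported domain is again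
  open and connected.\<close>

lemma field_conformal_branch:
  fixes X :: "'a::euclidean_space \<Rightarrow> 'a"
  assumes kind: "field_kind j X" and dim: "DIM('a) \<ge> 2" and adm: "admissible e1 e2 1"
    and op: "open \<Omega>" and con: "connected \<Omega>" and F: "has_field \<Omega> \<phi> X"
  shows "\<exists>F\<in>conformal_maps. \<exists>a b. a \<noteq> 0 \<and>
    branch_on \<Omega> (rescale a b (pullback F (psi e1 e2 (weight_class j)))) \<phi>"
proof (cases "j < 4")
  case True
  then have j: "j \<in> {1,2,3}" "weight_class j = j"
    using field_kind_invariants(4)[OF kind] by (auto simp: weight_class_def)
  obtain f a b where "similarity f" "a \<noteq> 0" "branch_on \<Omega> (rescale a b (\<lambda>x. psi e1 e2 j (f x))) \<phi>"
    using field_psi_branch[OF kind j(1) dim adm op con F] by blast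
  moreover from this have "map_option f \<in> conformal_maps"
    using affine_subset_conformal unfolding affine_conformal_maps_eq by blast
  ultimately show ?thesis unfolding j(2) by (intro bexI[of _ "map_option f"]) auto
next
  case False
  then have "j \<ge> 4" by simp
  then obtain \<beta> \<kappa> q where X: "\<beta> \<noteq> 0" "j = pencil_kind \<kappa>" "X = (\<lambda>x. pencil \<kappa> \<beta> (x - q))"
    using field_kind_invariants(5)[OF kind] by blast
  have i: "weight_class j \<in> {1,2,3}" by (simp add: X(2) pencil_kind_def weight_class_def)
  obtain z Y where Y: "field_kind (weight_class j) Y" "X z = 0"
    "\<And>x. x \<noteq> 0 \<Longrightarrow> inverted_field (\<lambda>x. X (x + z)) x = Y x"
    using inverted_pencil[OF dim X(1), of \<kappa> q] unfolding X(2,3) by blast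
  define \<Omega>1 where "\<Omega>1 = {x. x + z \<in> \<Omega>}"
  define \<Omega>' where "\<Omega>' = {y. y \<noteq> 0 \<and> vinv y \<in> \<Omega>1}"
  define \<phi>' where "\<phi>' y = \<phi> (vinv y + z)" for y
  have nz: "x \<noteq> z" if "x \<in> \<Omega>" for x using F Y(2) that by (auto simp: has_field_def)
  have op1: "open \<Omega>1" unfolding \<Omega>1_def by (rule open_similarity_vimage[OF similarity_translation op])
  have op': "open \<Omega>'" unfolding \<Omega>'_def by (rule open_vinv_vimage[OF op1])
  have img: "vinv (x - z) \<in> \<Omega>'" if "x \<in> \<Omega>" for x using nz[OF that] that by (simp add: \<Omega>'_def \<Omega>1_def)
  have "y \<in> (\<lambda>x. vinv (x - z)) ` \<Omega>" if "y \<in> \<Omega>'" for y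
    using that by (intro image_eqI[of _ _ "vinv y + z"]) (auto simp: \<Omega>'_def \<Omega>1_def)
  then have "\<Omega>' = (\<lambda>x. vinv (x - z)) ` \<Omega>" using img by blast
  moreover have "continuous_on \<Omega> (\<lambda>x. vinv (x - z))"
    unfolding vinv_def using nz by (intro continuous_intros) auto
  ultimately have con': "connected \<Omega>'" using connected_continuous_image[OF _ con] by simp
  have "has_field \<Omega>1 (\<lambda>x. \<phi> (x + z)) (\<lambda>x. X (x + z))"
    by (rule has_field_translation[OF F]) (simp add: \<Omega>1_def)
  then have "has_field \<Omega>' \<phi>' (inverted_field (\<lambda>x. X (x + z)))"
    unfolding \<phi>'_def by (rule has_field_inversion) (simp add: \<Omega>'_def)
  then have F': "has_field \<Omega>' \<phi>' Y"
    by (rule has_field_cong_field) (use Y(3) in \<open>simp add: \<Omega>'_def\<close>)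
  obtain f a b where f: "similarity f" "a \<noteq> 0" "branch_on \<Omega>' (rescale a b (\<lambda>x. psi e1 e2 (weight_class j) (f x))) \<phi>'"
    using field_psi_branch[OF Y(1) i dim adm op' con' F'] by blast
  have "branch_on \<Omega> (rescale a b (pullback (inverted_similarity f (- z)) (psi e1 e2 (weight_class j)))) \<phi>"
    unfolding branch_on_def
  proof
    show "continuous_on \<Omega> \<phi>" by (rule has_field_continuous[OF F])
    show "\<forall>x\<in>\<Omega>. \<phi> x \<in> rescale a b (pullback (inverted_similarity f (- z)) (psi e1 e2 (weight_class j))) x"
    proof
      fix x assume x: "x \<in> \<Omega>"
      have "\<phi>' (vinv (x - z)) \<in> rescale a b (\<lambda>x. psi e1 e2 (weight_class j) (f x)) (vinv (x - z))"
        using f(3) img[OF x] by (simp add: branch_on_def)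
      then show "\<phi> x \<in> rescale a b (pullback (inverted_similarity f (- z)) (psi e1 e2 (weight_class j))) x"
        using nz[OF x] unfolding rescale_def pullback_inverted_similarity by (simp add: \<phi>'_def)
    qed
  qed
  then show ?thesis using inverted_similarity_conformal[OF f(1)] f(2) by blast
qed

lemma LCW_conformal_orbit:
  fixes \<phi> :: "'a::euclidean_space \<Rightarrow> real"
  assumes dim: "DIM('a) \<ge> 3" and adm: "admissible e1 e2 1"
    and LCW: "LCW \<Omega> \<phi>" and con: "connected \<Omega>" and ne: "\<Omega> \<noteq> {}"
  shows "\<exists>!i. i \<in> {1,2,3} \<and> (\<exists>F\<in>conformal_maps. \<exists>a b. a \<noteq> 0 \<and>
    branch_on \<Omega> (rescale a b (pullback F (psi e1 e2 i))) \<phi>)"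
    (is "\<exists>!i. _ \<and> ?P i")
proof -
  have op: "open \<Omega>" using LCW by (simp add: LCW_def)
  obtain j X where X: "field_kind j X" "has_field \<Omega> \<phi> X"
    using LCW_field_kind[OF dim LCW con ne] by blast
  have dim2: "DIM('a) \<ge> 2" using dim by simp
  have j: "weight_class j \<in> {1,2,3}" using field_kind_invariants(4)[OF X(1)] by (auto simp: weight_class_def)
  show ?thesis
  proof (rule ex1I[of _ "weight_class j"])
    show "weight_class j \<in> {1,2,3} \<and> ?P (weight_class j)"
      using j field_conformal_branch[OF X(1) dim2 adm op con X(2)] by blast
    fix i assume "i \<in> {1,2,3} \<and> ?P i"
    then obtain F a b where i: "i \<in> {1,2,3}" "F \<in> conformal_maps" "a \<noteq> 0"
      "branch_on \<Omega> (rescale a b (pullback F (psi e1 e2 i))) \<phi>" by blast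
    obtain k Y where Y: "field_kind k Y" "weight_class k = i" "has_field \<Omega> \<phi> Y"
      using conformal_branch_field[OF i(2) adm i(1,3) op i(4)] by blast
    have "j = k"
      by (rule field_kind_unique[OF X(1) Y(1) op ne]) (rule has_field_unique[OF X(2) Y(3)])
    then show "i = weight_class j" using Y(2) by simp
  qed
qed

lemma LCW_affine_orbit:
  fixes \<phi> :: "'a::euclidean_space \<Rightarrow> real"
  assumes dim: "DIM('a) \<ge> 3" and LCW: "LCW \<Omega> \<phi>" and con: "connected \<Omega>" and ne: "\<Omega> \<noteq> {}"
  shows "\<exists>!j. j \<in> {1,2,3,4,5,6} \<and> (\<exists>\<gamma> \<sigma> s. admissible \<gamma> \<sigma> s \<and>
    (\<exists>F\<in>affine_conformal_maps. \<exists>a b. a \<noteq> 0 \<and>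
      branch_on \<Omega> (rescale a b (pullback F (affine_family \<gamma> \<sigma> s j))) \<phi>))"
    (is "\<exists>!j. _ \<and> ?P j")
proof -
  have op: "open \<Omega>" using LCW by (simp add: LCW_def)
  obtain j X where X: "field_kind j X" "has_field \<Omega> \<phi> X"
    using LCW_field_kind[OF dim LCW con ne] by blast
  have dim2: "DIM('a) \<ge> 2" using dim by simp
  show ?thesis
  proof (rule ex1I[of _ j])
    obtain \<gamma> \<sigma> s f a b where "admissible \<gamma> \<sigma> s" "similarity f" "a \<noteq> 0"
      "branch_on \<Omega> (rescale a b (\<lambda>x. affine_family \<gamma> \<sigma> s j (f x))) \<phi>"
      using field_affine_branch[OF X(1) dim2 op con X(2)] by blast
    moreover from this have "map_option f \<in> affine_conformal_maps" unfolding affine_conformal_maps_eq by blast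
    ultimately have "?P j"
      by (intro exI[of _ \<gamma>] exI[of _ \<sigma>] exI[of _ s] conjI bexI[of _ "map_option f"] exI[of _ a] exI[of _ b]) simp_all
    then show "j \<in> {1,2,3,4,5,6} \<and> ?P j"
      using field_kind_invariants(4)[OF X(1)] by blast
    fix k assume "k \<in> {1,2,3,4,5,6} \<and> ?P k"
    then obtain \<gamma>' \<sigma>' s' F a' b' where k: "k \<in> {1,2,3,4,5,6}" "admissible \<gamma>' \<sigma>' s'" "F \<in> affine_conformal_maps"
      "a' \<noteq> 0" "branch_on \<Omega> (rescale a' b' (pullback F (affine_family \<gamma>' \<sigma>' s' k))) \<phi>" by blast
    obtain f' where f': "similarity f'" "F = map_option f'"
      using k(3) unfolding affine_conformal_maps_eq by blast
    obtain Y where Y: "field_kind k Y" "has_field \<Omega> \<phi> Y"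
      using affine_branch_field[OF k(2,1) f'(1) k(4) op, of b' \<phi>] k(5) by (auto simp: f'(2))
    show "k = j"
      by (rule field_kind_unique[OF Y(1) X(1) op ne]) (rule has_field_unique[OF Y(2) X(2)])
  qed
qed

lemma affine_family_orbit_map:
  fixes \<gamma> \<sigma> \<gamma>' \<sigma>' :: "'a::euclidean_space"
  assumes "admissible \<gamma> \<sigma> s" "admissible \<gamma>' \<sigma>' s'" "j \<in> {1,2,3,4,5,6}"
  shows "\<exists>F\<in>affine_conformal_maps. \<exists>a b. a \<noteq> 0 \<and>
    affine_family \<gamma>' \<sigma>' s' j = rescale a b (pullback F (affine_family \<gamma> \<sigma> s j))"
proof -
  obtain f a b where "similarity f" "a \<noteq> 0"
    "affine_family \<gamma>' \<sigma>' s' j = rescale a b (\<lambda>x. affine_family \<gamma> \<sigma> s j (f x))"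
    using affine_family_orbit[OF assms] by blast
  then show ?thesis
    unfolding affine_conformal_maps_eq by (intro bexI[of _ "map_option f"]) auto
qed

theorem theorem1p2:
  fixes e1 e2 :: "real ^ 'n" and k1 k2 :: 'n
  assumes "CARD('n) \<ge> 3"
    and "k1 \<noteq> k2" and "e1 = axis k1 1" and "e2 = axis k2 1"
  shows
    \<comment> \<open>the groups and their action\<close>
    "subgroup (conformal_maps :: ((real ^ 'n) option \<Rightarrow> (real ^ 'n) option) set) (BijGroup UNIV)
   \<and> subgroup (affine_conformal_maps :: ((real ^ 'n) option \<Rightarrow> (real ^ 'n) option) set)
       (BijGroup UNIV)
   \<and> (\<forall>\<Omega> (\<phi> :: real ^ 'n \<Rightarrow> real). LCW \<Omega> \<phi> \<longrightarrow>
        (\<forall>F\<in>conformal_maps. LCW {x. F (Some x) \<in> Some ` \<Omega>} (\<lambda>x. \<phi> (the (F (Some x))))) \<and>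
        (\<forall>a b. a \<noteq> 0 \<longrightarrow> LCW \<Omega> (\<lambda>x. a * \<phi> x + b)))
   \<comment> \<open>exactly three orbits\<close>
   \<and> (\<forall>i\<in>{1,2,3}.
        (\<exists>\<Omega> \<phi>. open \<Omega> \<and> connected \<Omega> \<and> \<Omega> \<noteq> {} \<and> branch_on \<Omega> (psi e1 e2 i) \<phi>) \<and>
        (\<forall>\<Omega> \<phi>. open \<Omega> \<and> branch_on \<Omega> (psi e1 e2 i) \<phi> \<longrightarrow> LCW \<Omega> \<phi>))
   \<and> (\<forall>\<Omega> \<phi>. LCW \<Omega> \<phi> \<and> connected \<Omega> \<and> \<Omega> \<noteq> {} \<longrightarrow>
        (\<exists>!i. i \<in> {1,2,3} \<and>
           (\<exists>F\<in>conformal_maps. \<exists>a b. a \<noteq> 0 \<and>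
              branch_on \<Omega> (rescale a b (pullback F (psi e1 e2 i))) \<phi>)))
   \<comment> \<open>exactly six orbits under the affine conformal maps\<close>
   \<and> (\<forall>j\<in>{1,2,3,4,5,6}. \<forall>(\<gamma> :: real ^ 'n) \<sigma> s. admissible \<gamma> \<sigma> s \<longrightarrow>
        (\<exists>\<Omega> \<phi>. open \<Omega> \<and> connected \<Omega> \<and> \<Omega> \<noteq> {} \<and> branch_on \<Omega> (affine_family \<gamma> \<sigma> s j) \<phi>) \<and>
        (\<forall>\<Omega> \<phi>. open \<Omega> \<and> branch_on \<Omega> (affine_family \<gamma> \<sigma> s j) \<phi> \<longrightarrow> LCW \<Omega> \<phi>))
   \<and> (\<forall>j\<in>{1,2,3,4,5,6}. \<forall>(\<gamma> :: real ^ 'n) \<sigma> s \<gamma>' \<sigma>' s'.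
        admissible \<gamma> \<sigma> s \<and> admissible \<gamma>' \<sigma>' s' \<longrightarrow>
        (\<exists>F\<in>affine_conformal_maps. \<exists>a b. a \<noteq> 0 \<and>
           affine_family \<gamma>' \<sigma>' s' j = rescale a b (pullback F (affine_family \<gamma> \<sigma> s j))))
   \<and> (\<forall>\<Omega> (\<phi> :: real ^ 'n \<Rightarrow> real). LCW \<Omega> \<phi> \<and> connected \<Omega> \<and> \<Omega> \<noteq> {} \<longrightarrow>
        (\<exists>!j. j \<in> {1,2,3,4,5,6} \<and>
           (\<exists>\<gamma> \<sigma> s. admissible \<gamma> \<sigma> s \<and>
              (\<exists>F\<in>affine_conformal_maps. \<exists>a b. a \<noteq> 0 \<and>
                 branch_on \<Omega> (rescale a b (pullback F (affine_family \<gamma> \<sigma> s j))) \<phi>))))"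
proof -
  have dim: "DIM(real ^ 'n) \<ge> 3" using assms(1) by simp
  have adm: "admissible e1 e2 1"
    using assms(2) by (simp add: admissible_def assms(3,4) inner_axis_axis)
  have psi: "(\<exists>\<Omega> \<phi>. open \<Omega> \<and> connected \<Omega> \<and> \<Omega> \<noteq> {} \<and> branch_on \<Omega> (psi e1 e2 i) \<phi>) \<and>
      (\<forall>\<Omega> \<phi>. open \<Omega> \<and> branch_on \<Omega> (psi e1 e2 i) \<phi> \<longrightarrow> LCW \<Omega> \<phi>)" if i: "i \<in> {1,2,3}" for i
  proof -
    have "i \<in> {1,2,3,4,5,6}" using i by auto
    then show ?thesis
      unfolding psi_eq_affine_family[OF i, of e1 e2 1]
      using family_weight[OF adm] LCW_family[OF adm] unfolding weight_with_field_def by blast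
  qed
  show ?thesis
  proof (intro conjI)
    show "\<forall>\<Omega> (\<phi> :: real ^ 'n \<Rightarrow> real). LCW \<Omega> \<phi> \<longrightarrow>
        (\<forall>F\<in>conformal_maps. LCW {x. F (Some x) \<in> Some ` \<Omega>} (\<lambda>x. \<phi> (the (F (Some x))))) \<and>
        (\<forall>a b. a \<noteq> 0 \<longrightarrow> LCW \<Omega> (\<lambda>x. a * \<phi> x + b))"
      using LCW_conformal LCW_rescale by blast
    show "\<forall>j\<in>{1,2,3,4,5,6}. \<forall>(\<gamma> :: real ^ 'n) \<sigma> s. admissible \<gamma> \<sigma> s \<longrightarrow>
        (\<exists>\<Omega> \<phi>. open \<Omega> \<and> connected \<Omega> \<and> \<Omega> \<noteq> {} \<and> branch_on \<Omega> (affine_family \<gamma> \<sigma> s j) \<phi>) \<and>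
        (\<forall>\<Omega> \<phi>. open \<Omega> \<and> branch_on \<Omega> (affine_family \<gamma> \<sigma> s j) \<phi> \<longrightarrow> LCW \<Omega> \<phi>)"
    proof (intro ballI allI impI conjI; (elim conjE)?)
      fix j :: nat and \<gamma> \<sigma> :: "real ^ 'n" and s
      assume j: "j \<in> {1,2,3,4,5,6}" and adm: "admissible \<gamma> \<sigma> s"
      show "\<exists>\<Omega> \<phi>. open \<Omega> \<and> connected \<Omega> \<and> \<Omega> \<noteq> {} \<and> branch_on \<Omega> (affine_family \<gamma> \<sigma> s j) \<phi>"
        using family_weight[OF adm j] unfolding weight_with_field_def by blast
      fix \<Omega> \<phi> assume "open \<Omega>" "branch_on \<Omega> (affine_family \<gamma> \<sigma> s j) \<phi>"
      then show "LCW \<Omega> \<phi>" by (rule LCW_family[OF adm j])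
    qed
    show "\<forall>j\<in>{1,2,3,4,5,6}. \<forall>(\<gamma> :: real ^ 'n) \<sigma> s \<gamma>' \<sigma>' s'.
        admissible \<gamma> \<sigma> s \<and> admissible \<gamma>' \<sigma>' s' \<longrightarrow>
        (\<exists>F\<in>affine_conformal_maps. \<exists>a b. a \<noteq> 0 \<and>
           affine_family \<gamma>' \<sigma>' s' j = rescale a b (pullback F (affine_family \<gamma> \<sigma> s j)))"
    proof (intro ballI allI impI, elim conjE)
      fix j :: nat and \<gamma> \<sigma> \<gamma>' \<sigma>' :: "real ^ 'n" and s s'
      assume "j \<in> {1,2,3,4,5,6}" "admissible \<gamma> \<sigma> s" "admissible \<gamma>' \<sigma>' s'"
      then show "\<exists>F\<in>affine_conformal_maps. \<exists>a b. a \<noteq> 0 \<and>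
          affine_family \<gamma>' \<sigma>' s' j = rescale a b (pullback F (affine_family \<gamma> \<sigma> s j))"
        by (intro affine_family_orbit_map)
    qed
  qed (intro subgroup_conformal_maps subgroup_affine_conformal_maps ballI psi allI impI
      LCW_conformal_orbit[OF dim adm] LCW_affine_orbit[OF dim]; simp)+
qed

end
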